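(* Let $m \ge 1$. For a $321$-avoiding alternating permutation $v \in \mathfrak{S}_{2m-2}$, define $\phi(v) \in \mathfrak{S}_{2m}$ by $$\big(\phi(v)\big)(i) = \begin{cases} v(i)+1 & \text{if } i < 2m-1 \text{ is odd},\\ v(i-2)+1 & \text{if } i>2 \text{ is even},\\ 1 & \text{if } i=2,\\ 2m & \text{if } i = 2m-1.\end{cases}$$ Then $\phi$ is a bijection from the set of $321$-avoiding alternating permutations in $\mathfrak{S}_{2m-2}$ to the set of fully supported $321$-avoiding alternating permutations in $\mathfrak{S}_{2m}$. Moreover, the number of fully supported $w \in \mathfrak{S}_{2m}$ with $m$ forced right-perimeter tiles (equivalently, the number of fully supported $321$-avoiding alternating permutations in $\mathfrak{S}_{2m}$) is the Catalan number $C_{m-1}$.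
   Context: Permutations are written in one-line notation $w = w(1)w(2)\cdots w(n)$. A permutation $w \in \mathfrak{S}_n$ is fully supported if $\{w(1),\ldots,w(r)\} \ne \{1,\ldots,r\}$ for all $1 \le r < n$ (equivalently, every simple reflection appears in its reduced decompositions). A permutation is $321$-avoiding if there are no indices $i<j<l$ with $w(i)>w(j)>w(l)$. A permutation is alternating if $w(1)>w(2)<w(3)>w(4)<\cdots$. $\mathfrak{S}_0$ consists of the empty permutation, which is $321$-avoiding and alternating. The Catalan numbers are $C_k = \frac{1}{k+1}\binom{2k}{k}$. Elnitsky polygon. For fully supported $w \in \mathfrak{S}_n$, $n \ge 2$, Elnitsky's polygon $X(w)$ is the equilateral $2n$-gon whose sides, read counterclockwise starting at the top vertex, are labeled $1,\ldots,n,w(n),\ldots,w(1)$, such that the first $n$ sides form half of a convex $2n$-gon and sides with the same label are parallel. Concretely: fix unit vectors $v_1,\ldots,v_n$ in the plane with angles $\pi < \theta_1 < \cdots < \theta_n < 2\pi$; with the top vertex at the origin, the leftside boundary is the path with vertices $v_1+\cdots+v_k$ ($0\le k\le n$), its $k$th edge labeled $k$, and the rightside boundary is the path with vertices $v_{w(1)}+\cdots+v_{w(k)}$ ($0 \le k \le n$), its $k$th edge labeled $w(k)$. Both paths end at the bottom vertex, and $X(w)$ is the region they bound. Tilings. A rhombic tiling of $X(w)$ is an (edge-to-edge) tiling by rhombi whose edges are all congruent and parallel to edges of $X(w)$ (unit rhombi with sides parallel to $v_i$ and $v_j$, $i \ne j$). $T(w)$ is the set of all rhombic tilings of $X(w)$.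 The labels of a tile are the labels $\{i,j\}$ of the sides of $X(w)$ to which its edges are parallel. In any tiling no two tiles have the same labels, so a tile is identified with its label set: "the tile $\{x,y\}$". Perimeter tiles. A tile of $T \in T(w)$ is a right-perimeter tile if it shares two consecutive edges with the rightside boundary of $X(w)$. The tile $\{x,y\}$ is a forced right-perimeter tile for $w$ if in every $T \in T(w)$ the tile $\{x,y\}$ is present and is a right-perimeter tile. *)

theory Defs
  imports "HOL-Analysis.Analysis"
begin

text \<open>
  A permutation in the symmetric group of degree \<open>n\<close> is a function \<open>w :: nat \<Rightarrow> nat\<close> with
  \<open>w permutes {1..n}\<close>, hence the identity outside \<open>{1..n}\<close>; for \<open>n = 0\<close> the identity function
  is the empty permutation.
\<close>

definition fully_supported :: "nat \<Rightarrow> (nat \<Rightarrow> nat) \<Rightarrow> bool" where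
  "fully_supported n w \<longleftrightarrow> (\<forall>r. 1 \<le> r \<and> r < n \<longrightarrow> w ` {1..r} \<noteq> {1..r})"

definition avoids_321 :: "nat \<Rightarrow> (nat \<Rightarrow> nat) \<Rightarrow> bool" where
  "avoids_321 n w \<longleftrightarrow>
     \<not> (\<exists>i j l. 1 \<le> i \<and> i < j \<and> j < l \<and> l \<le> n \<and> w i > w j \<and> w j > w l)"

definition alternating :: "nat \<Rightarrow> (nat \<Rightarrow> nat) \<Rightarrow> bool" where
  "alternating n w \<longleftrightarrow>
     (\<forall>i. 1 \<le> i \<and> i < n \<longrightarrow> (if odd i then w i > w (Suc i) else w i < w (Suc i)))"

definition catalan :: "nat \<Rightarrow> real" where
  "catalan k = 1 / (real k + 1) * real ((2 * k) choose k)"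

definition phi :: "nat \<Rightarrow> (nat \<Rightarrow> nat) \<Rightarrow> nat \<Rightarrow> nat" where
  "phi m v i =
     (if i \<notin> {1..2 * m} then i
      else if odd i \<and> i < 2 * m - 1 then v i + 1
      else if even i \<and> i > 2 then v (i - 2) + 1
      else if i = 2 then 1
      else 2 * m)"
  \<comment> \<open>the last case is \<open>i = 2 * m - 1\<close>\<close>

text \<open>
  The plane is \<^typ>\<open>complex\<close>, and the unit vector in direction \<open>\<theta> k\<close> belongs to the label \<open>k\<close>.
  \<open>boundary_vertex \<theta> u k\<close> is the \<open>k\<close>-th vertex, counted from the top vertex 0, of the path
  whose edges are labelled \<open>u 1, u 2, \<dots>\<close>; the leftside boundary is the case \<open>u = id\<close>,
  the rightside boundary is the case \<open>u = w\<close>.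
\<close>

definition side_angles :: "nat \<Rightarrow> (nat \<Rightarrow> real) \<Rightarrow> bool" where
  "side_angles n \<theta> \<longleftrightarrow>
     strict_mono_on {1..n} \<theta> \<and> (\<forall>k\<in>{1..n}. pi < \<theta> k \<and> \<theta> k < 2 * pi)"

definition boundary_vertex :: "(nat \<Rightarrow> real) \<Rightarrow> (nat \<Rightarrow> nat) \<Rightarrow> nat \<Rightarrow> complex" where
  "boundary_vertex \<theta> u k = (\<Sum>i=1..k. cis (\<theta> (u i)))"

definition boundary_edge :: "(nat \<Rightarrow> real) \<Rightarrow> (nat \<Rightarrow> nat) \<Rightarrow> nat \<Rightarrow> complex set" where
  "boundary_edge \<theta> u k = closed_segment (boundary_vertex \<theta> u (k - 1)) (boundary_vertex \<theta> u k)"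

definition elnitsky_boundary :: "nat \<Rightarrow> (nat \<Rightarrow> real) \<Rightarrow> (nat \<Rightarrow> nat) \<Rightarrow> complex set" where
  "elnitsky_boundary n \<theta> w =
     (\<Union>k\<in>{1..n}. boundary_edge \<theta> id k) \<union> (\<Union>k\<in>{1..n}. boundary_edge \<theta> w k)"

definition elnitsky_polygon :: "nat \<Rightarrow> (nat \<Rightarrow> real) \<Rightarrow> (nat \<Rightarrow> nat) \<Rightarrow> complex set" where
  "elnitsky_polygon n \<theta> w = elnitsky_boundary n \<theta> w \<union> inside (elnitsky_boundary n \<theta> w)"

definition rhombus :: "(nat \<Rightarrow> real) \<Rightarrow> complex \<Rightarrow> nat \<Rightarrow> nat \<Rightarrow> complex set" where
  "rhombus \<theta> p i j =
     {p + a *\<^sub>R cis (\<theta> i) + b *\<^sub>R cis (\<theta> j) | a b. a \<in> {0..1} \<and> b \<in> {0..1}}"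

definition tile_with_labels ::
    "nat \<Rightarrow> (nat \<Rightarrow> real) \<Rightarrow> nat set \<Rightarrow> complex set \<Rightarrow> bool" where
  "tile_with_labels n \<theta> L R \<longleftrightarrow>
     (\<exists>p i j. i \<in> {1..n} \<and> j \<in> {1..n} \<and> i \<noteq> j \<and> L = {i, j} \<and> R = rhombus \<theta> p i j)"

text \<open>
  The \<open>face_of\<close> condition is the edge-to-edge condition: two distinct tiles meet in the empty
  set, in a common vertex or in a common edge.
\<close>

definition rhombic_tilings ::
    "nat \<Rightarrow> (nat \<Rightarrow> real) \<Rightarrow> (nat \<Rightarrow> nat) \<Rightarrow> complex set set set" where
  "rhombic_tilings n \<theta> w =
     {T. finite T
       \<and> (\<forall>R\<in>T. \<exists>L. tile_with_labels n \<theta> L R)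
       \<and> \<Union>T = elnitsky_polygon n \<theta> w
       \<and> pairwise (\<lambda>R S. interior R \<inter> interior S = {}) T
       \<and> pairwise (\<lambda>R S. (R \<inter> S) face_of R \<and> (R \<inter> S) face_of S) T}"

definition right_perimeter_tile ::
    "nat \<Rightarrow> (nat \<Rightarrow> real) \<Rightarrow> (nat \<Rightarrow> nat) \<Rightarrow> complex set \<Rightarrow> bool" where
  "right_perimeter_tile n \<theta> w R \<longleftrightarrow>
     (\<exists>k. 1 \<le> k \<and> k < n \<and>
        boundary_edge \<theta> w k edge_of R \<and> boundary_edge \<theta> w (Suc k) edge_of R)"

text \<open>
  Forced right-perimeter tiles are given by their label sets, since the position of the tile
  with a given label set may vary with the tiling.
\<close>

definition forced_right_perimeter_tiles ::
    "nat \<Rightarrow> (nat \<Rightarrow> real) \<Rightarrow> (nat \<Rightarrow> nat) \<Rightarrow> nat set set" where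
  "forced_right_perimeter_tiles n \<theta> w =
     {{x, y} | x y. x \<in> {1..n} \<and> y \<in> {1..n} \<and> x \<noteq> y \<and>
        (\<forall>T\<in>rhombic_tilings n \<theta> w. \<exists>R\<in>T.
           tile_with_labels n \<theta> {x, y} R \<and> right_perimeter_tile n \<theta> w R)}"

end

(* Let E_k be the k-th edge of the right boundary. In a tiling, the tile on E_k has labels w(k) and
   some z. Follow the strip of tiles with label z to the right: it can only end on the boundary edge
   labelled z, and it cannot cross the height of an end vertex of E_k. Hence z > w(k) forces z to stand
   before position k, and z < w(k) forces it to stand after k. If odd positions carry left-to-right
   maxima and even positions right-to-left minima, this leaves only {w(k), w(k+1)} for every odd k, so
   all m of these tiles are forced.
   Conversely, two tiles of one tiling cannot use E_{k-1}, E_k and E_k, E_{k+1}, so m forced tiles must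
   be {w(k), w(k+1)} for odd k. An inversion of w(k) on the wrong side of k can be moved next to k by
   undoing other inversions first; adding rhombi in that order yields a tiling in which the tile on E_k
   is a different one. So odd positions carry maxima and even positions minima, which is equivalent to
   being alternating and 321-avoiding.
   Such permutations are two-row standard Young tableaux, counted by ballot sequences; being fully
   supported is the strict (prime) version of the ballot condition, which phi undoes by a shift. *)
theory Submission
  imports Defs
begin

section \<open>Alternating permutations avoiding 321\<close>

text \<open>A tiling is given as a set of closed point sets, so strips and neighbours have to be
  extracted from the geometry. This works because every \<open>dir k\<close> points strictly
  downwards. Each boundary path is then a graph over the height, the polygon defined through
  \<open>inside\<close> becomes the region between two graphs, and every rhombus has two left and
  two right edges with respect to horizontal displacement. Which tile lies beside an edge is decided
  by moving a point of the edge horizontally by a small amount. The functional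
  \<open>cross (dir z)\<close> is constant along edges of label \<open>z\<close> and grows whenever
  a strip of that label is followed to the right, which gives both the termination of strips and the
  comparison with a fixed boundary vertex. Forcedness quantifies over all tilings and would be
  vacuous for a polygon without any. Both directions of the characterisation therefore need tilings
  to be constructed: one tiling bounds the number of forced tiles by \<open>m\<close>, and specially
  built ones refute a wrong inversion. They arise from sorting \<open>w\<close> by adjacent
  exchanges, each of which peels one rhombus off the right boundary.\<close>

text \<open>
  The values at even and at odd positions are then the two rows of a standard Young tableau, the
  descents being its column condition.
\<close>

definition extremal :: "nat \<Rightarrow> (nat \<Rightarrow> nat) \<Rightarrow> bool" where
  "extremal m w \<longleftrightarrow>
     (\<forall>k. odd k \<and> k < 2 * m \<longrightarrow> w (Suc k) < w k) \<and>
     (\<forall>i k. odd k \<and> k < 2 * m \<and> 1 \<le> i \<and> i < k \<longrightarrow> w i < w k) \<and>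
     (\<forall>k l. even k \<and> 1 \<le> k \<and> k < l \<and> l \<le> 2 * m \<longrightarrow> w k < w l)"

lemma extremal_descent: "extremal m w \<Longrightarrow> odd k \<Longrightarrow> k < 2 * m \<Longrightarrow> w (Suc k) < w k"
  and extremal_max: "extremal m w \<Longrightarrow> odd k \<Longrightarrow> k < 2 * m \<Longrightarrow> 1 \<le> i \<Longrightarrow> i < k \<Longrightarrow> w i < w k"
  and extremal_min: "extremal m w \<Longrightarrow> even k \<Longrightarrow> 1 \<le> k \<Longrightarrow> k < l \<Longrightarrow> l \<le> 2 * m \<Longrightarrow> w k < w l"
  unfolding extremal_def by blast+

text \<open>The descent next to a violation completes it to a 321 pattern: a larger earlier value
  before an odd \<open>k\<close> continues with \<open>w (Suc k)\<close>, and a smaller later value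
  after an even \<open>k\<close> is preceded by the value at \<open>k - 1\<close>. Conversely the
  position of the middle entry of a 321 pattern can be neither odd nor even.\<close>

lemma extremal_iff:
  assumes w: "w permutes {1..2 * m}"
  shows "avoids_321 (2 * m) w \<and> alternating (2 * m) w \<longleftrightarrow> extremal m w"
proof
  assume a: "avoids_321 (2 * m) w \<and> alternating (2 * m) w"
  have inj: "w i \<noteq> w j" if "i \<noteq> j" for i j using permutes_inj[OF w] that by (simp add: inj_eq)
  have desc: "w (Suc k) < w k" if "odd k" "k < 2 * m" for k
    using a that odd_pos[of k] unfolding alternating_def by (auto simp: Suc_le_eq)
  have avoid: False if "1 \<le> i" "i < j" "j < l" "l \<le> 2 * m" "w i > w j" "w j > w l" for i j l
    using a that unfolding avoids_321_def by blast
  show "extremal m w"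
    unfolding extremal_def
  proof (intro conjI allI impI)
    fix k assume "odd k \<and> k < 2 * m"
    then show "w (Suc k) < w k" using desc by blast
  next
    fix i k assume k: "odd k \<and> k < 2 * m \<and> 1 \<le> i \<and> i < k"
    show "w i < w k"
    proof (rule ccontr)
      assume "\<not> w i < w k"
      then have "w k < w i" using inj[of i k] k by simp
      then show False using avoid[of i k "Suc k"] desc[of k] k by simp
    qed
  next
    fix k l assume k: "even k \<and> 1 \<le> k \<and> k < l \<and> l \<le> 2 * m"
    then obtain j where j: "k = Suc j" "odd j" by (cases k) auto
    show "w k < w l"
    proof (rule ccontr)
      assume "\<not> w k < w l"
      then have "w l < w k" using inj[of k l] k by simp
      then show False using avoid[of j k l] desc[of j] k j odd_pos[of j] by simp
    qed
  qed
next
  assume e: "extremal m w"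
  have "alternating (2 * m) w"
    unfolding alternating_def using extremal_descent[OF e] extremal_min[OF e] by simp
  moreover have "avoids_321 (2 * m) w"
    unfolding avoids_321_def
  proof
    assume "\<exists>i j l. 1 \<le> i \<and> i < j \<and> j < l \<and> l \<le> 2 * m \<and> w i > w j \<and> w j > w l"
    then obtain i j l where h: "1 \<le> i" "i < j" "j < l" "l \<le> 2 * m" "w i > w j" "w j > w l" by blast
    then show False using extremal_max[OF e, of j i] extremal_min[OF e, of j l] by (cases "odd j") auto
  qed
  ultimately show "avoids_321 (2 * m) w \<and> alternating (2 * m) w" by blast
qed

lemma permutes_surjI:
  assumes "finite S" "\<And>x. x \<notin> S \<Longrightarrow> f x = x" "f ` S \<subseteq> S" "S \<subseteq> f ` S"
  shows "f permutes S"
proof (rule bij_imp_permutes)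
  have eq: "f ` S = S" using assms by blast
  then have "inj_on f S" using eq_card_imp_inj_on[OF assms(1), of f] by simp
  then show "bij_betw f S S" using eq by (simp add: bij_betw_def)
qed (use assms in auto)

text \<open>A value missing from the image is taken at a later position, so it exceeds the whole
  image. The image is thus a downward closed set of \<open>r\<close> positive integers.\<close>

lemma initial_segment_image:
  fixes n r :: nat
  assumes w: "w permutes {1..n}" and r: "r \<le> n"
    and sep: "\<And>i l. 1 \<le> i \<Longrightarrow> i \<le> r \<Longrightarrow> r < l \<Longrightarrow> l \<le> n \<Longrightarrow> w i < w l"
  shows "w ` {1..r} = {1..r}"
proof (cases "r = 0")
  case False
  let ?S = "w ` {1..r}"
  have S: "?S \<subseteq> {1..n}" using permutes_image[OF w] r by force
  have down: "y \<in> ?S" if h: "x \<in> ?S" "1 \<le> y" "y \<le> x" for x y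
  proof (rule ccontr)
    assume y: "y \<notin> ?S"
    obtain i where i: "i \<in> {1..r}" "x = w i" using h by auto
    have "y \<in> w ` {1..n}" using permutes_image[OF w] S h by force
    then obtain l where l: "l \<in> {1..n}" "y = w l" by auto
    then have "r < l" using y by (metis atLeastAtMost_iff image_eqI not_le)
    then show False using sep[of i l] i l h by auto
  qed
  have "finite ?S" "?S \<noteq> {}" using False by auto
  then have M: "Max ?S \<in> ?S" "\<And>x. x \<in> ?S \<Longrightarrow> x \<le> Max ?S" by (simp_all del: image_is_empty)
  have eq: "?S = {1..Max ?S}"
  proof
    show "?S \<subseteq> {1..Max ?S}" using M(2) S by fastforce
    show "{1..Max ?S} \<subseteq> ?S" using down[OF M(1)] by auto
  qed
  have "card ?S = r" using permutes_inj[OF w] by (simp add: card_image inj_on_subset)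
  moreover have "card ?S = Max ?S" using arg_cong[OF eq, of card] by simp
  ultimately show ?thesis using eq by simp
qed simp

text \<open>A cut after an odd position is always crossed by the descent there. For a cut after
  \<open>Suc k\<close> with \<open>k\<close> odd, the largest value before it is \<open>w k\<close>
  and the smallest value after it is \<open>w (k + 3)\<close> (or there is nothing after it), so
  this single pair decides whether the cut preserves an initial segment. In tableau terms this is
  the prime form of the column condition.\<close>

lemma fully_supported_extremal:
  assumes w: "w permutes {1..2 * m}" and e: "extremal m w"
  shows "fully_supported (2 * m) w \<longleftrightarrow> (\<forall>k. odd k \<and> k + 3 \<le> 2 * m \<longrightarrow> w (k + 3) < w k)"
proof
  assume fs: "fully_supported (2 * m) w"
  show "\<forall>k. odd k \<and> k + 3 \<le> 2 * m \<longrightarrow> w (k + 3) < w k"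
  proof (intro allI impI, rule ccontr)
    fix k assume k: "odd k \<and> k + 3 \<le> 2 * m" and n: "\<not> w (k + 3) < w k"
    have "w (k + 3) \<noteq> w k" using permutes_inj[OF w] by (simp add: inj_eq)
    then have lt: "w k < w (k + 3)" using n by simp
    have "w ` {1..Suc k} = {1..Suc k}"
    proof (rule initial_segment_image[OF w])
      show "Suc k \<le> 2 * m" using k by simp
      fix i l assume i: "1 \<le> i" "i \<le> Suc k" and l: "Suc k < l" "l \<le> 2 * m"
      have "w i \<le> w k"
        using extremal_max[OF e, of k i] extremal_descent[OF e, of k] k i
        by (cases "i < k"; cases "i = k"; cases "i = Suc k") auto
      also have "w k < w l"
      proof (cases "odd l")
        case True
        then have "l < 2 * m" using l by (metis dvd_triv_left order_less_le)
        then show ?thesis using extremal_max[OF e True, of k] k l odd_pos[of k] by auto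
      next
        case False
        then have "l = k + 3 \<or> k + 3 < l" using k l by (cases "l = k + 2") auto
        then show ?thesis using lt extremal_min[OF e, of "k + 3" l] k l by auto
      qed
      finally show "w i < w l" .
    qed
    then show False using fs k unfolding fully_supported_def by auto
  qed
next
  assume cond: "\<forall>k. odd k \<and> k + 3 \<le> 2 * m \<longrightarrow> w (k + 3) < w k"
  \<comment> \<open>An inversion across position \<open>r\<close> rules out that the first
    \<open>r\<close> values are an initial segment.\<close>
  have absurd: False if img: "w ` {1..r} = {1..r}" and a: "a \<in> {1..r}" and b: "r < b" "b \<le> 2 * m" "w b < w a" for a b r
  proof -
    have "w a \<in> {1..r}" using img a by blast
    moreover have "w b \<in> {1..2 * m}" using permutes_in_image[OF w, of b] b a by auto
    ultimately have "w b \<in> {1..r}" using b by auto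
    then obtain c where "c \<in> {1..r}" "w b = w c" using img by (metis imageE)
    then show False using permutes_inj[OF w] b by (auto simp: inj_eq)
  qed
  show "fully_supported (2 * m) w"
    unfolding fully_supported_def
  proof (intro allI impI notI)
    fix r assume r: "1 \<le> r \<and> r < 2 * m" and img: "w ` {1..r} = {1..r}"
    show False
    proof (cases "odd r")
      case True
      then show False using absurd[OF img, of r "Suc r"] extremal_descent[OF e, of r] r by auto
    next
      case False
      then obtain k where k: "r = Suc k" "odd k" using r by (cases r) auto
      have "r + 1 \<noteq> 2 * m" using False by presburger
      then have "k + 3 \<le> 2 * m" using r k by simp
      then show False using absurd[OF img, of k "k + 3"] cond k odd_pos[of k] by auto
    qed
  qed
qed

section \<open>The shift map phi and its inverse\<close>

lemma phi_simps:
  assumes "m \<ge> 1"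
  shows "odd i \<Longrightarrow> i < 2 * m - 2 \<Longrightarrow> phi m v i = v i + 1"
    "even i \<Longrightarrow> 2 < i \<Longrightarrow> i \<le> 2 * m \<Longrightarrow> phi m v i = v (i - 2) + 1"
    "phi m v 2 = 1" "phi m v (2 * m - 1) = 2 * m" "i \<notin> {1..2 * m} \<Longrightarrow> phi m v i = i"
proof -
  have "2 * m - 1 \<noteq> 2" "odd (2 * m - 1)" "2 * m - 1 \<in> {1..2 * m}" using assms by (presburger, presburger, auto)
  then show "phi m v (2 * m - 1) = 2 * m" unfolding phi_def by simp
qed (use assms odd_pos[of i] in \<open>auto simp: phi_def\<close>)

lemma position_cases:
  fixes i m :: nat
  assumes "1 \<le> i" "i \<le> 2 * m"
  obtains "odd i" "i < 2 * m - 2" | "even i" "2 < i" | "i = 2" | "i = 2 * m - 1"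
proof -
  have "odd i \<and> i < 2 * m - 2 \<or> even i \<and> 2 < i \<or> i = 2 \<or> i = 2 * m - 1" using assms by presburger
  then show ?thesis using that by blast
qed

lemma phi_permutes:
  assumes m: "m \<ge> 1" and v: "v permutes {1..2 * m - 2}"
  shows "phi m v permutes {1..2 * m}"
proof (rule permutes_surjI)
  have vin: "1 \<le> v i \<and> v i \<le> 2 * m - 2" if "1 \<le> i" "i \<le> 2 * m - 2" for i
    using permutes_in_image[OF v, of i] that by auto
  show "phi m v ` {1..2 * m} \<subseteq> {1..2 * m}"
  proof
    fix x assume "x \<in> phi m v ` {1..2 * m}"
    then obtain i where i: "1 \<le> i" "i \<le> 2 * m" "x = phi m v i" by auto
    from i(1,2) show "x \<in> {1..2 * m}"
    proof (cases rule: position_cases)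
      case 1
      then show ?thesis using i vin[of i] phi_simps(1)[OF m] by auto
    next
      case 2
      then have "1 \<le> i - 2" "i - 2 \<le> 2 * m - 2" using i by auto
      then show ?thesis using i vin[of "i - 2"] phi_simps(2)[OF m] 2 m by auto
    qed (use i m phi_simps[OF m] in auto)
  qed
  show "{1..2 * m} \<subseteq> phi m v ` {1..2 * m}"
  proof
    fix x assume x: "x \<in> {1..2 * m}"
    consider "x = 1" | "x = 2 * m" | "x - 1 \<in> {1..2 * m - 2}" using x by force
    then show "x \<in> phi m v ` {1..2 * m}"
    proof cases
      case 1
      then show ?thesis using phi_simps(3)[OF m] m by (intro image_eqI[of _ _ 2]) auto
    next
      case 2
      then show ?thesis using phi_simps(4)[OF m] m by (intro image_eqI[of _ _ "2 * m - 1"]) auto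
    next
      case 3
      then obtain j where j: "j \<in> {1..2 * m - 2}" "v j = x - 1" using permutes_image[OF v] by (metis imageE)
      show ?thesis
      proof (cases "odd j")
        case True
        then have "j < 2 * m - 2" using j(1) True unfolding atLeastAtMost_iff by presburger
        then show ?thesis using phi_simps(1)[OF m True] j x 3 by (intro image_eqI[of _ _ j]) auto
      next
        case False
        then show ?thesis using phi_simps(2)[OF m, of "j + 2"] j x 3 by (intro image_eqI[of _ _ "j + 2"]) auto
      qed
    qed
  qed
qed (use phi_simps[OF m] in auto)

text \<open>The even row moves two positions to the right, while 1 and \<open>2 * m\<close> fill the
  two free places. Hence the column condition \<open>v (Suc k) < v k\<close> turns into
  \<open>phi m v (k + 3) < phi m v k\<close>, the criterion for full support, and the descents of
  \<open>phi m v\<close> come from the maximum condition \<open>v (k - 1) < v k\<close>.\<close>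

lemma phi_extremal:
  assumes m: "m \<ge> 1" and v: "v permutes {1..2 * m - 2}" and e: "extremal (m - 1) v"
  shows "extremal m (phi m v)" "fully_supported (2 * m) (phi m v)"
proof -
  note p = phi_simps[OF m]
  have vin: "1 \<le> v i \<and> v i \<le> 2 * m - 2" if "1 \<le> i" "i \<le> 2 * m - 2" for i
    using permutes_in_image[OF v, of i] that by auto
  have e1: "v (Suc k) < v k" if "odd k" "k < 2 * m - 2" for k
    using extremal_descent[OF e, of k] that by (simp add: right_diff_distrib')
  have e2: "v i < v k" if "odd k" "k < 2 * m - 2" "1 \<le> i" "i < k" for i k
    using extremal_max[OF e, of k i] that by (simp add: right_diff_distrib')
  have e3: "v k < v l" if "even k" "1 \<le> k" "k < l" "l \<le> 2 * m - 2" for k l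
    using extremal_min[OF e, of k l] that by (simp add: right_diff_distrib')
  have max_top: "phi m v i < 2 * m" if "1 \<le> i" "i \<le> 2 * m" "i \<noteq> 2 * m - 1" for i
    using that(1,2)
  proof (cases rule: position_cases)
    case 1
    then show ?thesis using vin[of i] p(1) that by auto
  next
    case 2
    then have "1 \<le> i - 2" "i - 2 \<le> 2 * m - 2" using that by auto
    then show ?thesis using vin[of "i - 2"] p(2) that 2 m by auto
  qed (use p m that in auto)
  have min_bot: "1 < phi m v i" if "1 \<le> i" "i \<le> 2 * m" "i \<noteq> 2" for i
    using that(1,2)
  proof (cases rule: position_cases)
    case 1
    then show ?thesis using vin[of i] p(1) that by auto
  next
    case 2
    then have "1 \<le> i - 2" "i - 2 \<le> 2 * m - 2" using that by auto
    then show ?thesis using vin[of "i - 2"] p(2) that 2 m by auto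
  qed (use p m that in auto)
  show ext: "extremal m (phi m v)"
    unfolding extremal_def
  proof (intro conjI allI impI)
    fix k assume k: "odd k \<and> k < 2 * m"
    show "phi m v (Suc k) < phi m v k"
    proof (cases "k = 2 * m - 1")
      case True
      then show ?thesis using max_top[of "Suc k"] p(4) k by simp
    next
      case False
      then have "k < 2 * m - 2" using k by presburger
      then have k': "phi m v k = v k + 1" "k < 2 * m - 2" using p(1) k by auto
      show ?thesis
      proof (cases "k = 1")
        case True
        then show ?thesis using k' p(3) vin[of 1] by (simp add: numeral_2_eq_2)
      next
        case False
        then have "2 < Suc k" "1 \<le> k - 1" using k by (auto, presburger+)
        then show ?thesis using k' p(2)[of "Suc k"] e2[of k "k - 1"] k by simp
      qed
    qed
  next
    fix i k assume k: "odd k \<and> k < 2 * m \<and> 1 \<le> i \<and> i < k"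
    show "phi m v i < phi m v k"
    proof (cases "k = 2 * m - 1")
      case True
      then show ?thesis using max_top[of i] p(4) k by simp
    next
      case False
      then have "k < 2 * m - 2" using k by presburger
      then have k': "phi m v k = v k + 1" "k < 2 * m - 2" using p(1) k by auto
      have "1 \<le> i" "i \<le> 2 * m" using k by auto
      then show ?thesis
      proof (cases rule: position_cases)
        case 1
        then show ?thesis using p(1) k' k e2[of k i] by simp
      next
        case 2
        then have "1 \<le> i - 2" "i - 2 < k" using k by auto
        then show ?thesis using p(2) k' k e2[of k "i - 2"] 2 by simp
      qed (use k k' p(3) vin[of k] in auto)
    qed
  next
    fix k l assume k: "even k \<and> 1 \<le> k \<and> k < l \<and> l \<le> 2 * m"
    show "phi m v k < phi m v l"
    proof (cases "k = 2")
      case True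
      then show ?thesis using min_bot[of l] p(3) k by simp
    next
      case False
      then have "2 < k" using k by (metis One_nat_def Suc_1 dvd_imp_le nat_less_le order_less_le_trans zero_less_one)
      then have k': "phi m v k = v (k - 2) + 1" "1 \<le> k - 2" "even (k - 2)" using p(2) k by auto
      have "1 \<le> l" "l \<le> 2 * m" using k by auto
      then show ?thesis
      proof (cases rule: position_cases)
        case 1
        then have "k - 2 < l" using k by auto
        then show ?thesis using p(1) k' k e3[of "k - 2" l] 1 by simp
      next
        case 2
        then have "k - 2 < l - 2" "l - 2 \<le> 2 * m - 2" using k \<open>2 < k\<close> by auto
        then show ?thesis using p(2) k' k e3[of "k - 2" "l - 2"] 2 by simp
      next
        case 4
        then show ?thesis using max_top[of k] p(4) k by (cases "k = 2 * m - 1") auto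
      qed (use k in auto)
    qed
  qed
  show "fully_supported (2 * m) (phi m v)"
    unfolding fully_supported_extremal[OF phi_permutes[OF m v] ext]
  proof (intro allI impI)
    fix k assume k: "odd k \<and> k + 3 \<le> 2 * m"
    then have "phi m v k = v k + 1" "phi m v (k + 3) = v (Suc k) + 1" using p(1)[of k] p(2)[of "k + 3"] odd_pos[of k] by auto
    moreover have "k < 2 * m - 2" using k by linarith
    ultimately show "phi m v (k + 3) < phi m v k" using e1[of k] k by simp
  qed
qed

text \<open>The row conditions force the value 1 to position 2 and the value \<open>2 * m\<close> to
  position \<open>2 * m - 1\<close>. Deleting both and moving the even row back by two positions
  gives \<open>v\<close>; its descents are exactly what full support of \<open>w\<close>
  supplies.\<close>

lemma phi_surj:
  assumes m: "m \<ge> 1" and w: "w permutes {1..2 * m}" and e: "extremal m w" and fs: "fully_supported (2 * m) w"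
  obtains v where "v permutes {1..2 * m - 2}" "extremal (m - 1) v" "phi m v = w"
proof -
  have win: "1 \<le> w i \<and> w i \<le> 2 * m" if "1 \<le> i" "i \<le> 2 * m" for i
    using permutes_in_image[OF w, of i] that by auto
  have inj: "i = j" if "w i = w j" for i j using permutes_inj[OF w] that by (simp add: inj_eq)
  have fs': "w (k + 3) < w k" if "odd k" "k + 3 \<le> 2 * m" for k
    using fs fully_supported_extremal[OF w e] that by blast
  have w2: "w 2 = 1"
  proof -
    have "1 \<in> w ` {1..2 * m}" using permutes_image[OF w] m by simp
    then obtain j where j: "j \<in> {1..2 * m}" "w j = 1" by (metis imageE)
    have "even j"
    proof (rule ccontr)
      assume "odd j"
      then have "j \<noteq> 2 * m" by auto
      then show False using extremal_descent[OF e \<open>odd j\<close>] j win[of "Suc j"] by auto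
    qed
    moreover have "j = 2"
    proof (rule ccontr)
      assume "j \<noteq> 2"
      then have "2 < j" using \<open>even j\<close> j by (metis One_nat_def Suc_1 atLeastAtMost_iff dvd_imp_le nat_less_le order_less_le_trans zero_less_one)
      then show False using extremal_min[OF e, of 2 j] j win[of 2] by auto
    qed
    ultimately show ?thesis using j by simp
  qed
  have wt: "w (2 * m - 1) = 2 * m"
  proof -
    have "2 * m \<in> w ` {1..2 * m}" using permutes_image[OF w] m by simp
    then obtain j where j: "j \<in> {1..2 * m}" "w j = 2 * m" by (metis imageE)
    have "odd j"
    proof
      assume "even j"
      then obtain i where "j = Suc i" "odd i" using j by (cases j) auto
      then show False using extremal_descent[OF e, of i] j win[of i] odd_pos[of i] by auto
    qed
    moreover have "j = 2 * m - 1"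
    proof (rule ccontr)
      assume "j \<noteq> 2 * m - 1"
      moreover have "j \<noteq> 2 * m" using \<open>odd j\<close> by auto
      ultimately have "j < 2 * m - 1" using j by auto
      then show False using extremal_max[OF e, of "2 * m - 1" j] j m win[of "2 * m - 1"] by auto
    qed
    ultimately show ?thesis using j by simp
  qed
  define v where "v i = (if i \<notin> {1..2 * m - 2} then i else if odd i then w i - 1 else w (i + 2) - 1)" for i
  have vo: "v i = w i - 1" if "odd i" "i \<le> 2 * m - 2" for i using that odd_pos[of i] by (auto simp: v_def)
  have ve: "v i = w (i + 2) - 1" if "even i" "1 \<le> i" "i \<le> 2 * m - 2" for i using that by (auto simp: v_def)
  have big: "2 \<le> w i" if "1 \<le> i" "i \<le> 2 * m" "i \<noteq> 2" for i
    using win[of i] inj[of i 2] w2 that by fastforce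
  have small: "w i \<le> 2 * m - 1" if "1 \<le> i" "i \<le> 2 * m" "i \<noteq> 2 * m - 1" for i
    using win[of i] inj[of i "2 * m - 1"] wt that by fastforce
  have vp: "v permutes {1..2 * m - 2}"
  proof (rule permutes_surjI)
    show "v ` {1..2 * m - 2} \<subseteq> {1..2 * m - 2}"
    proof
      fix x assume "x \<in> v ` {1..2 * m - 2}"
      then obtain i where i: "1 \<le> i" "i \<le> 2 * m - 2" "x = v i" by auto
      then have "i \<le> 2 * m" "i \<noteq> 2 * m - 1" "i + 2 \<le> 2 * m" "even i \<Longrightarrow> i + 2 \<noteq> 2 * m - 1" "odd i \<Longrightarrow> i \<noteq> 2"
        by (auto, presburger)
      then show "x \<in> {1..2 * m - 2}"
        using i big[of i] small[of i] big[of "i + 2"] small[of "i + 2"] vo[of i] ve[of i] by (cases "odd i") auto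
    qed
    show "{1..2 * m - 2} \<subseteq> v ` {1..2 * m - 2}"
    proof
      fix x assume x: "x \<in> {1..2 * m - 2}"
      then have "x + 1 \<in> w ` {1..2 * m}" using permutes_image[OF w] by auto
      then obtain j where j: "j \<in> {1..2 * m}" "w j = x + 1" by (metis imageE)
      have ne: "j \<noteq> 2" "j \<noteq> 2 * m - 1" using j w2 wt x by auto
      have "1 \<le> j" "j \<le> 2 * m" using j by auto
      then show "x \<in> v ` {1..2 * m - 2}"
      proof (cases rule: position_cases)
        case 1
        then show ?thesis using vo[of j] j by (intro image_eqI[of _ _ j]) auto
      next
        case 2
        then have "j - 2 + 2 = j" "1 \<le> j - 2" "j - 2 \<le> 2 * m - 2" "even (j - 2)" using j by auto
        then show ?thesis using ve[of "j - 2"] j by (intro image_eqI[of _ _ "j - 2"]) auto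
      qed (use ne in auto)
    qed
  qed (auto simp: v_def)
  have lt: "a - 1 < b - 1" if "1 \<le> a" "a < b" for a b :: nat using that by simp
  have "extremal (m - 1) v"
    unfolding extremal_def
  proof (intro conjI allI impI)
    fix k assume "odd k \<and> k < 2 * (m - 1)"
    then have k: "odd k" "k < 2 * m - 2" by auto
    then have "v k = w k - 1" "v (Suc k) = w (k + 3) - 1" using vo[of k] ve[of "Suc k"] by (auto simp: numeral_3_eq_3)
    then show "v (Suc k) < v k" using lt[of "w (k + 3)" "w k"] fs'[of k] k win[of "k + 3"] by auto
  next
    fix i k assume "odd k \<and> k < 2 * (m - 1) \<and> 1 \<le> i \<and> i < k"
    then have k: "odd k" "k < 2 * m - 2" "1 \<le> i" "i < k" by auto
    have vk: "v k = w k - 1" using vo k by simp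
    show "v i < v k"
    proof (cases "odd i")
      case True
      then show ?thesis using vk vo[of i] lt[of "w i" "w k"] extremal_max[OF e, of k i] k win[of i] by simp
    next
      case False
      have "w (i + 2) < w k"
      proof (cases "i + 2 < k")
        case True
        then show ?thesis using extremal_max[OF e, of k "i + 2"] k by simp
      next
        case c: False
        then have "i + 2 = Suc k" using k False by presburger
        then show ?thesis using extremal_descent[OF e, of k] k by simp
      qed
      then show ?thesis using vk ve[of i] lt[of "w (i + 2)" "w k"] False k win[of "i + 2"] by simp
    qed
  next
    fix k l assume "even k \<and> 1 \<le> k \<and> k < l \<and> l \<le> 2 * (m - 1)"
    then have k: "even k" "1 \<le> k" "k < l" "l \<le> 2 * m - 2" by auto
    have vk: "v k = w (k + 2) - 1" using ve k by simp
    have wk: "1 \<le> w (k + 2)" using win[of "k + 2"] k by simp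
    show "v k < v l"
    proof (cases "odd l")
      case False
      then show ?thesis using vk ve[of l] lt[OF wk, of "w (l + 2)"] extremal_min[OF e, of "k + 2" "l + 2"] k by simp
    next
      case True
      have "w (k + 2) < w l"
      proof (cases "k + 2 < l")
        case True
        then show ?thesis using extremal_min[OF e, of "k + 2" l] k by simp
      next
        case c: False
        then have "k + 2 = Suc l" using k True by presburger
        then show ?thesis using extremal_descent[OF e, of l] k True by simp
      qed
      then show ?thesis using vk vo[of l] lt[OF wk] True k by simp
    qed
  qed
  moreover have "phi m v = w"
  proof
    fix i
    show "phi m v i = w i"
    proof (cases "i \<in> {1..2 * m}")
      case False
      then show ?thesis using phi_simps(5)[OF m] permutes_not_in[OF w] by metis
    next
      case True
      then have i: "1 \<le> i" "i \<le> 2 * m" by auto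
      then show ?thesis
      proof (cases rule: position_cases)
        case 1
        then show ?thesis using phi_simps(1)[OF m] vo[of i] win[OF i] by simp
      next
        case 2
        then have "i - 2 + 2 = i" "1 \<le> i - 2" "i - 2 \<le> 2 * m - 2" "even (i - 2)" using i by auto
        then have "v (i - 2) = w i - 1" using ve[of "i - 2"] by simp
        then show ?thesis using phi_simps(2)[OF m] win[OF i] i 2 by simp
      qed (use phi_simps[OF m] w2 wt in auto)
    qed
  qed
  ultimately show ?thesis using that vp by blast
qed

lemma phi_inj:
  assumes m: "m \<ge> 1" and v: "v permutes {1..2 * m - 2}" "v' permutes {1..2 * m - 2}" and eq: "phi m v = phi m v'"
  shows "v = v'"
proof
  fix i
  show "v i = v' i"
  proof (cases "i \<in> {1..2 * m - 2}")
    case False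
    then show ?thesis using permutes_not_in[OF v(1)] permutes_not_in[OF v(2)] by metis
  next
    case True
    show ?thesis
    proof (cases "odd i")
      case o: True
      then have "i < 2 * m - 2" using True o unfolding atLeastAtMost_iff by presburger
      then show ?thesis using phi_simps(1)[OF m o, of v] phi_simps(1)[OF m o, of v'] eq by simp
    next
      case False
      then show ?thesis using phi_simps(2)[OF m, of "i + 2" v] phi_simps(2)[OF m, of "i + 2" v'] eq True by auto
    qed
  qed
qed

lemma bij_betw_phi:
  assumes m: "m \<ge> 1"
  shows "bij_betw (phi m)
     {v. v permutes {1..2 * m - 2} \<and> avoids_321 (2 * m - 2) v \<and> alternating (2 * m - 2) v}
     {w. w permutes {1..2 * m} \<and> fully_supported (2 * m) w \<and> avoids_321 (2 * m) w \<and> alternating (2 * m) w}"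
proof -
  have A: "{v. v permutes {1..2 * m - 2} \<and> avoids_321 (2 * m - 2) v \<and> alternating (2 * m - 2) v}
    = {v. v permutes {1..2 * m - 2} \<and> extremal (m - 1) v}"
    using extremal_iff[of _ "m - 1"] by (auto simp: right_diff_distrib')
  have B: "{w. w permutes {1..2 * m} \<and> fully_supported (2 * m) w \<and> avoids_321 (2 * m) w \<and> alternating (2 * m) w}
    = {w. w permutes {1..2 * m} \<and> fully_supported (2 * m) w \<and> extremal m w}"
    using extremal_iff[of _ m] by auto
  show ?thesis unfolding A B bij_betw_def
  proof
    show "inj_on (phi m) {v. v permutes {1..2 * m - 2} \<and> extremal (m - 1) v}"
      using phi_inj[OF m] by (auto intro: inj_onI)
    show "phi m ` {v. v permutes {1..2 * m - 2} \<and> extremal (m - 1) v} =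
      {w. w permutes {1..2 * m} \<and> fully_supported (2 * m) w \<and> extremal m w}"
    proof (intro equalityI subsetI)
      fix w assume "w \<in> phi m ` {v. v permutes {1..2 * m - 2} \<and> extremal (m - 1) v}"
      then show "w \<in> {w. w permutes {1..2 * m} \<and> fully_supported (2 * m) w \<and> extremal m w}"
        using phi_permutes[OF m] phi_extremal[OF m] by auto
    next
      fix w assume "w \<in> {w. w permutes {1..2 * m} \<and> fully_supported (2 * m) w \<and> extremal m w}"
      then obtain v where "v permutes {1..2 * m - 2}" "extremal (m - 1) v" "phi m v = w"
        using phi_surj[OF m] by blast
      then show "w \<in> phi m ` {v. v permutes {1..2 * m - 2} \<and> extremal (m - 1) v}" by blast
    qed
  qed
qed

text \<open>\<open>A\<close> is the set of times of the up steps in a ballot sequence of length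
  \<open>N\<close>. Length and number of up steps are kept independent so that the last step can be
  removed in an induction.\<close>

definition ballot_sets :: "nat \<Rightarrow> nat \<Rightarrow> nat set set" where
  "ballot_sets N a = {A. A \<subseteq> {1..N} \<and> card A = a \<and> (\<forall>j\<le>N. j \<le> 2 * card (A \<inter> {1..j}))}"

lemma finite_ballot_sets: "finite (ballot_sets N a)"
  by (rule finite_subset[of _ "Pow {1..N}"]) (auto simp: ballot_sets_def)

lemma ballot_sets_empty: "2 * a < N \<Longrightarrow> ballot_sets N a = {}"
  unfolding ballot_sets_def by (auto simp: Int_absorb2)

text \<open>The two parts are the sequences whose last step is up or down. The assumption is the
  ballot condition at the full length, the only one that a shorter sequence does not supply.\<close>

lemma ballot_sets_Suc:
  assumes "Suc N \<le> 2 * a"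
  shows "ballot_sets (Suc N) a = insert (Suc N) ` ballot_sets N (a - 1) \<union> ballot_sets N a"
proof (intro equalityI subsetI)
  fix A assume "A \<in> ballot_sets (Suc N) a"
  then have A: "A \<subseteq> {1..Suc N}" "card A = a" "\<And>j. j \<le> Suc N \<Longrightarrow> j \<le> 2 * card (A \<inter> {1..j})"
    by (auto simp: ballot_sets_def)
  show "A \<in> insert (Suc N) ` ballot_sets N (a - 1) \<union> ballot_sets N a"
  proof (cases "Suc N \<in> A")
    case True
    let ?B = "A - {Suc N}"
    have "finite A" using A(1) finite_subset by blast
    then have "card ?B = a - 1" using A(2) True by simp
    moreover have "?B \<subseteq> {1..N}" using A(1) by (auto simp: le_Suc_eq)
    moreover have "?B \<inter> {1..j} = A \<inter> {1..j}" if "j \<le> N" for j using that by auto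
    ultimately have "?B \<in> ballot_sets N (a - 1)" using A(3) by (simp add: ballot_sets_def)
    moreover have "A = insert (Suc N) ?B" using True by blast
    ultimately show ?thesis by blast
  next
    case False
    then have "A \<subseteq> {1..N}" using A(1) by (auto simp: le_Suc_eq)
    then show ?thesis using A by (simp add: ballot_sets_def)
  qed
next
  fix A assume "A \<in> insert (Suc N) ` ballot_sets N (a - 1) \<union> ballot_sets N a"
  then show "A \<in> ballot_sets (Suc N) a"
  proof
    assume "A \<in> insert (Suc N) ` ballot_sets N (a - 1)"
    then obtain B where B: "A = insert (Suc N) B" "B \<subseteq> {1..N}" "card B = a - 1"
      "\<And>j. j \<le> N \<Longrightarrow> j \<le> 2 * card (B \<inter> {1..j})" by (auto simp: ballot_sets_def)
    have "finite B" "Suc N \<notin> B" using B(2) finite_subset by auto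
    then have c: "card A = a" using B assms by simp
    have sub: "A \<subseteq> {1..Suc N}" using B by auto
    have "j \<le> 2 * card (A \<inter> {1..j})" if "j \<le> Suc N" for j
    proof (cases "j = Suc N")
      case True
      then show ?thesis using c sub assms by (simp add: Int_absorb2)
    next
      case False
      then have "A \<inter> {1..j} = B \<inter> {1..j}" using that B by auto
      then show ?thesis using B(4)[of j] that False by simp
    qed
    then show ?thesis using c sub by (simp add: ballot_sets_def)
  next
    assume "A \<in> ballot_sets N a"
    then have A: "A \<subseteq> {1..N}" "card A = a" "\<And>j. j \<le> N \<Longrightarrow> j \<le> 2 * card (A \<inter> {1..j})"
      by (auto simp: ballot_sets_def)
    have sub: "A \<subseteq> {1..Suc N}" using A(1) by auto
    have "j \<le> 2 * card (A \<inter> {1..j})" if "j \<le> Suc N" for j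
      using A(2,3) sub assms that by (cases "j = Suc N") (auto simp: Int_absorb2 le_Suc_eq)
    then show ?thesis using A(2) sub by (simp add: ballot_sets_def)
  qed
qed

text \<open>The truncated subtraction makes the formula cover the empty case \<open>2 * a < N\<close>.\<close>

lemma card_ballot_sets: "(a + 1) * card (ballot_sets N a) = (2 * a + 1 - N) * (N choose a)"
proof (induction N arbitrary: a)
  case 0
  have "ballot_sets 0 a = (if a = 0 then {{}} else {})" by (auto simp: ballot_sets_def)
  then show ?case by (cases a) auto
next
  case (Suc N)
  show ?case
  proof (cases "2 * a < Suc N")
    case True
    then show ?thesis by (simp add: ballot_sets_empty)
  next
    case False
    then obtain b where a: "a = Suc b" by (cases a) auto
    have le: "Suc N \<le> 2 * a" using False by simp
    have "Suc N \<notin> A" if "A \<in> ballot_sets N c" for A c using that by (auto simp: ballot_sets_def)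
    then have "inj_on (insert (Suc N)) (ballot_sets N b)"
      by (intro inj_onI) (metis insert_ident)
    moreover have "insert (Suc N) ` ballot_sets N b \<inter> ballot_sets N a = {}"
      using \<open>\<And>c A. A \<in> ballot_sets N c \<Longrightarrow> Suc N \<notin> A\<close> by auto
    ultimately have c: "card (ballot_sets (Suc N) a) = card (ballot_sets N b) + card (ballot_sets N a)"
      using ballot_sets_Suc[OF le] finite_ballot_sets by (simp add: a card_Un_disjoint card_image)
    \<comment> \<open>In this case the truncated differences are true ones, so the recurrence can be
      checked over the integers. \<open>x\<close> and \<open>y\<close> are neighbouring binomial
      coefficients, linked by the absorption identity \<open>xy\<close>.\<close>
    define f g x y where "f = int (card (ballot_sets N b))" and "g = int (card (ballot_sets N a))"
      and "x = int (N choose b)" and "y = int (N choose a)"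
    have n1: "N \<le> 2 * b + 1" "N \<le> 2 * a + 1" using le a by auto
    have e: "int (2 * b + 1 - N) = 2 * int b + 1 - int N" "int (2 * a + 1 - N) = 2 * int b + 3 - int N"
      using n1 a by auto
    have f: "(int b + 1) * f = (2 * int b + 1 - int N) * x"
      using arg_cong[OF Suc.IH[of b], of int] unfolding of_nat_mult e f_def x_def by (simp add: algebra_simps)
    have g: "(int b + 2) * g = (2 * int b + 3 - int N) * y"
      using arg_cong[OF Suc.IH[of a], of int] unfolding of_nat_mult e g_def y_def by (simp add: a algebra_simps)
    have xy: "(int b + 1) * y = (int N - int b) * x"
    proof (cases "b \<le> N")
      case True
      have "Suc b * (N choose Suc b) = (N - b) * (N choose b)"
        using binomial_absorb_comp[of N b] binomial_absorption[of b N] by simp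
      then have "int (Suc b) * int (N choose Suc b) = int (N - b) * int (N choose b)"
        by (simp only: of_nat_mult[symmetric])
      then show ?thesis using True by (simp add: x_def y_def a of_nat_diff add.commute)
    qed (simp add: x_def y_def a binomial_eq_0)
    \<comment> \<open>The positive factor \<open>int b + 1\<close> is what makes the equations for
      \<open>f\<close> and \<open>y\<close> applicable; it is cancelled afterwards.\<close>
    have "(int b + 1) * ((int b + 2) * (f + g)) = (int b + 1) * ((2 * int b + 2 - int N) * (x + y))"
      using f g xy by algebra
    then have step: "(int b + 2) * (f + g) = (2 * int b + 2 - int N) * (x + y)" by simp
    have "int (2 * a + 1 - Suc N) = 2 * int b + 2 - int N" using le a by auto
    moreover have "int (Suc N choose a) = x + y" by (simp add: x_def y_def a)
    moreover have "int (card (ballot_sets (Suc N) a)) = f + g" unfolding c by (simp add: f_def g_def)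
    moreover have "int (a + 1) = int b + 2" by (simp add: a)
    ultimately have "int ((a + 1) * card (ballot_sets (Suc N) a)) = int ((2 * a + 1 - Suc N) * (Suc N choose a))"
      using step by (simp only: of_nat_mult)
    then show ?thesis by (simp only: of_nat_eq_iff)
  qed
qed

lemma card_ballot_sets_catalan: "real (card (ballot_sets (2 * k) k)) = catalan k"
proof -
  have "real (k + 1) * real (card (ballot_sets (2 * k) k)) = real ((2 * k) choose k)"
    using arg_cong[OF card_ballot_sets[of k "2 * k"], of real] by (simp only: of_nat_mult) simp
  then show ?thesis by (simp add: catalan_def field_simps)
qed

text \<open>Either function maps the sorted list of \<open>E\<close> to the sorted list of the
  common image.\<close>

lemma strict_mono_on_image_unique:
  fixes f g :: "nat \<Rightarrow> nat"
  assumes "finite E" "strict_mono_on E f" "strict_mono_on E g" "f ` E = g ` E" "x \<in> E"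
  shows "f x = g x"
proof -
  let ?l = "sorted_list_of_set E"
  have s: "sorted_wrt (<) ?l" by simp
  have "sorted_wrt (<) (map h ?l)" if "strict_mono_on E h" for h
    unfolding sorted_wrt_map using s by (rule sorted_wrt_mono_rel[rotated]) (use that assms(1) in \<open>auto simp: strict_mono_on_def\<close>)
  then have "map f ?l = map g ?l"
    using assms by (intro strict_sorted_equal) auto
  then show ?thesis using assms by simp
qed

section \<open>Rows of a tableau and ballot sets\<close>

definition evens :: "nat \<Rightarrow> nat set" where "evens k = {i \<in> {1..2 * k}. even i}"

definition odds :: "nat \<Rightarrow> nat set" where "odds k = {i \<in> {1..2 * k}. odd i}"

lemma evens_eq: "evens k = (\<lambda>s. 2 * s) ` {1..k}"
proof (intro equalityI subsetI)
  fix i assume "i \<in> evens k"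
  then show "i \<in> (\<lambda>s. 2 * s) ` {1..k}" by (intro image_eqI[of _ _ "i div 2"]) (auto simp: evens_def elim!: evenE)
qed (auto simp: evens_def)

lemma card_evens: "card (evens k) = k"
  unfolding evens_eq by (subst card_image) (auto intro: inj_onI)

lemma extremal_mono:
  assumes "extremal k v"
  shows "strict_mono_on (evens k) v" "strict_mono_on (odds k) v"
proof -
  have "i < 2 * k" if "odd i" "i \<le> 2 * k" for i using that by (metis dvd_triv_left order_less_le)
  then show "strict_mono_on (evens k) v" "strict_mono_on (odds k) v"
    using extremal_min[OF assms] extremal_max[OF assms]
    by (auto simp: strict_mono_on_def evens_def odds_def)
qed

text \<open>Passing from position \<open>i\<close> to \<open>Suc i\<close> sends each value at an
  odd position to a smaller one at an even position, injectively. So among the values up to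
  \<open>j\<close> at least half stand at even positions.\<close>

lemma extremal_ballot:
  assumes v: "v permutes {1..2 * k}" and e: "extremal k v"
  shows "v ` evens k \<in> ballot_sets (2 * k) k"
proof -
  have inj: "inj v" using permutes_inj[OF v] .
  have sub: "v ` evens k \<subseteq> {1..2 * k}" using permutes_image[OF v] by (auto simp: evens_def)
  have "card (v ` evens k) = k" using inj card_evens by (simp add: card_image inj_on_subset)
  moreover have "j \<le> 2 * card (v ` evens k \<inter> {1..j})" if j: "j \<le> 2 * k" for j
  proof -
    let ?A = "v ` evens k \<inter> {1..j}" and ?C = "v ` odds k \<inter> {1..j}"
    have fin: "finite ?A" "finite ?C" by simp_all
    have "{1..2 * k} = evens k \<union> odds k" by (auto simp: evens_def odds_def)
    then have all: "v ` evens k \<union> v ` odds k = {1..2 * k}" using permutes_image[OF v] by (metis image_Un)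
    have "?A \<union> ?C = (v ` evens k \<union> v ` odds k) \<inter> {1..j}" by blast
    also have "\<dots> = {1..j}" unfolding all using j by auto
    finally have "{1..j} = ?A \<union> ?C" by (rule sym)
    then have "card {1..j} = card (?A \<union> ?C)" by (rule arg_cong)
    then have "j \<le> card ?A + card ?C" using card_Un_le[of ?A ?C] by simp
    moreover have "card ?C \<le> card ?A"
    proof (rule card_inj_on_le[of "\<lambda>x. v (Suc (inv v x))"])
      show "inj_on (\<lambda>x. v (Suc (inv v x))) ?C"
        using inj permutes_inverses[OF v] by (intro inj_onI) (metis injD nat.inject)
      show "(\<lambda>x. v (Suc (inv v x))) ` ?C \<subseteq> ?A"
      proof
        fix y assume "y \<in> (\<lambda>x. v (Suc (inv v x))) ` ?C"
        then obtain i where i: "i \<in> odds k" "v i \<le> j" "y = v (Suc i)" using permutes_inverses[OF v] by auto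
        then have "i < 2 * k" unfolding odds_def by (metis (no_types, lifting) atLeastAtMost_iff dvd_triv_left mem_Collect_eq order_less_le)
        then have "v (Suc i) < v i" "Suc i \<in> evens k" using i extremal_descent[OF e, of i] by (auto simp: odds_def evens_def)
        then show "y \<in> ?A" using i sub by force
      qed
    qed simp
    ultimately show ?thesis by linarith
  qed
  ultimately show ?thesis using sub by (simp add: ballot_sets_def)
qed

text \<open>The increasing enumerations \<open>h\<close> of \<open>A\<close> and \<open>g\<close> of
  its complement are the two rows; the ballot condition is needed only for the columns
  \<open>h s < g s\<close>.\<close>

lemma ballot_extremal:
  assumes A: "A \<in> ballot_sets (2 * k) k"
  obtains v where "v permutes {1..2 * k}" "extremal k v" "v ` evens k = A"
proof -
  have sub: "A \<subseteq> {1..2 * k}" and cA: "card A = k" and bal: "\<And>j. j \<le> 2 * k \<Longrightarrow> j \<le> 2 * card (A \<inter> {1..j})"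
    using A by (auto simp: ballot_sets_def)
  define C where "C = {1..2 * k} - A"
  have fin: "finite A" "finite C" using sub finite_subset C_def by auto
  have cC: "card C = k" unfolding C_def using sub cA fin by (simp add: card_Diff_subset)
  obtain h where h: "bij_betw h {0..<k} A" "strict_mono_on {0..<k} h"
    using ex_bij_betw_strict_mono_card[OF fin(1)] cA by (metis lessThan_atLeast0)
  obtain g where g: "bij_betw g {0..<k} C" "strict_mono_on {0..<k} g"
    using ex_bij_betw_strict_mono_card[OF fin(2)] cC by (metis lessThan_atLeast0)
  have hA: "h ` {0..<k} = A" and gC: "g ` {0..<k} = C" using h g by (auto simp: bij_betw_def)
  have hm: "h s < h t" if "s < t" "t < k" for s t using h(2) that by (auto simp: strict_mono_on_def)
  have gm: "g s < g t" if "s < t" "t < k" for s t using g(2) that by (auto simp: strict_mono_on_def)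
  have hg: "h s < g s" if s: "s < k" for s
  proof (rule ccontr)
    assume "\<not> h s < g s"
    moreover have gs: "g s \<in> C" "h s \<in> A" using s hA gC by auto
    ultimately have lt: "g s < h s" using C_def by (metis DiffD2 linorder_neqE_nat)
    \<comment> \<open>If the column \<open>s\<close> failed, the numbers up to \<open>g s\<close>
      would comprise \<open>s + 1\<close> elements of the complement but at most \<open>s\<close>
      elements of \<open>A\<close>, against the ballot condition at this point.\<close>
    let ?j = "g s"
    have j: "?j \<le> 2 * k" using gs C_def by auto
    have subA: "A \<inter> {1..?j} \<subseteq> h ` {0..<s}"
    proof
      fix x assume x: "x \<in> A \<inter> {1..?j}"
      then obtain t where t: "t < k" "x = h t" using hA by auto
      have "t < s" using hm[of s t] t x lt by (cases "t = s"; cases "s < t") auto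
      then show "x \<in> h ` {0..<s}" using t by auto
    qed
    have "card (A \<inter> {1..?j}) \<le> card (h ` {0..<s})" using subA by (intro card_mono) simp_all
    also have "\<dots> \<le> s" using card_image_le[of "{0..<s}" h] by simp
    finally have "card (A \<inter> {1..?j}) \<le> s" .
    moreover have ss: "{0..<Suc s} \<subseteq> {0..<k}" using s by auto
    have "inj_on g {0..<Suc s}" using bij_betw_imp_inj_on[OF g(1)] ss by (rule inj_on_subset)
    then have "card (g ` {0..<Suc s}) = Suc s" by (simp add: card_image)
    moreover have "g ` {0..<Suc s} \<subseteq> C" using image_mono[OF ss, of g] gC by blast
    then have "g ` {0..<Suc s} \<inter> (A \<inter> {1..?j}) = {}" unfolding C_def by blast
    then have "card (g ` {0..<Suc s} \<union> (A \<inter> {1..?j})) = card (g ` {0..<Suc s}) + card (A \<inter> {1..?j})"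
      by (intro card_Un_disjoint) simp_all
    moreover have "{1..?j} - A \<subseteq> g ` {0..<Suc s}"
    proof
      fix x assume x: "x \<in> {1..?j} - A"
      then have "x \<in> C" using j C_def by auto
      then obtain t where t: "t < k" "x = g t" using gC by auto
      have "\<not> s < t" using gm[of s t] t x by auto
      then show "x \<in> g ` {0..<Suc s}" using t by auto
    qed
    moreover have "g ` {0..<Suc s} \<subseteq> {1..?j}"
    proof
      fix x assume "x \<in> g ` {0..<Suc s}"
      then obtain t where t: "t \<le> s" "x = g t" by (metis atLeastLessThan_iff imageE less_Suc_eq_le)
      then have "x \<le> ?j" using gm[of t s] s by (cases "t = s") auto
      moreover have "x \<in> C" using t s gC by auto
      ultimately show "x \<in> {1..?j}" using C_def by auto
    qed
    ultimately have "{1..?j} = g ` {0..<Suc s} \<union> (A \<inter> {1..?j})" "card (A \<inter> {1..?j}) \<le> s"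
      "card (g ` {0..<Suc s} \<union> (A \<inter> {1..?j})) = Suc s + card (A \<inter> {1..?j})" by (blast, simp_all)
    then have "card {1..?j} = Suc s + card (A \<inter> {1..?j})" "card (A \<inter> {1..?j}) \<le> s" by metis+
    then show False using bal[OF j] by simp
  qed
  define v where "v i = (if i \<notin> {1..2 * k} then i else if even i then h (i div 2 - 1) else g (i div 2))" for i
  have ve: "v i = h (i div 2 - 1)" "i div 2 - 1 < k" if "even i" "1 \<le> i" "i \<le> 2 * k" for i
    using that by (auto simp: v_def elim!: evenE)
  have vo: "v i = g (i div 2)" "i div 2 < k" if "odd i" "i \<le> 2 * k" for i
    using that by (auto simp: v_def elim!: oddE)
  have vE: "v ` evens k = A"
  proof -
    have "evens k = (\<lambda>s. 2 * (s + 1)) ` {0..<k}"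
    proof (intro equalityI subsetI)
      fix i assume "i \<in> evens k"
      then show "i \<in> (\<lambda>s. 2 * (s + 1)) ` {0..<k}" by (intro image_eqI[of _ _ "i div 2 - 1"]) (auto simp: evens_def elim!: evenE)
    qed (auto simp: evens_def)
    then have "v ` evens k = (\<lambda>s. v (2 * (s + 1))) ` {0..<k}" by (simp add: image_image)
    also have "\<dots> = h ` {0..<k}" using ve by (intro image_cong) (auto simp: v_def)
    finally show ?thesis using hA by simp
  qed
  have vO: "v ` odds k = C"
  proof -
    have "odds k = (\<lambda>s. 2 * s + 1) ` {0..<k}"
    proof (intro equalityI subsetI)
      fix i assume "i \<in> odds k"
      then show "i \<in> (\<lambda>s. 2 * s + 1) ` {0..<k}" by (intro image_eqI[of _ _ "i div 2"]) (auto simp: odds_def elim!: oddE)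
    qed (auto simp: odds_def)
    then have "v ` odds k = (\<lambda>s. v (2 * s + 1)) ` {0..<k}" by (simp add: image_image)
    also have "\<dots> = g ` {0..<k}" by (intro image_cong) (auto simp: v_def)
    finally show ?thesis using gC by simp
  qed
  have "{1..2 * k} = evens k \<union> odds k" by (auto simp: evens_def odds_def)
  then have "v ` {1..2 * k} = {1..2 * k}" using vE vO sub by (auto simp: image_Un C_def)
  then have "v permutes {1..2 * k}" by (intro permutes_surjI) (auto simp: v_def)
  moreover have "extremal k v"
    unfolding extremal_def
  proof (intro conjI allI impI)
    fix i assume i: "odd i \<and> i < 2 * k"
    then obtain s where s: "i = 2 * s + 1" by (auto elim!: oddE)
    then show "v (Suc i) < v i" using hg[of s] ve[of "Suc i"] vo[of i] i by simp
  next
    fix i l assume i: "odd l \<and> l < 2 * k \<and> 1 \<le> i \<and> i < l"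
    then obtain s where s: "l = 2 * s + 1" by (auto elim!: oddE)
    then have sk: "s < k" using i by simp
    show "v i < v l"
    proof (cases "odd i")
      case True
      then obtain t where "i = 2 * t + 1" by (auto elim!: oddE)
      then show ?thesis using gm[of t s] vo[of i] vo[of l] i s by simp
    next
      case False
      then obtain t where t: "i = 2 * t" by (auto elim!: evenE)
      then have t': "1 \<le> t" "t - 1 < s" using i s by auto
      then have "h (t - 1) < h s" using hm sk by blast
      then show ?thesis using hg[OF sk] ve[of i] vo[of l] i s t t' by simp
    qed
  next
    fix i l assume i: "even i \<and> 1 \<le> i \<and> i < l \<and> l \<le> 2 * k"
    then obtain s where s: "i = 2 * s" by (auto elim!: evenE)
    then have s1: "1 \<le> s" using i by simp
    show "v i < v l"
    proof (cases "odd l")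
      case False
      then obtain t where t: "l = 2 * t" by (auto elim!: evenE)
      then have "s - 1 < t - 1" using i s s1 by auto
      then show ?thesis using t hm[of "s - 1" "t - 1"] ve[of i] ve[of l] i s s1 by simp
    next
      case True
      then obtain t where t: "l = 2 * t + 1" by (auto elim!: oddE)
      then have t': "s - 1 < t" "t < k" using i s s1 by auto
      then have "h (s - 1) < h t" using hm by blast
      then show ?thesis using hg[of t] ve[of i] vo[of l] i s t t' by simp
    qed
  qed
  ultimately show ?thesis using that vE by blast
qed

text \<open>The lower row determines the upper one as its complement, and both rows are increasing,
  so the set of values at even positions determines \<open>v\<close>.\<close>

lemma card_extremal: "real (card {v. v permutes {1..2 * k} \<and> extremal k v}) = catalan k"
proof -
  have "bij_betw (\<lambda>v. v ` evens k) {v. v permutes {1..2 * k} \<and> extremal k v} (ballot_sets (2 * k) k)"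
    unfolding bij_betw_def
  proof
    show "inj_on (\<lambda>v. v ` evens k) {v. v permutes {1..2 * k} \<and> extremal k v}"
    proof (rule inj_onI)
      fix v v' assume "v \<in> {v. v permutes {1..2 * k} \<and> extremal k v}" "v' \<in> {v. v permutes {1..2 * k} \<and> extremal k v}"
        and eq: "v ` evens k = v' ` evens k"
      then have v: "v permutes {1..2 * k}" "extremal k v" and v': "v' permutes {1..2 * k}" "extremal k v'" by auto
      have odds: "u ` odds k = {1..2 * k} - u ` evens k" if "u permutes {1..2 * k}" for u
      proof -
        have "odds k = {1..2 * k} - evens k" by (auto simp: odds_def evens_def)
        then show ?thesis using permutes_image[OF that] permutes_inj[OF that] by (simp add: image_set_diff)
      qed
      have fin: "finite (evens k)" "finite (odds k)" by (simp_all add: evens_def odds_def)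
      show "v = v'"
      proof
        fix i
        consider "i \<in> evens k" | "i \<in> odds k" | "i \<notin> {1..2 * k}" by (auto simp: evens_def odds_def)
        then show "v i = v' i"
        proof cases
          case 1
          then show ?thesis using strict_mono_on_image_unique[OF fin(1) extremal_mono(1)[OF v(2)] extremal_mono(1)[OF v'(2)] eq] by blast
        next
          case 2
          have "v ` odds k = v' ` odds k" using odds[OF v(1)] odds[OF v'(1)] eq by simp
          then show ?thesis using 2 strict_mono_on_image_unique[OF fin(2) extremal_mono(2)[OF v(2)] extremal_mono(2)[OF v'(2)]] by blast
        next
          case 3
          then show ?thesis using permutes_not_in[OF v(1)] permutes_not_in[OF v'(1)] by metis
        qed
      qed
    qed
    show "(\<lambda>v. v ` evens k) ` {v. v permutes {1..2 * k} \<and> extremal k v} = ballot_sets (2 * k) k"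
    proof (intro equalityI subsetI)
      fix A assume "A \<in> (\<lambda>v. v ` evens k) ` {v. v permutes {1..2 * k} \<and> extremal k v}"
      then show "A \<in> ballot_sets (2 * k) k" using extremal_ballot by auto
    next
      fix A assume "A \<in> ballot_sets (2 * k) k"
      then obtain v where "v permutes {1..2 * k}" "extremal k v" "v ` evens k = A" by (rule ballot_extremal)
      then show "A \<in> (\<lambda>v. v ` evens k) ` {v. v permutes {1..2 * k} \<and> extremal k v}" by blast
    qed
  qed
  then show ?thesis using bij_betw_same_card card_ballot_sets_catalan by metis
qed

text \<open>Each block \<open>2 * t + 1\<close>, \<open>2 * t + 2\<close> contains at most one
  element of \<open>K\<close>. If all \<open>m\<close> blocks are used, the last one must use its
  odd element, since \<open>2 * m\<close> is out of range, and this propagates to the left.\<close>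

lemma card_no_consecutive:
  assumes K: "K \<subseteq> {1..<2 * m}" and nc: "\<And>k. k \<in> K \<Longrightarrow> Suc k \<notin> K"
  shows "card K \<le> m" "card K = m \<Longrightarrow> K = {k. odd k \<and> k < 2 * m}"
proof -
  let ?f = "\<lambda>k. (k - 1) div 2"
  have inj: "inj_on ?f K"
  proof (rule inj_onI)
    fix a b assume a: "a \<in> K" "b \<in> K" "(a - 1) div 2 = (b - 1) div 2"
    then have "1 \<le> a" "1 \<le> b" using K by auto
    then have "a = b \<or> a = Suc b \<or> b = Suc a" using a(3) by linarith
    then show "a = b" using nc a by auto
  qed
  have sub: "?f ` K \<subseteq> {0..<m}"
  proof
    fix t assume "t \<in> ?f ` K"
    then obtain k where "k \<in> K" "t = (k - 1) div 2" by blast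
    then have "k < 2 * m" "t = (k - 1) div 2" using K by auto
    then show "t \<in> {0..<m}" by auto
  qed
  show "card K \<le> m" using card_mono[OF _ sub] card_image[OF inj] by simp
  assume "card K = m"
  then have "card (?f ` K) = card {0..<m}" using card_image[OF inj] by simp
  then have f: "?f ` K = {0..<m}" by (intro card_subset_eq sub) simp
  have pair: "2 * t + 1 \<in> K \<or> 2 * t + 2 \<in> K" if t: "t < m" for t
  proof -
    have "t \<in> ?f ` K" unfolding f using t by simp
    then obtain k where k: "k \<in> K" "(k - 1) div 2 = t" by blast
    then have "1 \<le> k" using K by auto
    then have "k = 2 * t + 1 \<or> k = 2 * t + 2" using k(2) by linarith
    then show ?thesis using k by auto
  qed
  \<comment> \<open>Induction on the distance \<open>d\<close> from the last block: the even element
    of a block is excluded by the odd element of the next block.\<close>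
  have odd: "2 * (m - 1 - d) + 1 \<in> K" if "d < m" for d
    using that
  proof (induction d)
    case 0
    then have "2 * (m - 1) + 2 \<notin> K" using K by auto
    then show ?case using pair[of "m - 1"] 0 by auto
  next
    case (Suc d)
    have "Suc (2 * (m - 1 - Suc d) + 2) = 2 * (m - 1 - d) + 1" using Suc by auto
    then have "2 * (m - 1 - Suc d) + 2 \<notin> K" using nc Suc by (metis Suc_lessD)
    then show ?case using pair[of "m - 1 - Suc d"] Suc by auto
  qed
  show "K = {k. odd k \<and> k < 2 * m}"
  proof (intro equalityI subsetI)
    fix k assume k: "k \<in> {k. odd k \<and> k < 2 * m}"
    then obtain t where t: "k = 2 * t + 1" by (auto elim!: oddE)
    then show "k \<in> K" using odd[of "m - 1 - t"] k by simp
  next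
    fix k assume k: "k \<in> K"
    then have km: "k < 2 * m" "1 \<le> k" using K by auto
    have "odd k"
    proof (rule ccontr)
      assume "\<not> odd k"
      then obtain t where t: "k = 2 * t" by (auto elim!: evenE)
      then have t': "1 \<le> t" "t < m" using km by auto
      have "2 * (t - 1) + 1 \<in> K" using odd[of "m - t"] t' by (simp add: algebra_simps)
      moreover have "Suc (2 * (t - 1) + 1) = k" using t t' by auto
      ultimately show False using nc k by metis
    qed
    then show "k \<in> {k. odd k \<and> k < 2 * m}" using km by simp
  qed
qed

lemma card_odd_below: "card {k. odd k \<and> k < 2 * m} = m"
proof -
  have "{k. odd k \<and> k < 2 * m} = (\<lambda>t. 2 * t + 1) ` {0..<m}"
  proof (intro equalityI subsetI)
    fix k assume k: "k \<in> {k. odd k \<and> k < 2 * m}"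
    then obtain t where "k = 2 * t + 1" by (auto elim!: oddE)
    then show "k \<in> (\<lambda>t. 2 * t + 1) ` {0..<m}" using k by auto
  qed auto
  moreover have "inj_on (\<lambda>t::nat. 2 * t + 1) {0..<m}" by (rule inj_onI) simp
  ultimately show ?thesis by (simp add: card_image)
qed

section \<open>Rhombi\<close>

text \<open>The oriented area of the parallelogram spanned by the two vectors. Its sign compares
  directions, and with a fixed \<open>dir z\<close> as first argument it measures progress
  transversal to the edges of label \<open>z\<close>.\<close>

definition cross :: "complex \<Rightarrow> complex \<Rightarrow> real" where
  "cross a b = Re a * Im b - Im a * Re b"

lemma cross_simps:
  "cross (a + b) c = cross a c + cross b c" "cross c (a + b) = cross c a + cross c b"
  "cross (a - b) c = cross a c - cross b c" "cross c (a - b) = cross c a - cross c b"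
  "cross (r *\<^sub>R a) c = r * cross a c" "cross c (r *\<^sub>R a) = r * cross c a"
  "cross (- a) c = - cross a c" "cross c (- a) = - cross c a"
  "cross a a = 0" "cross 0 a = 0" "cross a 0 = 0"
  "cross a (of_real r) = - r * Im a" "cross (of_real r) a = r * Im a"
  by (simp_all add: cross_def algebra_simps)

lemma cross_swap: "cross b a = - cross a b"
  by (simp add: cross_def)

lemma cross_sum_right: "cross c (sum f A) = (\<Sum>i\<in>A. cross c (f i))"
  by (simp add: cross_def sum_distrib_left sum_subtractf)

text \<open>Puts the functional into the form required by the supporting hyperplane facts on
  faces.\<close>

lemma cross_inner: "cross x a = inner (Complex (Im a) (- Re a)) x"
  by (simp add: cross_def inner_complex_def)

text \<open>Cramer's rule in the plane.\<close>

lemma cross_decomp: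
  assumes "cross a b \<noteq> 0"
  shows "x = (cross x b / cross a b) *\<^sub>R a + (cross a x / cross a b) *\<^sub>R b"
proof -
  have "cross a b *\<^sub>R x = cross x b *\<^sub>R a + cross a x *\<^sub>R b"
    by (simp add: complex_eq_iff cross_def algebra_simps)
  then have "(1 / cross a b) *\<^sub>R (cross a b *\<^sub>R x) = (1 / cross a b) *\<^sub>R (cross x b *\<^sub>R a + cross a x *\<^sub>R b)"
    by simp
  then show ?thesis using assms by (simp add: scaleR_add_right)
qed

locale side_directions =
  fixes n :: nat and \<theta> :: "nat \<Rightarrow> real"
  assumes angles: "side_angles n \<theta>" and n2: "2 \<le> n"
begin

definition dir :: "nat \<Rightarrow> complex" where "dir k = cis (\<theta> k)"

abbreviation labels :: "nat set" where "labels \<equiv> {1..n}"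

text \<open>This is what makes the height strictly decreasing along every boundary path.\<close>

lemma Im_dir: "k \<in> labels \<Longrightarrow> Im (dir k) < 0"
  using angles unfolding side_angles_def dir_def by (simp add: sin_lt_zero)

text \<open>The cross product is the sine of the difference of two angles, and this difference lies
  strictly between 0 and pi.\<close>

lemma cross_dir: "i \<in> labels \<Longrightarrow> j \<in> labels \<Longrightarrow> i < j \<Longrightarrow> 0 < cross (dir i) (dir j)"
proof -
  assume a: "i \<in> labels" "j \<in> labels" "i < j"
  have "cross (dir i) (dir j) = sin (\<theta> j - \<theta> i)"
    by (simp add: cross_def dir_def sin_diff)
  moreover have "\<theta> i < \<theta> j" using angles a unfolding side_angles_def strict_mono_on_def by blast
  moreover have "\<theta> j - \<theta> i < pi" using angles a unfolding side_angles_def by (smt (verit))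
  ultimately show ?thesis by (simp add: sin_gt_zero)
qed

lemma cross_dir_neg: "i \<in> labels \<Longrightarrow> j \<in> labels \<Longrightarrow> i < j \<Longrightarrow> cross (dir j) (dir i) < 0"
  using cross_dir cross_swap[of "dir j" "dir i"] by simp

lemma cross_dir_eq_0: "i \<in> labels \<Longrightarrow> j \<in> labels \<Longrightarrow> cross (dir i) (dir j) = 0 \<Longrightarrow> i = j"
  using cross_dir[of i j] cross_dir_neg[of j i] by (cases i j rule: linorder_cases) auto

lemma coords_unique:
  assumes "i \<in> labels" "j \<in> labels" "i < j" "a *\<^sub>R dir i + b *\<^sub>R dir j = a' *\<^sub>R dir i + b' *\<^sub>R dir j"
  shows "a = a' \<and> b = b'"
proof -
  have D: "cross (dir i) (dir j) \<noteq> 0" using cross_dir assms(1-3) by fastforce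
  have "cross (a *\<^sub>R dir i + b *\<^sub>R dir j) (dir j) = cross (a' *\<^sub>R dir i + b' *\<^sub>R dir j) (dir j)"
       "cross (dir i) (a *\<^sub>R dir i + b *\<^sub>R dir j) = cross (dir i) (a' *\<^sub>R dir i + b' *\<^sub>R dir j)"
    using assms(4) by simp_all
  then show ?thesis using D by (simp add: cross_simps)
qed

lemma coords_exist:
  assumes "i \<in> labels" "j \<in> labels" "i < j"
  obtains a b where "q = p + a *\<^sub>R dir i + b *\<^sub>R dir j"
proof -
  have D: "cross (dir i) (dir j) \<noteq> 0" using cross_dir assms(1-3) by fastforce
  have "q = p + (cross (q - p) (dir j) / cross (dir i) (dir j)) *\<^sub>R dir i
      + (cross (dir i) (q - p) / cross (dir i) (dir j)) *\<^sub>R dir j"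
    using cross_decomp[OF D, of "q - p"] by (simp add: algebra_simps)
  then show ?thesis using that by blast
qed

text \<open>A displacement to the right lowers the coordinate of the smaller label and raises that
  of the larger one. Every statement on the left and right sides of a rhombus rests on these two
  signs.\<close>

lemma horizontal_coords:
  assumes "i \<in> labels" "j \<in> labels" "i < j"
  obtains \<alpha> \<beta> where "\<alpha> > 0" "\<beta> > 0"
    "\<And>\<epsilon>. of_real \<epsilon> = (- \<epsilon> * \<alpha>) *\<^sub>R dir i + (\<epsilon> * \<beta>) *\<^sub>R dir j"
proof -
  let ?D = "cross (dir i) (dir j)"
  have D: "?D > 0" using cross_dir assms by blast
  show ?thesis
  proof (rule that)
    show "- Im (dir j) / ?D > 0" "- Im (dir i) / ?D > 0" using D Im_dir assms by (simp_all add: divide_neg_pos)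
    fix \<epsilon>
    have "complex_of_real \<epsilon> = (cross (of_real \<epsilon>) (dir j) / ?D) *\<^sub>R dir i + (cross (dir i) (of_real \<epsilon>) / ?D) *\<^sub>R dir j"
      using cross_decomp[of "dir i" "dir j" "of_real \<epsilon>"] D by simp
    then show "complex_of_real \<epsilon> = (- \<epsilon> * (- Im (dir j) / ?D)) *\<^sub>R dir i + (\<epsilon> * (- Im (dir i) / ?D)) *\<^sub>R dir j"
      by (simp add: cross_simps)
  qed
qed

lemma rhombus_swap: "rhombus \<theta> p i j = rhombus \<theta> p j i"
  unfolding rhombus_def by (auto simp: add_ac) (metis add.assoc add.commute)+

lemma rhombus_coords:
  assumes "i \<in> labels" "j \<in> labels" "i < j"
  shows "p + a *\<^sub>R dir i + b *\<^sub>R dir j \<in> rhombus \<theta> p i j \<longleftrightarrow> 0 \<le> a \<and> a \<le> 1 \<and> 0 \<le> b \<and> b \<le> 1"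
proof
  assume "p + a *\<^sub>R dir i + b *\<^sub>R dir j \<in> rhombus \<theta> p i j"
  then obtain a' b' where ab: "p + a *\<^sub>R dir i + b *\<^sub>R dir j = p + a' *\<^sub>R dir i + b' *\<^sub>R dir j"
    "a' \<in> {0..1}" "b' \<in> {0..1}" unfolding rhombus_def dir_def by blast
  then have "a *\<^sub>R dir i + b *\<^sub>R dir j = a' *\<^sub>R dir i + b' *\<^sub>R dir j" by (simp add: add.assoc)
  then show "0 \<le> a \<and> a \<le> 1 \<and> 0 \<le> b \<and> b \<le> 1" using coords_unique[OF assms] ab by auto
qed (auto simp: rhombus_def dir_def)

lemma rhombus_cases:
  assumes "q \<in> rhombus \<theta> p i j"
  obtains a b where "q = p + a *\<^sub>R dir i + b *\<^sub>R dir j" "0 \<le> a" "a \<le> 1" "0 \<le> b" "b \<le> 1"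
  using assms unfolding rhombus_def dir_def by auto

lemma interior_rhombus:
  assumes ij: "i \<in> labels" "j \<in> labels" "i < j" and "0 < a" "a < 1" "0 < b" "b < 1"
  shows "p + a *\<^sub>R dir i + b *\<^sub>R dir j \<in> interior (rhombus \<theta> p i j)"
proof -
  let ?D = "cross (dir i) (dir j)"
  let ?U = "{q. 0 < cross (q - p) (dir j) \<and> cross (q - p) (dir j) < ?D \<and>
               0 < cross (dir i) (q - p) \<and> cross (dir i) (q - p) < ?D}"
  have D: "?D > 0" using cross_dir ij by blast
  have "open ?U" unfolding cross_def
    by (intro open_Collect_conj open_Collect_less continuous_intros)
  moreover have "?U \<subseteq> rhombus \<theta> p i j"
  proof
    fix q assume q: "q \<in> ?U"
    obtain a b where ab: "q = p + a *\<^sub>R dir i + b *\<^sub>R dir j" using coords_exist[OF ij] .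
    then have "cross (q - p) (dir j) = a * ?D" "cross (dir i) (q - p) = b * ?D"
      by (simp_all add: cross_simps)
    then have "0 < a \<and> a < 1 \<and> 0 < b \<and> b < 1" using q D by (simp add: zero_less_mult_iff)
    then show "q \<in> rhombus \<theta> p i j" using rhombus_coords[OF ij] ab by simp
  qed
  moreover have "p + a *\<^sub>R dir i + b *\<^sub>R dir j \<in> ?U" using assms(4-) D by (simp add: cross_simps)
  ultimately show ?thesis using interior_maximal by blast
qed

lemma compact_rhombus: "compact (rhombus \<theta> p i j)"
proof -
  have "rhombus \<theta> p i j = (\<lambda>z. p + fst z *\<^sub>R dir i + snd z *\<^sub>R dir j) ` ({0..1} \<times> {0..1})"
    unfolding rhombus_def dir_def by force
  moreover have "compact ((\<lambda>z. p + fst z *\<^sub>R dir i + snd z *\<^sub>R dir j) ` ({0..1::real} \<times> {0..1::real}))"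
    by (intro compact_continuous_image continuous_intros compact_Times compact_Icc)
  ultimately show ?thesis by simp
qed

lemma convex_rhombus: "convex (rhombus \<theta> p i j)"
proof -
  have "rhombus \<theta> p i j = (\<lambda>z. p + z) ` ((\<lambda>z. fst z *\<^sub>R dir i + snd z *\<^sub>R dir j) ` ({0..1} \<times> {0..1}))"
    unfolding rhombus_def dir_def by (force simp: add.assoc)
  moreover have "linear (\<lambda>z::real\<times>real. fst z *\<^sub>R dir i + snd z *\<^sub>R dir j)"
    by (rule linearI) (simp_all add: algebra_simps)
  ultimately show ?thesis
    by (simp add: convex_translation convex_linear_image convex_Times)
qed

text \<open>\<open>P\<close> is the upper end of the edge and \<open>z\<close> its label. A
  displacement to the right leaves the rhombus where the \<open>i\<close>-coordinate is 0 or the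
  \<open>j\<close>-coordinate is 1; this is the path from the top \<open>p\<close> along
  \<open>dir j\<close> and then along \<open>dir i\<close>. The left edges use the two directions in
  the opposite order.\<close>

definition right_edge :: "complex set \<Rightarrow> complex \<Rightarrow> nat \<Rightarrow> bool" where
  "right_edge R P z \<longleftrightarrow> (\<exists>p i j. i \<in> labels \<and> j \<in> labels \<and> i < j \<and> R = rhombus \<theta> p i j \<and>
     (z = j \<and> P = p \<or> z = i \<and> P = p + dir j))"

definition left_edge :: "complex set \<Rightarrow> complex \<Rightarrow> nat \<Rightarrow> bool" where
  "left_edge R P z \<longleftrightarrow> (\<exists>p i j. i \<in> labels \<and> j \<in> labels \<and> i < j \<and> R = rhombus \<theta> p i j \<and>
     (z = i \<and> P = p \<or> z = j \<and> P = p + dir i))"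

lemma rhombus_edges:
  assumes "i \<in> labels" "j \<in> labels" "i < j"
  shows "right_edge (rhombus \<theta> p i j) p j" "right_edge (rhombus \<theta> p i j) (p + dir j) i"
    "left_edge (rhombus \<theta> p i j) p i" "left_edge (rhombus \<theta> p i j) (p + dir i) j"
  unfolding right_edge_def left_edge_def using assms by blast+

lemma right_edge_label: "right_edge R P z \<Longrightarrow> z \<in> labels"
  unfolding right_edge_def by auto

lemma left_edge_label: "left_edge R P z \<Longrightarrow> z \<in> labels"
  unfolding left_edge_def by auto

lemma edge_mem:
  assumes "right_edge R P z \<or> left_edge R P z" "0 \<le> t" "t \<le> 1"
  shows "P + t *\<^sub>R dir z \<in> R"
proof -
  obtain p i j where ij: "i \<in> labels" "j \<in> labels" "i < j" and R: "R = rhombus \<theta> p i j"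
    and c: "(z = j \<and> P = p \<or> z = i \<and> P = p + dir j) \<or> (z = i \<and> P = p \<or> z = j \<and> P = p + dir i)"
    using assms(1) unfolding right_edge_def left_edge_def by blast
  note rc = rhombus_coords[OF ij, of p]
  from c show ?thesis using rc[of 0 t] rc[of t 1] rc[of t 0] rc[of 1 t] assms R
    by (auto simp: add_ac)
qed

text \<open>Lets two tiles be identified through overlapping interiors next to a common
  edge.\<close>

lemma left_of_right_edge:
  assumes "right_edge R P z" "0 < t" "t < 1"
  obtains \<delta> where "\<delta> > 0" "\<And>\<epsilon>. 0 < \<epsilon> \<Longrightarrow> \<epsilon> < \<delta> \<Longrightarrow> P + t *\<^sub>R dir z - of_real \<epsilon> \<in> interior R"
proof -
  obtain p i j where ij: "i \<in> labels" "j \<in> labels" "i < j" and R: "R = rhombus \<theta> p i j"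
    and c: "z = j \<and> P = p \<or> z = i \<and> P = p + dir j"
    using assms(1) unfolding right_edge_def by blast
  obtain \<alpha> \<beta> where ab: "\<alpha> > 0" "\<beta> > 0"
    and h: "\<And>\<epsilon>. complex_of_real \<epsilon> = (- \<epsilon> * \<alpha>) *\<^sub>R dir i + (\<epsilon> * \<beta>) *\<^sub>R dir j"
    using horizontal_coords[OF ij] by metis
  \<comment> \<open>The four bounds keep both moving coordinates strictly between 0 and 1 in either
    position of the edge.\<close>
  define \<delta> where "\<delta> = min (min (t/\<alpha>) (t/\<beta>)) (min ((1-t)/\<alpha>) ((1-t)/\<beta>))"
  have d: "\<delta> > 0" using ab assms unfolding \<delta>_def by simp
  have d2: "\<epsilon> * \<alpha> < t \<and> \<epsilon> * \<beta> < t \<and> \<epsilon> * \<alpha> < 1 - t \<and> \<epsilon> * \<beta> < 1 - t" if "\<epsilon> < \<delta>" for \<epsilon>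
    using that ab unfolding \<delta>_def by (simp add: pos_less_divide_eq)
  have "P + t *\<^sub>R dir z - of_real \<epsilon> \<in> interior R" if e: "0 < \<epsilon>" "\<epsilon> < \<delta>" for \<epsilon>
  proof -
    have pos: "\<epsilon> * \<alpha> > 0" "\<epsilon> * \<beta> > 0" using e ab by simp_all
    from c show ?thesis
    proof
      assume "z = j \<and> P = p"
      then have "P + t *\<^sub>R dir z - of_real \<epsilon> = p + (\<epsilon> * \<alpha>) *\<^sub>R dir i + (t - \<epsilon> * \<beta>) *\<^sub>R dir j"
        unfolding h by (simp add: algebra_simps)
      then show ?thesis unfolding R using interior_rhombus[OF ij, of "\<epsilon>*\<alpha>" "t - \<epsilon>*\<beta>" p] pos d2[OF e(2)] assms by simp
    next
      assume "z = i \<and> P = p + dir j"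
      then have "P + t *\<^sub>R dir z - of_real \<epsilon> = p + (t + \<epsilon> * \<alpha>) *\<^sub>R dir i + (1 - \<epsilon> * \<beta>) *\<^sub>R dir j"
        unfolding h by (simp add: algebra_simps)
      then show ?thesis unfolding R using interior_rhombus[OF ij, of "t+\<epsilon>*\<alpha>" "1 - \<epsilon>*\<beta>" p] pos d2[OF e(2)] assms by simp
    qed
  qed
  then show ?thesis using that d by blast
qed

text \<open>The displacement pushes one coordinate below 0 or above 1. The parameter
  \<open>t\<close> is unrestricted, so the whole half-plane beyond the edge is excluded.\<close>

lemma beyond_right_edge:
  assumes "right_edge R P z" "\<epsilon> > 0"
  shows "P + t *\<^sub>R dir z + of_real \<epsilon> \<notin> R"
proof -
  obtain p i j where ij: "i \<in> labels" "j \<in> labels" "i < j" and R: "R = rhombus \<theta> p i j"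
    and c: "z = j \<and> P = p \<or> z = i \<and> P = p + dir j"
    using assms(1) unfolding right_edge_def by blast
  obtain \<alpha> \<beta> where ab: "\<alpha> > 0" "\<beta> > 0"
    and h: "\<And>\<epsilon>. complex_of_real \<epsilon> = (- \<epsilon> * \<alpha>) *\<^sub>R dir i + (\<epsilon> * \<beta>) *\<^sub>R dir j"
    using horizontal_coords[OF ij] by metis
  have pos: "\<epsilon> * \<alpha> > 0" "\<epsilon> * \<beta> > 0" using assms ab by simp_all
  from c show ?thesis
  proof
    assume "z = j \<and> P = p"
    then have "P + t *\<^sub>R dir z + of_real \<epsilon> = p + (- (\<epsilon> * \<alpha>)) *\<^sub>R dir i + (t + \<epsilon> * \<beta>) *\<^sub>R dir j"
      unfolding h by (simp add: algebra_simps)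
    then show ?thesis unfolding R using rhombus_coords[OF ij, of p "-(\<epsilon>*\<alpha>)" "t + \<epsilon>*\<beta>"] pos by simp
  next
    assume "z = i \<and> P = p + dir j"
    then have "P + t *\<^sub>R dir z + of_real \<epsilon> = p + (t - \<epsilon> * \<alpha>) *\<^sub>R dir i + (1 + \<epsilon> * \<beta>) *\<^sub>R dir j"
      unfolding h by (simp add: algebra_simps)
    then show ?thesis unfolding R using rhombus_coords[OF ij, of p "t-\<epsilon>*\<alpha>" "1 + \<epsilon>*\<beta>"] pos by simp
  qed
qed

text \<open>The point reflection exchanges left and right edges, so facts on left edges and on
  bottom sides are transferred instead of being proved twice.\<close>

lemma rhombus_reflect: "rhombus \<theta> (- p - dir i - dir j) i j = uminus ` rhombus \<theta> p i j"
proof (intro equalityI subsetI)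
  fix q assume "q \<in> rhombus \<theta> (- p - dir i - dir j) i j"
  then obtain a b where q: "q = - p - dir i - dir j + a *\<^sub>R dir i + b *\<^sub>R dir j" "0 \<le> a" "a \<le> 1" "0 \<le> b" "b \<le> 1"
    by (rule rhombus_cases)
  then have "q = - (p + (1 - a) *\<^sub>R dir i + (1 - b) *\<^sub>R dir j)" by (simp add: algebra_simps)
  moreover have "p + (1 - a) *\<^sub>R dir i + (1 - b) *\<^sub>R dir j \<in> rhombus \<theta> p i j"
    unfolding rhombus_def dir_def[symmetric] using q(2-) by force
  ultimately show "q \<in> uminus ` rhombus \<theta> p i j" by blast
next
  fix q assume "q \<in> uminus ` rhombus \<theta> p i j"
  then obtain a b where q: "q = - (p + a *\<^sub>R dir i + b *\<^sub>R dir j)" "0 \<le> a" "a \<le> 1" "0 \<le> b" "b \<le> 1"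
    by (auto elim!: rhombus_cases)
  then have "q = - p - dir i - dir j + (1 - a) *\<^sub>R dir i + (1 - b) *\<^sub>R dir j" by (simp add: algebra_simps)
  then show "q \<in> rhombus \<theta> (- p - dir i - dir j) i j"
    unfolding rhombus_def dir_def[symmetric] using q(2-) by force
qed

text \<open>The reflection turns the edge upside down, so the new upper end is the negative of the
  old lower end \<open>P + dir z\<close>.\<close>

lemma left_edge_reflect:
  assumes "left_edge R P z"
  shows "right_edge (uminus ` R) (- P - dir z) z"
proof -
  obtain p i j where ij: "i \<in> labels" "j \<in> labels" "i < j" and R: "R = rhombus \<theta> p i j"
    and c: "z = i \<and> P = p \<or> z = j \<and> P = p + dir i"
    using assms unfolding left_edge_def by blast
  from c show ?thesis
    using rhombus_edges(1,2)[OF ij, of "- p - dir i - dir j"] unfolding R rhombus_reflect[symmetric]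
    by (auto simp: algebra_simps)
qed

lemma right_of_left_edge:
  assumes "left_edge R P z" "0 < t" "t < 1"
  obtains \<delta> where "\<delta> > 0" "\<And>\<epsilon>. 0 < \<epsilon> \<Longrightarrow> \<epsilon> < \<delta> \<Longrightarrow> P + t *\<^sub>R dir z + of_real \<epsilon> \<in> interior R"
proof -
  obtain \<delta> where \<delta>: "\<delta> > 0"
    "\<And>\<epsilon>. 0 < \<epsilon> \<Longrightarrow> \<epsilon> < \<delta> \<Longrightarrow> - P - dir z + (1 - t) *\<^sub>R dir z - of_real \<epsilon> \<in> interior (uminus ` R)"
    using left_of_right_edge[OF left_edge_reflect[OF assms(1)], of "1 - t"] assms(2,3) by auto
  have eq: "- P - dir z + (1 - t) *\<^sub>R dir z - of_real \<epsilon> = - (P + t *\<^sub>R dir z + of_real \<epsilon>)" for \<epsilon>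
    by (simp add: algebra_simps)
  have "P + t *\<^sub>R dir z + of_real \<epsilon> \<in> interior R" if "0 < \<epsilon>" "\<epsilon> < \<delta>" for \<epsilon>
    using \<delta>(2)[OF that] unfolding interior_negations eq by (metis image_iff neg_equal_iff_equal)
  then show ?thesis using that \<delta>(1) by blast
qed

lemma beyond_left_edge:
  assumes "left_edge R P z" "\<epsilon> > 0"
  shows "P + t *\<^sub>R dir z - of_real \<epsilon> \<notin> R"
proof
  assume "P + t *\<^sub>R dir z - of_real \<epsilon> \<in> R"
  moreover have "- P - dir z + (1 - t) *\<^sub>R dir z + of_real \<epsilon> = - (P + t *\<^sub>R dir z - of_real \<epsilon>)"
    by (simp add: algebra_simps)
  ultimately show False
    using beyond_right_edge[OF left_edge_reflect[OF assms(1)] assms(2), of "1 - t"] by (metis imageI)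
qed

lemma not_interiorI:
  fixes q :: complex
  assumes "\<And>\<epsilon>. \<epsilon> > 0 \<Longrightarrow> q + of_real \<epsilon> \<notin> R"
  shows "q \<notin> interior R"
proof
  assume "q \<in> interior R"
  then obtain e where e: "e > 0" "ball q e \<subseteq> R" using mem_interior by blast
  have "q + of_real (e / 2) \<in> ball q e" using e by (simp add: dist_norm)
  then show False using e assms[of "e / 2"] by auto
qed

text \<open>If the midpoint is not interior, one of its coordinates is 0 or 1. As a mean of two
  numbers in the unit interval it can be extreme only if both end points have the same coordinate,
  so the segment runs along a side, and its label is that of the side.\<close>

lemma segment_in_edge_label:
  assumes ij: "i \<in> labels" "j \<in> labels" "i < j" and R: "R = rhombus \<theta> p i j" and z: "z \<in> labels"
    and s: "s > 0" and Q: "Q \<in> R" "Q + s *\<^sub>R dir z \<in> R" "Q + (s/2) *\<^sub>R dir z \<notin> interior R"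
  obtains P t where "Q = P + t *\<^sub>R dir z" "0 \<le> t" "t + s \<le> 1" "right_edge R P z \<or> left_edge R P z" "z = i \<or> z = j"
proof -
  obtain a b where ab: "Q = p + a *\<^sub>R dir i + b *\<^sub>R dir j" "0 \<le> a" "a \<le> 1" "0 \<le> b" "b \<le> 1"
    using Q(1) rhombus_cases unfolding R by blast
  obtain a' b' where ab': "Q + s *\<^sub>R dir z = p + a' *\<^sub>R dir i + b' *\<^sub>R dir j" "0 \<le> a'" "a' \<le> 1" "0 \<le> b'" "b' \<le> 1"
    using Q(2) rhombus_cases unfolding R by blast
  have sz: "s *\<^sub>R dir z = (a' - a) *\<^sub>R dir i + (b' - b) *\<^sub>R dir j"
    using ab(1) ab'(1) by (simp add: algebra_simps)
  have "(s/2) *\<^sub>R dir z = (1/2) *\<^sub>R (s *\<^sub>R dir z)" by simp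
  then have mid: "Q + (s/2) *\<^sub>R dir z = p + ((a+a')/2) *\<^sub>R dir i + ((b+b')/2) *\<^sub>R dir j"
    unfolding sz ab(1) by (simp add: complex_eq_iff field_simps)
  have nmid: "\<not> (0 < (a+a')/2 \<and> (a+a')/2 < 1 \<and> 0 < (b+b')/2 \<and> (b+b')/2 < 1)"
    using interior_rhombus[OF ij, of "(a+a')/2" "(b+b')/2" p] Q(3) mid R by auto
  then have cases: "a = 0 \<and> a' = 0 \<or> a = 1 \<and> a' = 1 \<or> b = 0 \<and> b' = 0 \<or> b = 1 \<and> b' = 1"
  proof -
    have "a + a' \<le> 0 \<or> 2 \<le> a + a' \<or> b + b' \<le> 0 \<or> 2 \<le> b + b'"
      using nmid by (simp add: not_less)
    then consider "a + a' \<le> 0" | "2 \<le> a + a'" | "b + b' \<le> 0" | "2 \<le> b + b'" by blast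
    then show ?thesis
    proof cases
      case 1 then have "a = 0 \<and> a' = 0" using ab(2-) ab'(2-) by simp then show ?thesis by simp
    next
      case 2 then have "a = 1 \<and> a' = 1" using ab(2-) ab'(2-) by simp then show ?thesis by simp
    next
      case 3 then have "b = 0 \<and> b' = 0" using ab(2-) ab'(2-) by simp then show ?thesis by simp
    next
      case 4 then have "b = 1 \<and> b' = 1" using ab(2-) ab'(2-) by simp then show ?thesis by simp
    qed
  qed
  have par: "z = k \<and> c = s" if "s *\<^sub>R dir z = c *\<^sub>R dir k" "k \<in> labels" for k c
  proof -
    have "s * cross (dir z) (dir k) = cross (s *\<^sub>R dir z) (dir k)" by (simp add: cross_simps)
    also have "\<dots> = 0" unfolding that by (simp add: cross_simps)
    finally have "cross (dir z) (dir k) = 0" using s by simp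
    then have zk: "z = k" by (rule cross_dir_eq_0[OF z that(2)])
    moreover have "dir k \<noteq> 0" using Im_dir[OF that(2)] by auto
    ultimately show ?thesis using that(1) by simp
  qed
  show ?thesis
  proof (cases "a = a'")
    case True
    then have zj: "z = j" "b' - b = s" using par[of "b'-b" j] sz ij by auto
    then have "b \<noteq> b'" using s by auto
    then have a: "a = 0 \<or> a = 1" using cases by auto
    then show ?thesis
    proof
      assume "a = 0"
      then have "Q = p + b *\<^sub>R dir z" "right_edge R p z" using rhombus_edges[OF ij, of p] ab zj ij R by auto
      then show ?thesis using that[of p b] zj ab ab' by auto
    next
      assume "a = 1"
      then have "Q = p + dir i + b *\<^sub>R dir z" "left_edge R (p + dir i) z" using rhombus_edges[OF ij, of p] ab zj ij R by auto
      then show ?thesis using that[of "p + dir i" b] zj ab ab' by auto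
    qed
  next
    case False
    then have b: "b = 0 \<and> b' = 0 \<or> b = 1 \<and> b' = 1" using cases by auto
    then have zi: "z = i" "a' - a = s" using par[of "a'-a" i] sz ij by auto
    from b show ?thesis
    proof
      assume "b = 0 \<and> b' = 0"
      then have "Q = p + a *\<^sub>R dir z" "left_edge R p z" using rhombus_edges[OF ij, of p] ab zi ij R by auto
      then show ?thesis using that[of p a] zi ab ab' by auto
    next
      assume "b = 1 \<and> b' = 1"
      then have "Q = p + dir j + a *\<^sub>R dir z" "right_edge R (p + dir j) z" using rhombus_edges[OF ij, of p] ab zi ij R by auto
      then show ?thesis using that[of "p + dir j" a] zi ab ab' by auto
    qed
  qed
qed

lemma segment_in_edge:
  assumes "i \<in> labels" "j \<in> labels" "i < j" "R = rhombus \<theta> p i j" "z \<in> labels"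
    "s > 0" "Q \<in> R" "Q + s *\<^sub>R dir z \<in> R" "Q + (s/2) *\<^sub>R dir z \<notin> interior R"
  obtains P t where "Q = P + t *\<^sub>R dir z" "0 \<le> t" "t + s \<le> 1" "right_edge R P z \<or> left_edge R P z"
  using segment_in_edge_label[OF assms] that by metis

text \<open>\<open>right_edge\<close> refers to some representation of the point set as a rhombus.
  The labels are recovered for the given representation from the segment itself.\<close>

lemma right_edge_labels:
  assumes "i \<in> labels" "j \<in> labels" "i < j" "right_edge (rhombus \<theta> p i j) P z"
  shows "z = i \<or> z = j"
proof -
  let ?R = "rhombus \<theta> p i j"
  have "P \<in> ?R" "P + 1 *\<^sub>R dir z \<in> ?R"
    using edge_mem[of ?R P z 0] edge_mem[of ?R P z 1] assms(4) by simp_all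
  moreover have "P + (1/2) *\<^sub>R dir z \<notin> interior ?R"
    using beyond_right_edge[OF assms(4)] by (intro not_interiorI)
  ultimately show ?thesis
    using segment_in_edge_label[OF assms(1-3) refl right_edge_label[OF assms(4)], of 1 P] by auto
qed

lemma right_edge_tile_label:
  assumes "tile_with_labels n \<theta> L R" "right_edge R P z"
  shows "z \<in> L"
proof -
  obtain p i j where ij: "i \<in> labels" "j \<in> labels" "i \<noteq> j" "L = {i, j}" "R = rhombus \<theta> p i j"
    using assms unfolding tile_with_labels_def by blast
  then show ?thesis using right_edge_labels[of i j p P z] right_edge_labels[of j i p P z] assms(2) rhombus_swap[of p i j]
    by (cases "i < j") auto
qed

lemma cross_coords:
  "cross (p + a *\<^sub>R dir i + b *\<^sub>R dir j) (dir j) = cross p (dir j) + a * cross (dir i) (dir j)"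
  "cross (p + a *\<^sub>R dir i + b *\<^sub>R dir j) (dir i) = cross p (dir i) - b * cross (dir i) (dir j)"
  using cross_swap[of "dir i" "dir j"] by (simp_all add: cross_simps)

lemma closed_segment_dir: "closed_segment P (P + dir z) = {P + t *\<^sub>R dir z | t. 0 \<le> t \<and> t \<le> 1}"
  unfolding closed_segment_def by (auto simp: algebra_simps)

text \<open>Each of the two sides at \<open>p\<close> is where a functional given by the cross
  product with its own direction takes its extreme value on the rhombus.\<close>

lemma rhombus_top_face:
  assumes ij: "i \<in> labels" "j \<in> labels" "i < j"
  shows "closed_segment p (p + dir j) face_of rhombus \<theta> p i j"
    "closed_segment p (p + dir i) face_of rhombus \<theta> p i j"
proof -
  let ?R = "rhombus \<theta> p i j" and ?D = "cross (dir i) (dir j)"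
  have D: "?D > 0" using cross_dir ij by blast
  note rc = rhombus_coords[OF ij, of p]
  have le: "cross q (dir j) \<ge> cross p (dir j)" "cross q (dir i) \<le> cross p (dir i)" if "q \<in> ?R" for q
    using that D by (auto elim!: rhombus_cases simp: cross_coords)
  have "?R \<inter> {q. cross q (dir j) = cross p (dir j)} = closed_segment p (p + dir j)"
    unfolding closed_segment_dir
  proof (intro set_eqI iffI)
    fix q assume "q \<in> ?R \<inter> {q. cross q (dir j) = cross p (dir j)}"
    then show "q \<in> {p + t *\<^sub>R dir j | t. 0 \<le> t \<and> t \<le> 1}" using D by (auto elim!: rhombus_cases simp: cross_coords)
  next
    fix q assume "q \<in> {p + t *\<^sub>R dir j | t. 0 \<le> t \<and> t \<le> 1}"
    then show "q \<in> ?R \<inter> {q. cross q (dir j) = cross p (dir j)}" using rc[of 0] by (auto simp: cross_simps)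
  qed
  then show "closed_segment p (p + dir j) face_of ?R"
    using face_of_Int_supporting_hyperplane_ge[OF convex_rhombus, of p i j "cross p (dir j)" "Complex (Im (dir j)) (- Re (dir j))"]
      le(1) by (simp add: cross_inner)
  have "?R \<inter> {q. cross q (dir i) = cross p (dir i)} = closed_segment p (p + dir i)"
    unfolding closed_segment_dir
  proof (intro set_eqI iffI)
    fix q assume "q \<in> ?R \<inter> {q. cross q (dir i) = cross p (dir i)}"
    then show "q \<in> {p + t *\<^sub>R dir i | t. 0 \<le> t \<and> t \<le> 1}" using D by (auto elim!: rhombus_cases simp: cross_coords)
  next
    fix q assume "q \<in> {p + t *\<^sub>R dir i | t. 0 \<le> t \<and> t \<le> 1}"
    then show "q \<in> ?R \<inter> {q. cross q (dir i) = cross p (dir i)}" using rc[of _ 0] by (auto simp: cross_simps)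
  qed
  then show "closed_segment p (p + dir i) face_of ?R"
    using face_of_Int_supporting_hyperplane_le[OF convex_rhombus, of p i j "Complex (Im (dir i)) (- Re (dir i))" "cross p (dir i)"]
      le(2) by (simp add: cross_inner)
qed

lemma rhombus_bottom_face:
  assumes ij: "i \<in> labels" "j \<in> labels" "i < j"
  shows "closed_segment (p + dir i) (p + dir i + dir j) face_of rhombus \<theta> p i j"
    "closed_segment (p + dir j) (p + dir j + dir i) face_of rhombus \<theta> p i j"
proof -
  let ?p = "- p - dir i - dir j"
  have neg: "uminus ` closed_segment a b = closed_segment (- a) (- b)" for a b :: complex
    using closed_segment_linear_image[OF linear_uminus] by metis
  have img: "uminus ` F face_of rhombus \<theta> p i j" if "F face_of rhombus \<theta> ?p i j" for F
  proof -
    have "uminus ` F face_of uminus ` (rhombus \<theta> ?p i j)"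
      using that by (subst face_of_linear_image) (auto simp: linear_uminus)
    then show ?thesis unfolding rhombus_reflect image_image by simp
  qed
  show "closed_segment (p + dir i) (p + dir i + dir j) face_of rhombus \<theta> p i j"
    using img[OF rhombus_top_face(1)[OF ij]] unfolding neg by (subst closed_segment_commute) (simp add: algebra_simps)
  show "closed_segment (p + dir j) (p + dir j + dir i) face_of rhombus \<theta> p i j"
    using img[OF rhombus_top_face(2)[OF ij]] unfolding neg by (subst closed_segment_commute) (simp add: algebra_simps)
qed

lemma edge_face: "right_edge R P z \<or> left_edge R P z \<Longrightarrow> closed_segment P (P + dir z) face_of R"
  unfolding right_edge_def left_edge_def using rhombus_top_face rhombus_bottom_face by blast

lemma edge_edge_of:
  assumes "right_edge R P z \<or> left_edge R P z" shows "closed_segment P (P + dir z) edge_of R"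
proof -
  have "z \<in> labels" using assms right_edge_label left_edge_label by blast
  then have "dir z \<noteq> 0" using Im_dir by fastforce
  then have "aff_dim (closed_segment P (P + dir z)) = 1"
    by (simp add: segment_convex_hull aff_dim_convex_hull aff_dim_2)
  then show ?thesis using edge_face[OF assms] by (simp add: edge_of_def)
qed

end

section \<open>The two boundary paths and the polygon\<close>

lemma boundary_vertex_0 [simp]: "boundary_vertex \<theta> u 0 = 0"
  by (simp add: boundary_vertex_def)

context side_directions begin

abbreviation V :: "(nat \<Rightarrow> nat) \<Rightarrow> nat \<Rightarrow> complex" where "V \<equiv> boundary_vertex \<theta>"

abbreviation bottom :: complex where "bottom \<equiv> V id n"

definition boundary_path :: "(nat \<Rightarrow> nat) \<Rightarrow> complex set" where
  "boundary_path u = (\<Union>k\<in>labels. boundary_edge \<theta> u k)"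

lemma V_Suc: "V u (Suc k) = V u k + dir (u (Suc k))"
  by (simp add: boundary_vertex_def dir_def)

lemma V_step: "k \<in> labels \<Longrightarrow> V u k = V u (k - 1) + dir (u k)"
  using V_Suc[of u "k - 1"] by simp

lemma V_sum: "V u k = (\<Sum>i=1..k. dir (u i))"
  by (simp add: boundary_vertex_def dir_def)

lemma boundary_edge_dir: "k \<in> labels \<Longrightarrow> boundary_edge \<theta> u k = closed_segment (V u (k - 1)) (V u (k - 1) + dir (u k))"
  by (simp add: boundary_edge_def V_step)

lemma perm_label: "u permutes labels \<Longrightarrow> k \<in> labels \<Longrightarrow> u k \<in> labels"
  using permutes_in_image[of u labels k] by blast

lemma V_n: "u permutes labels \<Longrightarrow> V u n = bottom"
  unfolding V_sum using sum.permute[of u labels dir] by (simp add: o_def)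

lemma Im_V_less:
  assumes u: "u permutes labels" and "j < k" "k \<le> n"
  shows "Im (V u k) < Im (V u j)"
  using assms(2,3)
proof (induction k)
  case (Suc k)
  have "Im (V u (Suc k)) < Im (V u k)" using Im_dir[OF perm_label[OF u, of "Suc k"]] Suc.prems by (simp add: V_Suc)
  then show ?case using Suc by (cases "j = k") auto
qed simp

lemma Im_V_le:
  assumes u: "u permutes labels" and "j \<le> k" "k \<le> n"
  shows "Im (V u k) \<le> Im (V u j)"
  using Im_V_less[OF u, of j k] assms by (cases "j = k") auto

lemma Im_V_less_iff:
  assumes "u permutes labels" "j \<le> n" "k \<le> n"
  shows "Im (V u k) < Im (V u j) \<longleftrightarrow> j < k"
  using Im_V_less[OF assms(1), of j k] Im_V_le[OF assms(1), of k j] assms by (meson not_less)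

lemma V_inj:
  assumes "u permutes labels" "j \<le> n" "k \<le> n" "V u j = V u k"
  shows "j = k"
  using Im_V_less_iff[OF assms(1-3)] Im_V_less_iff[OF assms(1) assms(3,2)] assms(4) by (metis nat_neq_iff order_less_irrefl)

lemma bottom_neg: "Im bottom < 0"
  using Im_V_less[of id 0 n] n2 by (simp add: permutes_id)

text \<open>
  The path of \<open>u\<close> is a graph over the height: \<open>edge_fraction u h k\<close> is the fraction of the
  \<open>k\<close>-th edge that lies above height \<open>h\<close>, and \<open>point_at u h\<close> the point at height \<open>h\<close>.
\<close>

definition edge_fraction :: "(nat \<Rightarrow> nat) \<Rightarrow> real \<Rightarrow> nat \<Rightarrow> real" where
  "edge_fraction u h k = max 0 (min 1 ((h - Im (V u (k - 1))) / Im (dir (u k))))"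

definition point_at :: "(nat \<Rightarrow> nat) \<Rightarrow> real \<Rightarrow> complex" where
  "point_at u h = (\<Sum>k\<in>labels. edge_fraction u h k *\<^sub>R dir (u k))"

abbreviation abscissa :: "(nat \<Rightarrow> nat) \<Rightarrow> real \<Rightarrow> real" where "abscissa u h \<equiv> Re (point_at u h)"

lemma edge_fraction_on_edge:
  assumes u: "u permutes labels" and k: "k \<in> labels" and t: "0 \<le> t" "t \<le> 1" and j: "j \<in> labels"
  shows "edge_fraction u (Im (V u (k - 1) + t *\<^sub>R dir (u k))) j = (if j < k then 1 else if j = k then t else 0)"
proof -
  have dk: "Im (dir (u k)) < 0" and dj: "Im (dir (u j)) < 0" using Im_dir perm_label u k j by blast+
  have tk: "Im (dir (u k)) \<le> t * Im (dir (u k))" "t * Im (dir (u k)) \<le> 0"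
    using t dk mult_right_mono_neg[of t 1 "Im (dir (u k))"] by (auto simp: mult_nonneg_nonpos)
  consider "j < k" | "j = k" | "j > k" by linarith
  then show ?thesis
  proof cases
    case 1
    then have "Im (V u (k - 1)) \<le> Im (V u j)" using Im_V_le[OF u, of j "k - 1"] k by auto
    also have "\<dots> = Im (V u (j - 1)) + Im (dir (u j))" using V_step[OF j, of u] by simp
    finally have "Im (V u (k - 1)) + t * Im (dir (u k)) - Im (V u (j - 1)) \<le> Im (dir (u j))" using tk by linarith
    then have "1 \<le> (Im (V u (k - 1)) + t * Im (dir (u k)) - Im (V u (j - 1))) / Im (dir (u j))"
      using dj by (simp add: le_divide_eq)
    then show ?thesis using 1 by (simp add: edge_fraction_def)
  next
    case 2
    then show ?thesis using dk t by (simp add: edge_fraction_def)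
  next
    case 3
    then have "Im (V u (j - 1)) \<le> Im (V u k)" using Im_V_le[OF u, of k "j - 1"] j by auto
    also have "\<dots> = Im (V u (k - 1)) + Im (dir (u k))" using V_step[OF k, of u] by simp
    finally have "0 \<le> Im (V u (k - 1)) + t * Im (dir (u k)) - Im (V u (j - 1))" using tk by linarith
    then have "(Im (V u (k - 1)) + t * Im (dir (u k)) - Im (V u (j - 1))) / Im (dir (u j)) \<le> 0"
      using dj by (simp add: divide_nonneg_neg)
    then show ?thesis using 3 by (simp add: edge_fraction_def)
  qed
qed

lemma sum_initial:
  fixes f :: "nat \<Rightarrow> complex"
  assumes "k \<in> labels"
  shows "(\<Sum>j\<in>labels. (if j < k then 1 else if j = k then t else 0) *\<^sub>R f j) = (\<Sum>j=1..k-1. f j) + t *\<^sub>R f k"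
proof -
  have "labels = {1..k-1} \<union> {k} \<union> {k+1..n}" using assms by auto
  then have "(\<Sum>j\<in>labels. (if j < k then 1 else if j = k then t else 0) *\<^sub>R f j)
    = (\<Sum>j\<in>{1..k-1} \<union> {k} \<union> {k+1..n}. (if j < k then 1 else if j = k then t else 0) *\<^sub>R f j)" by simp
  also have "\<dots> = (\<Sum>j\<in>{1..k-1} \<union> {k}. (if j < k then 1 else if j = k then t else 0) *\<^sub>R f j)
      + (\<Sum>j\<in>{k+1..n}. (if j < k then 1 else if j = k then t else 0) *\<^sub>R f j)"
    by (intro sum.union_disjoint) auto
  also have "(\<Sum>j\<in>{k+1..n}. (if j < k then 1 else if j = k then t else 0) *\<^sub>R f j) = 0"
    by (intro sum.neutral) auto
  also have "(\<Sum>j\<in>{1..k-1} \<union> {k}. (if j < k then 1 else if j = k then t else 0) *\<^sub>R f j) =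
     (\<Sum>j\<in>{1..k-1}. (if j < k then 1 else if j = k then t else 0) *\<^sub>R f j) + (\<Sum>j\<in>{k}. (if j < k then 1 else if j = k then t else 0) *\<^sub>R f j)"
    using assms by (intro sum.union_disjoint) auto
  also have "(\<Sum>j\<in>{1..k-1}. (if j < k then 1 else if j = k then t else 0) *\<^sub>R f j) = (\<Sum>j\<in>{1..k-1}. f j)"
    using assms by (intro sum.cong) auto
  finally show ?thesis by simp
qed

lemma point_at_edge:
  assumes u: "u permutes labels" and k: "k \<in> labels" and t: "0 \<le> t" "t \<le> 1"
  shows "point_at u (Im (V u (k - 1) + t *\<^sub>R dir (u k))) = V u (k - 1) + t *\<^sub>R dir (u k)"
proof -
  have "point_at u (Im (V u (k - 1) + t *\<^sub>R dir (u k)))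
    = (\<Sum>j\<in>labels. (if j < k then 1 else if j = k then t else 0) *\<^sub>R dir (u j))"
    unfolding point_at_def
    by (intro sum.cong refl arg_cong2[where f = scaleR] edge_fraction_on_edge[OF u k t])
  then show ?thesis by (simp only: sum_initial[OF k] V_sum)
qed

lemma height_cases:
  assumes u: "u permutes labels" and h: "Im bottom \<le> h" "h < 0"
  obtains k t where "k \<in> labels" "0 < t" "t \<le> 1" "h = Im (V u (k - 1) + t *\<^sub>R dir (u k))"
proof -
  \<comment> \<open>The first vertex at or below height \<open>h\<close>; its predecessor is
    strictly above, whence a positive parameter on the edge.\<close>
  define k where "k = (LEAST k. Im (V u k) \<le> h)"
  have n: "Im (V u n) \<le> h" using h V_n[OF u] by simp
  have k: "Im (V u k) \<le> h" unfolding k_def using n by (rule LeastI)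
  have "k \<le> n" unfolding k_def using n by (rule Least_le)
  moreover have "k \<noteq> 0" using k h by (metis boundary_vertex_0 leD zero_complex.simps(2))
  ultimately have kl: "k \<in> labels" by simp
  have k': "h < Im (V u (k - 1))" using not_less_Least[of "k - 1" "\<lambda>k. Im (V u k) \<le> h"] kl unfolding k_def[symmetric] by simp
  let ?d = "Im (dir (u k))"
  have d: "?d < 0" using Im_dir perm_label u kl by blast
  have s: "Im (V u k) = Im (V u (k - 1)) + ?d" using V_step[OF kl] by simp
  show ?thesis
  proof (rule that[OF kl, of "(h - Im (V u (k - 1))) / ?d"])
    show "0 < (h - Im (V u (k - 1))) / ?d" using k' d by (simp add: divide_neg_neg)
    show "(h - Im (V u (k - 1))) / ?d \<le> 1" using k s d by (simp add: divide_le_eq)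
    show "h = Im (V u (k - 1) + ((h - Im (V u (k - 1))) / ?d) *\<^sub>R dir (u k))" using d by simp
  qed
qed

lemma height_cases_closed:
  assumes u: "u permutes labels" and h: "Im bottom \<le> h" "h \<le> 0"
  obtains k t where "k \<in> labels" "0 \<le> t" "t \<le> 1" "h = Im (V u (k - 1) + t *\<^sub>R dir (u k))"
proof (cases "h = 0")
  case True
  then show ?thesis using that[of 1 0] n2 by simp
next
  case False
  then have "h < 0" using h by simp
  then show ?thesis using height_cases[OF u h(1)] that less_imp_le by metis
qed

lemma mem_boundary_edge:
  assumes "k \<in> labels"
  shows "p \<in> boundary_edge \<theta> u k \<longleftrightarrow> (\<exists>t. 0 \<le> t \<and> t \<le> 1 \<and> p = V u (k - 1) + t *\<^sub>R dir (u k))"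
  unfolding boundary_edge_dir[OF assms] closed_segment_dir by auto

lemma edge_height:
  assumes u: "u permutes labels" and k: "k \<in> labels" and t: "0 \<le> t" "t \<le> 1"
  shows "Im (V u k) \<le> Im (V u (k - 1) + t *\<^sub>R dir (u k))" "Im (V u (k - 1) + t *\<^sub>R dir (u k)) \<le> Im (V u (k - 1))"
proof -
  have dk: "Im (dir (u k)) < 0" using Im_dir perm_label u k by blast
  then have "Im (dir (u k)) \<le> t * Im (dir (u k))" "t * Im (dir (u k)) \<le> 0"
    using t mult_right_mono_neg[of t 1 "Im (dir (u k))"] by (auto simp: mult_nonneg_nonpos)
  then show "Im (V u k) \<le> Im (V u (k - 1) + t *\<^sub>R dir (u k))" "Im (V u (k - 1) + t *\<^sub>R dir (u k)) \<le> Im (V u (k - 1))"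
    using V_step[OF k, of u] by auto
qed

text \<open>The heights of a path fill the interval from \<open>Im bottom\<close> to 0, each taken
  once, so membership in the path becomes an equation for \<open>point_at\<close>.\<close>

lemma mem_path:
  assumes u: "u permutes labels"
  shows "p \<in> boundary_path u \<longleftrightarrow> Im bottom \<le> Im p \<and> Im p \<le> 0 \<and> p = point_at u (Im p)"
proof
  assume "p \<in> boundary_path u"
  then obtain k t where k: "k \<in> labels" and t: "0 \<le> t" "t \<le> 1" and p: "p = V u (k - 1) + t *\<^sub>R dir (u k)"
    unfolding boundary_path_def using mem_boundary_edge by blast
  have "Im p \<le> Im (V u (k-1))" "Im (V u k) \<le> Im p" using edge_height[OF u k t] p by simp_all
  moreover have "Im (V u (k-1)) \<le> Im (V u 0)" using Im_V_le[OF u, of 0 "k - 1"] k by auto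
  moreover have "Im bottom \<le> Im (V u k)" using Im_V_le[OF u, of k n] V_n[OF u] k by auto
  ultimately show "Im bottom \<le> Im p \<and> Im p \<le> 0 \<and> p = point_at u (Im p)"
    using point_at_edge[OF u k t] p by simp
next
  assume a: "Im bottom \<le> Im p \<and> Im p \<le> 0 \<and> p = point_at u (Im p)"
  then obtain k t where k: "k \<in> labels" and t: "0 \<le> t" "t \<le> 1" and h: "Im p = Im (V u (k - 1) + t *\<^sub>R dir (u k))"
    using height_cases_closed[OF u] by metis
  then have "p = V u (k - 1) + t *\<^sub>R dir (u k)" using point_at_edge[OF u k t] a by simp
  then show "p \<in> boundary_path u" unfolding boundary_path_def using mem_boundary_edge[OF k] k t by blast
qed

lemma Im_point_at: "u permutes labels \<Longrightarrow> Im bottom \<le> h \<Longrightarrow> h \<le> 0 \<Longrightarrow> Im (point_at u h) = h"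
  by (metis height_cases_closed point_at_edge)

lemma mem_path_iff:
  assumes u: "u permutes labels"
  shows "p \<in> boundary_path u \<longleftrightarrow> Im bottom \<le> Im p \<and> Im p \<le> 0 \<and> Re p = abscissa u (Im p)"
  using mem_path[OF u] Im_point_at[OF u] by (auto simp: complex_eq_iff)

lemma edge_in_path: "k \<in> labels \<Longrightarrow> 0 \<le> t \<Longrightarrow> t \<le> 1 \<Longrightarrow> V u (k - 1) + t *\<^sub>R dir (u k) \<in> boundary_path u"
  unfolding boundary_path_def using mem_boundary_edge by blast

lemma vertex_in_path: "k \<le> n \<Longrightarrow> V u k \<in> boundary_path u"
  using edge_in_path[of k 1 u] V_step[of k u] edge_in_path[of 1 0 u] n2 by (cases "k = 0") auto

lemma continuous_point_at: 
  assumes "u permutes labels"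
  shows "continuous_on UNIV (point_at u)"
proof -
  have "Im (dir (u k)) \<noteq> 0" if "k \<in> labels" for k using Im_dir[OF perm_label[OF assms that]] by simp
  then show ?thesis unfolding point_at_def edge_fraction_def by (intro continuous_intros) auto
qed

lemma edge_fraction_bounds: "0 \<le> edge_fraction u h k" "edge_fraction u h k \<le> 1"
  by (auto simp: edge_fraction_def)

text \<open>
  The left boundary is half of the boundary of the zonotope of all \<open>\<Sum>c\<^sub>i v\<^sub>i\<close> with
  \<open>0 \<le> c\<^sub>i \<le> 1\<close>, and the path of every permutation stays in this zonotope.
\<close>

lemma abscissa_id_le_strong:
  assumes u: "u permutes labels" and j: "j \<in> labels" "0 \<le> t" "t \<le> 1" and h: "h = Im (V id (j - 1) + t *\<^sub>R dir j)"
    and hb: "Im bottom \<le> h" "h \<le> 0"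
  shows "abscissa id h \<le> abscissa u h"
    "abscissa id h = abscissa u h \<Longrightarrow> i \<in> labels \<Longrightarrow> i < j \<Longrightarrow> edge_fraction u h (inv u i) = 1"
    "abscissa id h = abscissa u h \<Longrightarrow> i \<in> labels \<Longrightarrow> j < i \<Longrightarrow> edge_fraction u h (inv u i) = 0"
proof -
  define c where "c i = edge_fraction u h (inv u i)" for i
  define b where "b i = (if i < j then 1 else if i = j then t else 0)" for i
  define d where "d i = (c i - b i) * cross (dir j) (dir i)" for i
  have id: "(id :: nat \<Rightarrow> nat) permutes labels" by (rule permutes_id)
  have pu: "point_at u h = (\<Sum>i\<in>labels. c i *\<^sub>R dir i)"
    unfolding point_at_def c_def using sum.permute[OF u, of "\<lambda>i. edge_fraction u h (inv u i) *\<^sub>R dir i"]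
    by (simp add: o_def permutes_inverses(2)[OF u])
  have pid: "point_at id h = (\<Sum>i\<in>labels. b i *\<^sub>R dir i)"
    unfolding h point_at_def b_def using edge_fraction_on_edge[OF id j(1,2,3)] by (intro sum.cong) (auto simp del: plus_complex.simps)
  \<comment> \<open>\<open>dir j\<close> is the direction of the left boundary at height
    \<open>h\<close>. Labels before \<open>j\<close> contribute fully to the left path and have
    negative cross product with \<open>dir j\<close>; labels after \<open>j\<close> contribute
    nothing and have positive cross product. Hence every \<open>d i\<close> is nonnegative, while
    the difference of the two points is horizontal.\<close>
  have "cross (dir j) (point_at u h - point_at id h) = (\<Sum>i\<in>labels. d i)"
    unfolding pu pid d_def by (simp add: cross_simps cross_sum_right sum_subtractf algebra_simps)
  moreover have "point_at u h - point_at id h = of_real (abscissa u h - abscissa id h)"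
    using Im_point_at[OF u hb] Im_point_at[OF id hb] by (simp add: complex_eq_iff)
  ultimately have main: "- (abscissa u h - abscissa id h) * Im (dir j) = (\<Sum>i\<in>labels. d i)"
    by (simp add: cross_simps algebra_simps)
  have d: "0 \<le> d i" if i: "i \<in> labels" for i
  proof -
    consider "i < j" | "i = j" | "i > j" by linarith
    then show ?thesis
    proof cases
      case 1
      then show ?thesis unfolding d_def b_def c_def using cross_dir_neg[OF i j(1)] edge_fraction_bounds[of u h "inv u i"]
        by (simp add: mult_nonpos_nonpos)
    next
      case 3
      then show ?thesis unfolding d_def b_def c_def using cross_dir[OF j(1) i] edge_fraction_bounds[of u h "inv u i"] by simp
    qed (simp add: d_def cross_simps)
  qed
  have dj: "Im (dir j) < 0" using Im_dir j by blast
  have "0 \<le> (\<Sum>i\<in>labels. d i)" using d by (rule sum_nonneg)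
  then have "(abscissa u h - abscissa id h) * Im (dir j) \<le> 0" using main by (simp add: algebra_simps)
  then show "abscissa id h \<le> abscissa u h" using dj by (simp add: mult_le_0_iff)
  \<comment> \<open>At a point of contact the nonnegative terms sum to zero, so each vanishes and
    the fractions agree for every label other than \<open>j\<close>.\<close>
  assume eq: "abscissa id h = abscissa u h" and i: "i \<in> labels"
  then have "(\<Sum>i\<in>labels. d i) = 0" using main by simp
  then have d0: "d i = 0" using d i sum_nonneg_eq_0_iff[of labels d] by blast
  show "i < j \<Longrightarrow> edge_fraction u h (inv u i) = 1" using d0 cross_dir_neg[OF i j(1)] unfolding d_def b_def c_def by auto
  show "j < i \<Longrightarrow> edge_fraction u h (inv u i) = 0" using d0 cross_dir[OF j(1) i] unfolding d_def b_def c_def by auto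
qed

lemma abscissa_id_le:
  assumes u: "u permutes labels" and h: "Im bottom \<le> h" "h \<le> 0"
  shows "abscissa id h \<le> abscissa u h"
proof -
  obtain j t where "j \<in> labels" "0 \<le> t" "t \<le> 1" "h = Im (V id (j - 1) + t *\<^sub>R dir (id j))"
    using height_cases_closed[OF permutes_id h] .
  then show ?thesis using abscissa_id_le_strong(1)[OF u, of j t h] h by simp
qed

text \<open>At a point of contact the labels used up by the path of \<open>u\<close> are those below
  \<open>j\<close>, with \<open>j\<close> itself possibly used in part, whereas in the order of
  \<open>u\<close> they are the first positions. Some initial segment of positions is therefore
  mapped to an initial segment of labels.\<close>

lemma abscissa_id_less:
  assumes u: "u permutes labels" and fs: "fully_supported n u" and h: "Im bottom < h" "h < 0"
  shows "abscissa id h < abscissa u h"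
proof (rule ccontr)
  assume "\<not> abscissa id h < abscissa u h"
  then have eq: "abscissa id h = abscissa u h" using abscissa_id_le[OF u, of h] h by simp
  obtain j t where j: "j \<in> labels" "0 \<le> t" "t \<le> 1" "h = Im (V id (j - 1) + t *\<^sub>R dir (id j))"
    using height_cases_closed[OF permutes_id, of h] h by auto
  have one: "edge_fraction u h (inv u i) = 1" if "i \<in> labels" "i < j" for i
    using abscissa_id_le_strong(2)[OF u, of j t h i] j h eq that by simp
  have zero: "edge_fraction u h (inv u i) = 0" if "i \<in> labels" "j < i" for i
    using abscissa_id_le_strong(3)[OF u, of j t h i] j h eq that by simp
  obtain k s where k: "k \<in> labels" "0 < s" "s \<le> 1" "h = Im (V u (k - 1) + s *\<^sub>R dir (u k))"
    using height_cases[OF u, of h] h by auto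
  have fr: "edge_fraction u h l = (if l < k then 1 else if l = k then s else 0)" if "l \<in> labels" for l
    using edge_fraction_on_edge[OF u k(1) _ k(3) that] k by simp
  \<comment> \<open>\<open>P\<close> is a threshold on fractions that separates 1 from 0. It cuts
    the positions after \<open>r\<close>, and the labels after \<open>j - 1\<close> or after
    \<open>j\<close>; cardinality identifies the two cuts.\<close>
  have initial: "u ` {1..r} = {1..r}"
    if "r \<le> n" and P: "\<And>l. l \<in> labels \<Longrightarrow> P (edge_fraction u h l) \<longleftrightarrow> l \<le> r" "P 1" "\<not> P 0" for r and P :: "real \<Rightarrow> bool"
  proof -
    have img: "u ` {1..r} = {i \<in> labels. P (edge_fraction u h (inv u i))}"
    proof (intro set_eqI iffI)
      fix i assume "i \<in> u ` {1..r}"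
      then obtain l where "i = u l" "l \<in> {1..r}" by auto
      then show "i \<in> {i \<in> labels. P (edge_fraction u h (inv u i))}" using P(1)[of l] \<open>r \<le> n\<close> perm_label[OF u, of l] permutes_inverses(2)[OF u] by auto
    next
      fix i assume i: "i \<in> {i \<in> labels. P (edge_fraction u h (inv u i))}"
      then have "inv u i \<in> labels" using perm_label[OF permutes_inv[OF u]] by blast
      then show "i \<in> u ` {1..r}" using P(1)[of "inv u i"] i permutes_inverses(1)[OF u, of i] by force
    qed
    have "{i \<in> labels. P (edge_fraction u h (inv u i))} = {1..j - 1} \<or> {i \<in> labels. P (edge_fraction u h (inv u i))} = {1..j}"
    proof (cases "P (edge_fraction u h (inv u j))")
      case True
      have "P (edge_fraction u h (inv u i)) \<longleftrightarrow> i \<le> j" if "i \<in> labels" for i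
        using one[OF that] zero[OF that] P(2,3) True by (cases i j rule: linorder_cases) auto
      then show ?thesis using j by auto
    next
      case False
      have "P (edge_fraction u h (inv u i)) \<longleftrightarrow> i \<le> j - 1" if "i \<in> labels" for i
        using one[OF that] zero[OF that] P(2,3) False that by (cases i j rule: linorder_cases) auto
      then show ?thesis using j by auto
    qed
    then obtain q where q: "u ` {1..r} = {1..q}" using img by auto
    have "inj_on u {1..r}" using permutes_inj[OF u] by (rule inj_on_subset) simp
    then have "card (u ` {1..r}) = r" by (simp add: card_image)
    then have "q = r" unfolding q by simp
    then show ?thesis using q by simp
  qed
  \<comment> \<open>The cut has to be proper. On the last edge the point lies above the bottom, so
    only edges used completely are counted, which gives \<open>n - 1\<close>; otherwise edges used
    at all are counted, which gives \<open>k\<close>.\<close>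
  show False
  proof (cases "k = n")
    case True
    have s: "s \<noteq> 1"
    proof
      assume "s = 1"
      then have "h = Im (V u n)" using k True V_step[OF k(1), of u] by simp
      then show False using V_n[OF u] h by simp
    qed
    have "u ` {1..n-1} = {1..n-1}"
      by (rule initial[of _ "\<lambda>x. x = 1"]) (use fr True s k in auto)
    moreover have "1 \<le> n - 1 \<and> n - 1 < n" using n2 by auto
    ultimately show False using fs unfolding fully_supported_def by blast
  next
    case False
    have "u ` {1..k} = {1..k}"
      by (rule initial[of _ "\<lambda>x. x > 0"]) (use fr k in auto)
    then show False using fs k False unfolding fully_supported_def by auto
  qed
qed

end

section \<open>The polygon as the region between two graphs\<close>

context side_directions begin

text \<open>Explicit form of the polygon by horizontal sections; \<open>open_region\<close> is the
  corresponding form of the inside of its boundary.\<close>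

definition region :: "(nat \<Rightarrow> nat) \<Rightarrow> complex set" where
  "region w = {p. Im bottom \<le> Im p \<and> Im p \<le> 0 \<and> abscissa id (Im p) \<le> Re p \<and> Re p \<le> abscissa w (Im p)}"

definition open_region :: "(nat \<Rightarrow> nat) \<Rightarrow> complex set" where
  "open_region w = {p. Im bottom < Im p \<and> Im p < 0 \<and> abscissa id (Im p) < Re p \<and> Re p < abscissa w (Im p)}"

lemma point_at_vertex: "u permutes labels \<Longrightarrow> k \<le> n \<Longrightarrow> point_at u (Im (V u k)) = V u k"
  using vertex_in_path[of k u] mem_path[of u] by metis

lemma point_at_ends:
  assumes "u permutes labels"
  shows "point_at u 0 = 0" "point_at u (Im bottom) = bottom"
  using point_at_vertex[OF assms, of 0] point_at_vertex[OF assms, of n] V_n[OF assms] by simp_all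

lemma continuous_abscissa:
  assumes "u permutes labels"
  shows "continuous_on UNIV (\<lambda>p. abscissa u (Im p))"
  by (intro continuous_intros continuous_on_compose2[OF continuous_point_at[OF assms]]) auto

lemma open_open_region: "w permutes labels \<Longrightarrow> open (open_region w)"
  unfolding open_region_def
  by (intro open_Collect_conj open_Collect_less continuous_intros continuous_abscissa permutes_id)

lemma closed_region: "w permutes labels \<Longrightarrow> closed (region w)"
  unfolding region_def
  by (intro closed_Collect_conj closed_Collect_le continuous_intros continuous_abscissa permutes_id)

lemma elnitsky_boundary_path: "elnitsky_boundary n \<theta> w = boundary_path id \<union> boundary_path w"
  unfolding elnitsky_boundary_def boundary_path_def ..

lemma region_minus_open:
  assumes w: "w permutes labels"
  shows "region w - open_region w \<subseteq> boundary_path id \<union> boundary_path w"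
proof
  fix p assume p: "p \<in> region w - open_region w"
  then have "Im p = 0 \<or> Im p = Im bottom \<or> Re p = abscissa id (Im p) \<or> Re p = abscissa w (Im p)"
    unfolding region_def open_region_def by auto
  then show "p \<in> boundary_path id \<union> boundary_path w"
    using p point_at_ends[OF w] point_at_ends[OF permutes_id] mem_path_iff[OF w] mem_path_iff[OF permutes_id]
    unfolding region_def by auto
qed

lemma path_in_region:
  assumes w: "w permutes labels"
  shows "boundary_path id \<union> boundary_path w \<subseteq> region w" "(boundary_path id \<union> boundary_path w) \<inter> open_region w = {}"
  using mem_path_iff[OF w] mem_path_iff[OF permutes_id] abscissa_id_le[OF w]
  unfolding region_def open_region_def by auto

lemma compact_path: "compact (boundary_path u)"
  unfolding boundary_path_def by (intro compact_UN) (auto simp: boundary_edge_def)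

lemma ray_unbounded: "c \<noteq> 0 \<Longrightarrow> \<not> bounded {p + t *\<^sub>R c | t. 0 \<le> t}" for p c :: complex
proof
  assume c: "c \<noteq> 0" and "bounded {p + t *\<^sub>R c | t. 0 \<le> t}"
  then obtain B where B: "\<And>t. 0 \<le> t \<Longrightarrow> norm (p + t *\<^sub>R c) \<le> B" unfolding bounded_iff by blast
  let ?t = "(B + norm p + 1) / norm c"
  have B0: "B \<ge> 0" using B[of 0] norm_ge_zero order_trans by blast
  then have t: "?t \<ge> 0" by simp
  have "norm (?t *\<^sub>R c) = B + norm p + 1" using c B0 by simp
  moreover have "norm (?t *\<^sub>R c) \<le> norm (p + ?t *\<^sub>R c) + norm p"
    using norm_triangle_ineq4[of "p + ?t *\<^sub>R c" p] by simp
  ultimately show False using B[OF t] by simp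
qed

text \<open>A point outside the region escapes to infinity along a horizontal ray that misses both
  paths. A component starting in the bounded set \<open>open_region w\<close> cannot leave it,
  because the frontier of that set lies on the paths.\<close>

lemma elnitsky_polygon_region:
  assumes w: "w permutes labels"
  shows "elnitsky_polygon n \<theta> w = region w"
proof -
  let ?B = "boundary_path id \<union> boundary_path w"
  have bB: "bounded ?B" using compact_path compact_imp_bounded by auto
  note pr = path_in_region[OF w]
  have "inside ?B = open_region w"
  proof (intro equalityI subsetI)
    fix p assume p: "p \<in> inside ?B"
    show "p \<in> open_region w"
    proof (rule ccontr)
      assume "p \<notin> open_region w"
      then have nr: "p \<notin> region w" using p region_minus_open[OF w] inside_no_overlap[of ?B] by blast
      \<comment> \<open>The ray points left only for points left of the polygon at one of its
        heights; in all other cases the ray to the right is free.\<close>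
      define c :: complex where "c = (if Im bottom \<le> Im p \<and> Im p \<le> 0 \<and> Re p < abscissa id (Im p) then -1 else 1)"
      let ?r = "{p + t *\<^sub>R c | t. 0 \<le> t}"
      have c: "c \<noteq> 0" "Im c = 0" by (auto simp: c_def)
      have disj: "?r \<inter> ?B = {}"
      proof (rule ccontr)
        assume "?r \<inter> ?B \<noteq> {}"
        then obtain t where t: "0 \<le> t" "p + t *\<^sub>R c \<in> ?B" by auto
        then have h: "Im bottom \<le> Im p" "Im p \<le> 0"
          and e: "Re p + t * Re c = abscissa id (Im p) \<or> Re p + t * Re c = abscissa w (Im p)"
          using mem_path_iff[OF w] mem_path_iff[OF permutes_id] c by auto
        have le: "abscissa id (Im p) \<le> abscissa w (Im p)" using abscissa_id_le[OF w h] .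
        show False
        proof (cases "Re p < abscissa id (Im p)")
          case True
          then have "c = -1" using h c_def by simp
          then show False using e le t True by auto
        next
          case False
          then have "c = 1" "Re p > abscissa w (Im p)" using h nr unfolding c_def region_def by auto
          then show False using e le t by auto
        qed
      qed
      have "convex ?r"
      proof (rule convexI)
        fix x y and u v :: real assume a: "x \<in> ?r" "y \<in> ?r" "0 \<le> u" "0 \<le> v" "u + v = 1"
        then obtain s t where st: "x = p + s *\<^sub>R c" "y = p + t *\<^sub>R c" "0 \<le> s" "0 \<le> t" by auto
        have "u *\<^sub>R x + v *\<^sub>R y = (u + v) *\<^sub>R p + (u * s + v * t) *\<^sub>R c"
          unfolding st by (simp add: algebra_simps)
        then show "u *\<^sub>R x + v *\<^sub>R y \<in> ?r" using a st by auto
      qed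
      then have "connected ?r" by (rule convex_connected)
      moreover have "p \<in> ?r" using exI[of _ 0] by force
      ultimately have "?r \<subseteq> connected_component_set (- ?B) p"
        using disj by (intro connected_component_maximal) auto
      moreover have "bounded (connected_component_set (- ?B) p)" using p unfolding inside_def by simp
      ultimately show False using ray_unbounded[OF c(1)] bounded_subset by blast
    qed
  next
    fix p assume p: "p \<in> open_region w"
    let ?C = "connected_component_set (- ?B) p"
    have pB: "p \<notin> ?B" using p pr by blast
    have O: "open_region w \<subseteq> region w" unfolding open_region_def region_def by auto
    have "?C \<subseteq> open_region w"
    proof (rule ccontr)
      assume "\<not> ?C \<subseteq> open_region w"
      moreover have "p \<in> ?C" using pB by (simp add: connected_component_refl)
      then have "?C \<inter> open_region w \<noteq> {}" using p by blast
      ultimately have "?C \<inter> frontier (open_region w) \<noteq> {}"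
        by (intro connected_Int_frontier connected_connected_component) blast+
      moreover have "frontier (open_region w) \<subseteq> region w - open_region w"
        using closure_minimal[OF O closed_region[OF w]] interior_open[OF open_open_region[OF w]]
        unfolding frontier_def by blast
      ultimately have "?C \<inter> ?B \<noteq> {}" using region_minus_open[OF w] by blast
      then show False using connected_component_subset[of "- ?B" p] by blast
    qed
    moreover have "bounded (open_region w)"
    proof -
      let ?S = "{Im bottom..0}"
      have "bounded (point_at id ` ?S)" "bounded (point_at w ` ?S)"
        using continuous_point_at[OF w] continuous_point_at[OF permutes_id]
        by (auto intro!: compact_imp_bounded compact_continuous_image intro: continuous_on_subset)
      then obtain b c where b: "\<And>h. h \<in> ?S \<Longrightarrow> norm (point_at id h) \<le> b" and c: "\<And>h. h \<in> ?S \<Longrightarrow> norm (point_at w h) \<le> c"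
        unfolding bounded_iff by fast
      have "norm q \<le> b + c - Im bottom" if q: "q \<in> open_region w" for q
      proof -
        have "\<bar>abscissa id (Im q)\<bar> \<le> b" "\<bar>abscissa w (Im q)\<bar> \<le> c"
          using b[of "Im q"] c[of "Im q"] q abs_Re_le_cmod[of "point_at id (Im q)"] abs_Re_le_cmod[of "point_at w (Im q)"]
          unfolding open_region_def by auto
        then have "\<bar>Re q\<bar> \<le> b + c" "\<bar>Im q\<bar> \<le> - Im bottom" using q unfolding open_region_def by auto
        then show ?thesis using cmod_le[of q] by linarith
      qed
      then show ?thesis unfolding bounded_iff by blast
    qed
    ultimately have "bounded ?C" using bounded_subset by blast
    then show "p \<in> inside ?B" using pB unfolding inside_def by simp
  qed
  moreover have "?B \<union> open_region w = region w"
    using region_minus_open[OF w] pr(1) unfolding open_region_def region_def by auto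
  ultimately show ?thesis unfolding elnitsky_polygon_def elnitsky_boundary_path by simp
qed

text \<open>By full support the open region is dense in the region: a point at an inner height is
  reached horizontally from the midpoint of its section, and the top and bottom vertices are reached
  along the curve of these midpoints. This passes from covering the open region to covering the
  polygon.\<close>

lemma region_subset_closed:
  assumes w: "w permutes labels" and fs: "fully_supported n w" and C: "closed C" "open_region w \<subseteq> C"
  shows "region w \<subseteq> C"
proof
  fix p assume p: "p \<in> region w"
  let ?g = "\<lambda>h. Complex ((abscissa id h + abscissa w h) / 2) h"
  have g: "?g h \<in> open_region w" if "Im bottom < h" "h < 0" for h
    using abscissa_id_less[OF w fs that] that unfolding open_region_def by simp
  show "p \<in> C"
  proof (cases "Im bottom < Im p \<and> Im p < 0")
    case True
    let ?q = "?g (Im p)"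
    have q: "?q \<in> open_region w" using g True by simp
    have "open_segment p ?q \<subseteq> C"
    proof
      fix r assume "r \<in> open_segment p ?q"
      then obtain u where u: "0 < u" "u < 1" "r = (1 - u) *\<^sub>R p + u *\<^sub>R ?q" by (auto simp: in_segment)
      have im: "Im r = Im p" unfolding u(3) by (simp add: algebra_simps)
      have 1: "0 \<le> (1 - u) * (Re p - abscissa id (Im p))" "0 \<le> (1 - u) * (abscissa w (Im p) - Re p)"
        using p u unfolding region_def by auto
      have 2: "0 < u * (Re ?q - abscissa id (Im p))" "0 < u * (abscissa w (Im p) - Re ?q)"
        using q u unfolding open_region_def by auto
      define m where "m = Re ?q"
      have rr: "Re r = (1 - u) * Re p + u * m" unfolding u(3) m_def by simp
      have "Re r - abscissa id (Im p) = (1 - u) * (Re p - abscissa id (Im p)) + u * (m - abscissa id (Im p))"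
           "abscissa w (Im p) - Re r = (1 - u) * (abscissa w (Im p) - Re p) + u * (abscissa w (Im p) - m)"
        unfolding rr by algebra+
      moreover have "0 < (1 - u) * (Re p - abscissa id (Im p)) + u * (m - abscissa id (Im p))"
        "0 < (1 - u) * (abscissa w (Im p) - Re p) + u * (abscissa w (Im p) - m)"
        using 1 2[folded m_def] by (auto intro: add_nonneg_pos)
      ultimately have "0 < Re r - abscissa id (Im p)" "0 < abscissa w (Im p) - Re r" by metis+
      then have "abscissa id (Im p) < Re r" "Re r < abscissa w (Im p)" by simp_all
      then show "r \<in> C" using C True im unfolding open_region_def by auto
    qed
    then have "closure (open_segment p ?q) \<subseteq> C" by (rule closure_minimal[OF _ C(1)])
    then show ?thesis using q C by (cases "p = ?q") (auto simp: subset_iff)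
  next
    case False
    then have "Im p = Im bottom \<or> Im p = 0" using p unfolding region_def by auto
    then have pg: "p = ?g (Im p)" using p point_at_ends[OF w] point_at_ends[OF permutes_id]
      unfolding region_def by (auto simp: complex_eq_iff)
    have "continuous_on UNIV ?g"
      unfolding complex_eq
      by (intro continuous_intros continuous_on_compose2[OF continuous_point_at[OF w]] continuous_on_compose2[OF continuous_point_at[OF permutes_id]]) auto
    then have gC: "?g ` closure {Im bottom<..<0} \<subseteq> C"
      using g C by (intro image_closure_subset) (auto intro: continuous_on_subset)
    have "Im p \<in> closure {Im bottom<..<0}"
      using bottom_neg \<open>Im p = Im bottom \<or> Im p = 0\<close> by (auto simp: closure_greaterThanLessThan)
    then have "?g (Im p) \<in> C" using gC by blast
    then show ?thesis using pg by simp
  qed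
qed

text \<open>At a descent this replaces two right edges of a rhombus by the two left edges, which
  removes a tile from the right boundary.\<close>

definition swap_adjacent :: "(nat \<Rightarrow> nat) \<Rightarrow> nat \<Rightarrow> nat \<Rightarrow> nat" where
  "swap_adjacent w k = w \<circ> Transposition.transpose k (Suc k)"

lemma swap_adjacent_simps [simp]: "swap_adjacent w k k = w (Suc k)" "swap_adjacent w k (Suc k) = w k" "j \<noteq> k \<Longrightarrow> j \<noteq> Suc k \<Longrightarrow> swap_adjacent w k j = w j"
  by (simp_all add: swap_adjacent_def)

lemma swap_adjacent_permutes: "w permutes labels \<Longrightarrow> 1 \<le> k \<Longrightarrow> k < n \<Longrightarrow> swap_adjacent w k permutes labels"
  unfolding swap_adjacent_def by (intro permutes_compose permutes_swap_id) auto

lemma V_swap_adjacent: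
  assumes "1 \<le> k" "j \<noteq> k"
  shows "V (swap_adjacent w k) j = V w j"
proof (cases "j < k")
  case True
  then show ?thesis unfolding V_sum by (intro sum.cong) auto
next
  case False
  then have "Transposition.transpose k (Suc k) permutes {1..j}" using assms by (intro permutes_swap_id) auto
  then show ?thesis unfolding V_sum swap_adjacent_def using sum.permute[of _ "{1..j}" "\<lambda>i. dir (w i)"] by (simp add: o_def)
qed

lemma point_at_height:
  assumes u: "u permutes labels" and k: "k \<in> labels" and h: "Im (V u k) \<le> h" "h \<le> Im (V u (k - 1))"
  obtains t where "0 \<le> t" "t \<le> 1" "point_at u h = V u (k - 1) + t *\<^sub>R dir (u k)"
proof -
  let ?d = "Im (dir (u k))"
  have d: "?d < 0" using Im_dir perm_label u k by blast
  have s: "Im (V u k) = Im (V u (k - 1)) + ?d" using V_step[OF k, of u] by simp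
  let ?t = "(h - Im (V u (k - 1))) / ?d"
  have t: "0 \<le> ?t" "?t \<le> 1" using h s d by (simp_all add: divide_nonpos_neg divide_le_eq)
  have "h = Im (V u (k - 1) + ?t *\<^sub>R dir (u k))" using d by simp
  then have "point_at u h = V u (k - 1) + ?t *\<^sub>R dir (u k)" using point_at_edge[OF u k t] by metis
  then show ?thesis using that t by blast
qed

lemma point_at_swap_adjacent:
  assumes w: "w permutes labels" and k: "1 \<le> k" "k < n" and h: "Im bottom \<le> h" "h \<le> 0"
    and out: "h \<le> Im (V w (Suc k)) \<or> Im (V w (k - 1)) \<le> h"
  shows "point_at (swap_adjacent w k) h = point_at w h"
proof -
  have u: "swap_adjacent w k permutes labels" using swap_adjacent_permutes w k by blast
  obtain j t where j: "j \<in> labels" "0 \<le> t" "t \<le> 1" "h = Im (V w (j - 1) + t *\<^sub>R dir (w j))"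
    using height_cases_closed[OF w h] .
  have pw: "point_at w h = V w (j - 1) + t *\<^sub>R dir (w j)" using point_at_edge[OF w j(1-3)] j(4) by simp
  have hj: "Im (V w j) \<le> h" "h \<le> Im (V w (j - 1))" using edge_height[OF w j(1-3)] j(4) by simp_all
  have vert: ?thesis if "h = Im (V w i)" "i \<le> n" "i \<noteq> k" for i
    using point_at_vertex[OF w that(2)] point_at_vertex[OF u that(2)] V_swap_adjacent[OF k(1) that(3)] that(1) by simp
  consider "j = k" | "j = Suc k" | "j \<noteq> k" "j \<noteq> Suc k" by blast
  then show ?thesis
  proof cases
    case 1
    then have "h = Im (V w (k - 1)) \<or> h \<le> Im (V w (Suc k))" using out hj by auto
    moreover have "Im (V w (Suc k)) < Im (V w k)" using Im_V_less[OF w, of k "Suc k"] k by simp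
    ultimately have "h = Im (V w (k - 1))" using hj 1 by auto
    then show ?thesis using vert[of "k - 1"] k by simp
  next
    case 2
    then have "h = Im (V w (Suc k)) \<or> Im (V w (k - 1)) \<le> h" using out hj by auto
    moreover have "Im (V w k) < Im (V w (k - 1))" using Im_V_less[OF w, of "k - 1" k] k by simp
    ultimately have "h = Im (V w (Suc k))" using hj 2 by auto
    then show ?thesis using vert[of "Suc k"] k by simp
  next
    case 3
    then have "V (swap_adjacent w k) (j - 1) = V w (j - 1)" using V_swap_adjacent[OF k(1)] j(1) by auto
    then show ?thesis using point_at_edge[OF u j(1-3)] j(4) pw 3 by simp
  qed
qed

text \<open>At each height of the rhombus the path of \<open>w\<close> runs along the right sides
  and the exchanged path along the left sides. Comparing a point with both path points at its height
  makes the four coordinate bounds equivalent to lying between the paths.\<close>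

lemma rhombus_between:
  assumes w: "w permutes labels" and k: "1 \<le> k" "k < n" and desc: "w (Suc k) < w k"
  shows "q \<in> rhombus \<theta> (V w (k - 1)) (w (Suc k)) (w k) \<longleftrightarrow>
    Im (V w (Suc k)) \<le> Im q \<and> Im q \<le> Im (V w (k - 1)) \<and>
    abscissa (swap_adjacent w k) (Im q) \<le> Re q \<and> Re q \<le> abscissa w (Im q)"
proof -
  define i j p u where "i = w (Suc k)" and "j = w k" and "p = V w (k - 1)" and "u = swap_adjacent w k"
  have u: "u permutes labels" using swap_adjacent_permutes w k u_def by blast
  have kl: "k \<in> labels" "Suc k \<in> labels" using k by auto
  have ij: "i \<in> labels" "j \<in> labels" "i < j" using perm_label[OF w] kl desc by (auto simp: i_def j_def)
  have Vk: "V w k = p + dir j" "V w (Suc k) = p + dir i + dir j"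
    using V_step[OF kl(1), of w] V_step[OF kl(2), of w] by (simp_all add: i_def j_def p_def)
  have Uk: "V u (k - 1) = p" "V u k = p + dir i" "V u (Suc k) = p + dir i + dir j"
    using V_step[OF kl(1), of u] V_step[OF kl(2), of u] V_swap_adjacent[OF k(1), of "k - 1" w] k
    by (simp_all add: i_def j_def p_def u_def)
  obtain \<alpha> \<beta> where ab: "\<alpha> > 0" "\<beta> > 0"
    and hor: "\<And>\<epsilon>. complex_of_real \<epsilon> = (- \<epsilon> * \<alpha>) *\<^sub>R dir i + (\<epsilon> * \<beta>) *\<^sub>R dir j"
    using horizontal_coords[OF ij] by metis
  obtain a b where q: "q = p + a *\<^sub>R dir i + b *\<^sub>R dir j" using coords_exist[OF ij] .
  have d: "Im (dir i) < 0" "Im (dir j) < 0" using Im_dir ij by auto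
  \<comment> \<open>A horizontal distance \<delta> changes the two coordinates in opposite senses,
    by the constants of \<open>horizontal_coords\<close>.\<close>
  have shift: "a = a' - \<delta> * \<alpha> \<and> b = b' + \<delta> * \<beta>"
    if "q = p + a' *\<^sub>R dir i + b' *\<^sub>R dir j + of_real \<delta>" for a' b' \<delta>
  proof -
    have "p + (a *\<^sub>R dir i + b *\<^sub>R dir j) = p + ((a' - \<delta> * \<alpha>) *\<^sub>R dir i + (b' + \<delta> * \<beta>) *\<^sub>R dir j)"
      using that unfolding hor q by (simp add: algebra_simps)
    then have "a *\<^sub>R dir i + b *\<^sub>R dir j = (a' - \<delta> * \<alpha>) *\<^sub>R dir i + (b' + \<delta> * \<beta>) *\<^sub>R dir j"
      by (simp only: add_left_cancel)
    then show ?thesis by (rule coords_unique[OF ij])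
  qed
  have bounds: "Im bottom \<le> Im q \<and> Im q \<le> 0" if "Im (V w (Suc k)) \<le> Im q" "Im q \<le> Im (V w (k - 1))"
  proof -
    have "Im (V w (k - 1)) \<le> Im (V w 0)" by (rule Im_V_le[OF w]) (use k in auto)
    moreover have "Im (V w n) \<le> Im (V w (Suc k))" by (rule Im_V_le[OF w]) (use k in auto)
    ultimately show ?thesis using that V_n[OF w] by simp
  qed
  have right: "\<exists>a' b'. point_at w (Im q) = p + a' *\<^sub>R dir i + b' *\<^sub>R dir j \<and> (a' = 0 \<and> 0 \<le> b' \<and> b' \<le> 1 \<or> b' = 1 \<and> 0 \<le> a' \<and> a' \<le> 1)"
    if h: "Im (V w (Suc k)) \<le> Im q" "Im q \<le> Im (V w (k - 1))"
  proof (cases "Im (V w k) \<le> Im q")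
    case True
    obtain t where "0 \<le> t" "t \<le> 1" "point_at w (Im q) = V w (k - 1) + t *\<^sub>R dir (w k)"
      using point_at_height[OF w kl(1) True h(2)] .
    then have "0 \<le> t \<and> t \<le> 1 \<and> point_at w (Im q) = p + 0 *\<^sub>R dir i + t *\<^sub>R dir j" by (simp add: p_def j_def)
    then show ?thesis by (metis zero_le_one order_refl)
  next
    case False
    obtain t where "0 \<le> t" "t \<le> 1" "point_at w (Im q) = V w (Suc k - 1) + t *\<^sub>R dir (w (Suc k))"
      using point_at_height[OF w kl(2) h(1)] False by auto
    then have "0 \<le> t \<and> t \<le> 1 \<and> point_at w (Im q) = p + t *\<^sub>R dir i + 1 *\<^sub>R dir j" by (simp add: Vk i_def)
    then show ?thesis by (metis zero_le_one order_refl)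
  qed
  have left: "\<exists>a' b'. point_at u (Im q) = p + a' *\<^sub>R dir i + b' *\<^sub>R dir j \<and> (b' = 0 \<and> 0 \<le> a' \<and> a' \<le> 1 \<or> a' = 1 \<and> 0 \<le> b' \<and> b' \<le> 1)"
    if h: "Im (V w (Suc k)) \<le> Im q" "Im q \<le> Im (V w (k - 1))"
  proof (cases "Im (V u k) \<le> Im q")
    case True
    have "Im q \<le> Im (V u (k - 1))" using h Uk by (simp add: p_def)
    then obtain t where "0 \<le> t" "t \<le> 1" "point_at u (Im q) = V u (k - 1) + t *\<^sub>R dir (u k)"
      using point_at_height[OF u kl(1) True] by blast
    then have "0 \<le> t \<and> t \<le> 1 \<and> point_at u (Im q) = p + t *\<^sub>R dir i + 0 *\<^sub>R dir j" using Uk by (simp add: u_def i_def j_def)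
    then show ?thesis by (metis zero_le_one order_refl)
  next
    case False
    have "Im (V u (Suc k)) \<le> Im q" "Im q \<le> Im (V u (Suc k - 1))" using h Uk Vk False by simp_all
    then obtain t where "0 \<le> t" "t \<le> 1" "point_at u (Im q) = V u (Suc k - 1) + t *\<^sub>R dir (u (Suc k))"
      using point_at_height[OF u kl(2)] by blast
    then have "0 \<le> t \<and> t \<le> 1 \<and> point_at u (Im q) = p + 1 *\<^sub>R dir i + t *\<^sub>R dir j" using Uk by (simp add: u_def i_def j_def)
    then show ?thesis by (metis zero_le_one order_refl)
  qed
  have diff: "q = point_at v (Im q) + of_real (Re q - abscissa v (Im q))"
    if "v permutes labels" "Im bottom \<le> Im q \<and> Im q \<le> 0" for v
    using Im_point_at[OF that(1), of "Im q"] that(2) by (simp add: complex_eq_iff)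
  have "q \<in> rhombus \<theta> p i j \<longleftrightarrow> Im (V w (Suc k)) \<le> Im q \<and> Im q \<le> Im (V w (k - 1)) \<and>
    abscissa u (Im q) \<le> Re q \<and> Re q \<le> abscissa w (Im q)" (is "?L \<longleftrightarrow> ?R")
  proof
    assume ?L
    then have c: "0 \<le> a" "a \<le> 1" "0 \<le> b" "b \<le> 1" using rhombus_coords[OF ij] q by auto
    have "a * Im (dir i) \<le> 0" "Im (dir i) \<le> a * Im (dir i)" "b * Im (dir j) \<le> 0" "Im (dir j) \<le> b * Im (dir j)"
      using c d mult_right_mono_neg[of a 1 "Im (dir i)"] mult_right_mono_neg[of b 1 "Im (dir j)"] by (auto simp: mult_nonneg_nonpos)
    then have h: "Im (V w (Suc k)) \<le> Im q" "Im q \<le> Im (V w (k - 1))" unfolding Vk q p_def[symmetric] by simp_all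
    obtain a' b' where r: "point_at w (Im q) = p + a' *\<^sub>R dir i + b' *\<^sub>R dir j" "a' = 0 \<and> 0 \<le> b' \<and> b' \<le> 1 \<or> b' = 1 \<and> 0 \<le> a' \<and> a' \<le> 1"
      using right[OF h] by blast
    obtain a'' b'' where l: "point_at u (Im q) = p + a'' *\<^sub>R dir i + b'' *\<^sub>R dir j" "b'' = 0 \<and> 0 \<le> a'' \<and> a'' \<le> 1 \<or> a'' = 1 \<and> 0 \<le> b'' \<and> b'' \<le> 1"
      using left[OF h] by blast
    define \<delta> \<delta>' where "\<delta> = Re q - abscissa w (Im q)" and "\<delta>' = Re q - abscissa u (Im q)"
    have s: "a = a' - \<delta> * \<alpha> \<and> b = b' + \<delta> * \<beta>" using shift diff[OF w bounds[OF h]] unfolding r(1) \<delta>_def by metis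
    have s': "a = a'' - \<delta>' * \<alpha> \<and> b = b'' + \<delta>' * \<beta>" using shift diff[OF u bounds[OF h]] unfolding l(1) \<delta>'_def by metis
    have "\<delta> \<le> 0"
    proof (rule ccontr)
      assume "\<not> \<delta> \<le> 0"
      then have "\<delta> * \<alpha> > 0" "\<delta> * \<beta> > 0" using ab by simp_all
      then show False using s c r(2) by auto
    qed
    moreover have "\<delta>' \<ge> 0"
    proof (rule ccontr)
      assume "\<not> \<delta>' \<ge> 0"
      then have "\<delta>' * \<alpha> < 0" "\<delta>' * \<beta> < 0" using ab by (simp_all add: mult_less_0_iff)
      then show False using s' c l(2) by auto
    qed
    ultimately show ?R using h unfolding \<delta>_def \<delta>'_def by simp
  next
    assume R: ?R
    then have h: "Im (V w (Suc k)) \<le> Im q" "Im q \<le> Im (V w (k - 1))" by auto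
    obtain a' b' where r: "point_at w (Im q) = p + a' *\<^sub>R dir i + b' *\<^sub>R dir j" "a' = 0 \<and> 0 \<le> b' \<and> b' \<le> 1 \<or> b' = 1 \<and> 0 \<le> a' \<and> a' \<le> 1"
      using right[OF h] by blast
    obtain a'' b'' where l: "point_at u (Im q) = p + a'' *\<^sub>R dir i + b'' *\<^sub>R dir j" "b'' = 0 \<and> 0 \<le> a'' \<and> a'' \<le> 1 \<or> a'' = 1 \<and> 0 \<le> b'' \<and> b'' \<le> 1"
      using left[OF h] by blast
    define \<delta> \<delta>' where "\<delta> = Re q - abscissa w (Im q)" and "\<delta>' = Re q - abscissa u (Im q)"
    have s: "a = a' - \<delta> * \<alpha> \<and> b = b' + \<delta> * \<beta>" using shift diff[OF w bounds[OF h]] unfolding r(1) \<delta>_def by metis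
    have s': "a = a'' - \<delta>' * \<alpha> \<and> b = b'' + \<delta>' * \<beta>" using shift diff[OF u bounds[OF h]] unfolding l(1) \<delta>'_def by metis
    have "\<delta> \<le> 0" "\<delta>' \<ge> 0" using R unfolding \<delta>_def \<delta>'_def by auto
    then have "\<delta> * \<alpha> \<le> 0" "\<delta> * \<beta> \<le> 0" "\<delta>' * \<alpha> \<ge> 0" "\<delta>' * \<beta> \<ge> 0" using ab by (simp_all add: mult_nonpos_nonneg)
    then have "0 \<le> a \<and> a \<le> 1 \<and> 0 \<le> b \<and> b \<le> 1" using s s' r(2) l(2) by auto
    then show ?L using rhombus_coords[OF ij] q by simp
  qed
  then show ?thesis unfolding i_def j_def p_def u_def .
qed

lemma Im_dir_ge: "- Im (dir a) \<le> 1"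
  by (simp add: dir_def)

text \<open>A segment going down from a boundary vertex inside the region cannot point further to
  the right than the next boundary edge, and larger labels point further to the right.\<close>

lemma sector_down:
  assumes u: "u permutes labels" and j: "j < n" and a: "a \<in> labels"
    and sub: "\<And>t. 0 \<le> t \<Longrightarrow> t \<le> 1 \<Longrightarrow> V u j + t *\<^sub>R dir a \<in> region u"
  shows "a \<le> u (Suc j)"
proof -
  define b where "b = u (Suc j)"
  have jl: "Suc j \<in> labels" using j by simp
  have b: "b \<in> labels" using perm_label[OF u jl] b_def by simp
  \<comment> \<open>Each direction is scaled by the vertical extent of the other, so both points
    have the same height; the factors are at most 1 because the directions are unit vectors.\<close>
  let ?q = "V u j + (- Im (dir b)) *\<^sub>R dir a" and ?r = "V u j + (- Im (dir a)) *\<^sub>R dir b"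
  have "?q \<in> region u" using sub[of "- Im (dir b)"] Im_dir[OF b] Im_dir_ge[of b] by simp
  moreover have "?r \<in> boundary_path u" using edge_in_path[OF jl, of "- Im (dir a)" u] Im_dir[OF a] Im_dir_ge[of a] by (simp add: b_def)
  moreover have "Im ?r = Im ?q" by simp
  ultimately have "Re ?q \<le> Re ?r" using mem_path_iff[OF u, of ?r] unfolding region_def by (simp only: mem_Collect_eq)
  then have "0 \<le> cross (dir a) (dir b)" by (simp add: cross_def algebra_simps)
  then show ?thesis using cross_dir_neg[OF b a] unfolding b_def by force
qed

text \<open>The upward counterpart: going up, a smaller label points further to the right, so the
  preceding boundary edge gives a lower bound for the label.\<close>

lemma sector_up:
  assumes u: "u permutes labels" and j: "j \<in> labels" and a: "a \<in> labels"
    and sub: "\<And>t. 0 \<le> t \<Longrightarrow> t \<le> 1 \<Longrightarrow> V u j - t *\<^sub>R dir a \<in> region u"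
  shows "u j \<le> a"
proof -
  define b where "b = u j"
  have b: "b \<in> labels" using perm_label[OF u j] b_def by simp
  let ?q = "V u j - (- Im (dir b)) *\<^sub>R dir a" and ?r = "V u j - (- Im (dir a)) *\<^sub>R dir b"
  have "?q \<in> region u" using sub[of "- Im (dir b)"] Im_dir[OF b] Im_dir_ge[of b] by simp
  moreover have "?r = V u (j - 1) + (1 - (- Im (dir a))) *\<^sub>R dir (u j)"
    using V_step[OF j, of u] by (simp add: b_def algebra_simps)
  then have "?r \<in> boundary_path u" using edge_in_path[OF j, of "1 - (- Im (dir a))" u] Im_dir[OF a] Im_dir_ge[of a] by simp
  moreover have "Im ?r = Im ?q" by simp
  ultimately have "Re ?q \<le> Re ?r" using mem_path_iff[OF u, of ?r] unfolding region_def by (simp only: mem_Collect_eq)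
  then have "0 \<le> cross (dir b) (dir a)" by (simp add: cross_def algebra_simps)
  then show ?thesis using cross_dir_neg[OF a b] unfolding b_def by force
qed

end

section \<open>Strips in a tiling\<close>

context side_directions begin

lemma tile_with_labelsE:
  assumes "tile_with_labels n \<theta> L R"
  obtains p i j where "i \<in> labels" "j \<in> labels" "i < j" "L = {i, j}" "R = rhombus \<theta> p i j"
proof -
  obtain p i j where ij: "i \<in> labels" "j \<in> labels" "i \<noteq> j" "L = {i, j}" "R = rhombus \<theta> p i j"
    using assms unfolding tile_with_labels_def by blast
  show ?thesis
  proof (cases "i < j")
    case True
    then show ?thesis using that ij by blast
  next
    case False
    then have "j < i" "L = {j, i}" "R = rhombus \<theta> p j i" using ij rhombus_swap[of p i j] by auto
    then show ?thesis using that ij by blast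
  qed
qed

text \<open>From the top of a tile the right side passes the larger label first. So the other right
  edge lies above the given one if its label is larger, and below if it is smaller.\<close>

lemma right_edge_other:
  assumes "right_edge R P x"
  obtains z where "x < z" "right_edge R (P - dir z) z" "tile_with_labels n \<theta> {x, z} R"
  | z where "z < x" "right_edge R (P + dir x) z" "tile_with_labels n \<theta> {x, z} R"
proof -
  obtain p i j where ij: "i \<in> labels" "j \<in> labels" "i < j" and R: "R = rhombus \<theta> p i j"
    and c: "x = j \<and> P = p \<or> x = i \<and> P = p + dir j"
    using assms unfolding right_edge_def by blast
  have t: "tile_with_labels n \<theta> {i, j} R" unfolding tile_with_labels_def using ij R by blast
  from c show ?thesis
  proof
    assume "x = j \<and> P = p"
    then show ?thesis using that(2)[of i] rhombus_edges(2)[OF ij, of p] ij R t by (simp add: insert_commute)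
  next
    assume "x = i \<and> P = p + dir j"
    then show ?thesis using that(1)[of j] rhombus_edges(1)[OF ij, of p] ij R t by simp
  qed
qed

text \<open>The tile carries the edge of label \<open>z\<close> along its second direction,
  downwards for a larger label and upwards for a smaller one. In both cases
  \<open>cross (dir z)\<close> increases.\<close>

lemma left_edge_opposite:
  assumes "left_edge S P z"
  obtains a where "a \<in> labels" "z < a" "right_edge S (P + dir a) z"
  | a where "a \<in> labels" "a < z" "right_edge S (P - dir a) z"
proof -
  obtain p i j where ij: "i \<in> labels" "j \<in> labels" "i < j" and S: "S = rhombus \<theta> p i j"
    and c: "z = i \<and> P = p \<or> z = j \<and> P = p + dir i"
    using assms unfolding left_edge_def by blast
  from c show ?thesis
  proof
    assume "z = i \<and> P = p"
    then show ?thesis using that(1)[of j] rhombus_edges(2)[OF ij, of p] ij S by simp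
  next
    assume "z = j \<and> P = p + dir i"
    then show ?thesis using that(2)[of i] rhombus_edges(1)[OF ij, of p] ij S by simp
  qed
qed

lemma parallel_dirs:
  assumes "a *\<^sub>R dir i = b *\<^sub>R dir j" "a \<noteq> 0" "i \<in> labels" "j \<in> labels"
  shows "i = j"
proof -
  have "a * cross (dir i) (dir j) = cross (a *\<^sub>R dir i) (dir j)" by (simp add: cross_simps)
  also have "\<dots> = 0" unfolding assms(1) by (simp add: cross_simps)
  finally have "cross (dir i) (dir j) = 0" using assms(2) by simp
  then show ?thesis by (rule cross_dir_eq_0[OF assms(3,4)])
qed

lemma path_heights: "u permutes labels \<Longrightarrow> p \<in> boundary_path u \<Longrightarrow> Im bottom \<le> Im p \<and> Im p \<le> 0"
  using mem_path by blast

text \<open>\<open>\<sigma> = 1\<close> looks downwards along the path, \<open>\<sigma> = - 1\<close> upwards.\<close>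

lemma path_direction:
  assumes u: "u permutes labels" and k: "k \<in> labels" and s: "0 \<le> s" "s \<le> 1" and z: "z \<in> labels" and r: "0 < r"
    and \<sigma>: "\<sigma> = 1 \<and> s < 1 \<or> \<sigma> = - 1 \<and> 0 < s"
    and sub: "\<And>\<tau>. 0 < \<tau> \<Longrightarrow> \<tau> < r \<Longrightarrow> V u (k - 1) + s *\<^sub>R dir (u k) + (\<sigma> * \<tau>) *\<^sub>R dir z \<in> boundary_path u"
  shows "u k = z"
proof -
  let ?a = "Im (dir z)" and ?b = "Im (dir (u k))"
  have ab: "0 < - ?b" "0 < - ?a" using Im_dir z perm_label[OF u k] by auto
  define l where "l = (if \<sigma> = 1 then 1 - s else s)"
  have l: "l > 0" using \<sigma> by (auto simp: l_def)
  \<comment> \<open>Equal heights require steps \<open>\<tau>\<close> and \<open>\<rho>\<close>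
    proportional to the vertical extents of the other direction; \<open>c\<close> keeps the first
    within the given segment and the second within the rest \<open>l\<close> of the edge.\<close>
  define c where "c = min (r / 2 / - ?b) (l / - ?a)"
  define \<tau> \<rho> where "\<tau> = c * - ?b" and "\<rho> = c * - ?a"
  have "0 < r / 2 / - ?b" "0 < l / - ?a" using r l ab by (intro divide_pos_pos; simp)+
  then have c: "c > 0" by (simp only: c_def min_less_iff_conj)
  have "c \<le> r / 2 / - ?b" "c \<le> l / - ?a" unfolding c_def by (rule min.cobounded1, rule min.cobounded2)
  then have t: "\<tau> \<le> r / 2" "\<rho> \<le> l"
    unfolding \<tau>_def \<rho>_def using pos_le_divide_eq[OF ab(1)] pos_le_divide_eq[OF ab(2)] by blast+
  have pos: "\<tau> > 0" "\<rho> > 0" using c ab by (simp_all add: \<tau>_def \<rho>_def mult_pos_neg)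
  let ?q = "V u (k - 1) + s *\<^sub>R dir (u k) + (\<sigma> * \<tau>) *\<^sub>R dir z" and ?q' = "V u (k - 1) + (s + \<sigma> * \<rho>) *\<^sub>R dir (u k)"
  have "?q \<in> boundary_path u" using sub[of \<tau>] pos t r by simp
  moreover have "0 \<le> s + \<sigma> * \<rho>" "s + \<sigma> * \<rho> \<le> 1" using t pos s \<sigma> by (auto simp: l_def)
  then have "?q' \<in> boundary_path u" by (rule edge_in_path[OF k])
  moreover have "Im ?q = Im ?q'" by (simp add: \<tau>_def \<rho>_def algebra_simps)
  ultimately have "?q = ?q'" using mem_path[OF u] by metis
  then have "(\<sigma> * \<tau>) *\<^sub>R dir z = (\<sigma> * \<rho>) *\<^sub>R dir (u k)" by (simp add: algebra_simps)
  moreover have "\<sigma> * \<tau> \<noteq> 0" using pos \<sigma> by auto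
  ultimately show ?thesis using parallel_dirs[of "\<sigma> * \<tau>" z "\<sigma> * \<rho>" "u k"] z perm_label[OF u k] by simp
qed

text \<open>The label of the edge through the midpoint must be \<open>z\<close>. If the segment were
  displaced along this edge, it would run on into a neighbouring edge of the same label or beyond an
  end of the path.\<close>

lemma segment_on_path:
  assumes u: "u permutes labels" and z: "z \<in> labels"
    and sub: "\<And>t. 0 < t \<Longrightarrow> t < 1 \<Longrightarrow> P + t *\<^sub>R dir z \<in> boundary_path u"
  obtains l where "l \<in> labels" "u l = z" "P = V u (l - 1)"
proof -
  have dz: "Im (dir z) < 0" using Im_dir z by blast
  have inj: "i = j" if "u i = u j" for i j using permutes_inj[OF u] that by (simp add: inj_eq)
  define q where "q = P + (1/2) *\<^sub>R dir z"
  have q: "q \<in> boundary_path u" unfolding q_def by (rule sub) simp_all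
  have "P + (1/4) *\<^sub>R dir z \<in> boundary_path u" by (rule sub) simp_all
  then have "Im (P + (1/4) *\<^sub>R dir z) \<le> 0" using mem_path[OF u] by blast
  then have "Im q < 0" using dz by (simp add: q_def)
  then obtain l s where l: "l \<in> labels" and s: "0 < s" "s \<le> 1" and h: "Im q = Im (V u (l - 1) + s *\<^sub>R dir (u l))"
    using height_cases[OF u, of "Im q"] mem_path[OF u] q by metis
  have ql: "q = V u (l - 1) + s *\<^sub>R dir (u l)"
    using mem_path[OF u, of q] point_at_edge[OF u l _ s(2)] s q h by simp
  have lz: "u l = z"
  proof (rule path_direction[OF u l _ s(2) z, of "1/2" "- 1"])
    fix \<tau> :: real assume "0 < \<tau>" "\<tau> < 1/2"
    then have "P + (1/2 - \<tau>) *\<^sub>R dir z \<in> boundary_path u" by (intro sub) simp_all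
    moreover have "P + (1/2 - \<tau>) *\<^sub>R dir z = q - \<tau> *\<^sub>R dir z" by (simp add: q_def algebra_simps)
    ultimately show "V u (l - 1) + s *\<^sub>R dir (u l) + (- 1 * \<tau>) *\<^sub>R dir z \<in> boundary_path u" using ql by simp
  qed (use s in auto)
  \<comment> \<open>\<open>r\<close> is the displacement of the segment against the edge: positive
    if it overshoots the lower end, negative if it overshoots the upper end.\<close>
  define r where "r = s - 1/2"
  have P: "P = V u (l - 1) + r *\<^sub>R dir z" using ql lz by (simp add: q_def r_def algebra_simps)
  consider "r = 0" | "r > 0" | "r < 0" by linarith
  then show ?thesis
  proof cases
    case 1
    then show ?thesis using that[OF l lz] P by simp
  next
    case 2
    have Vl: "V u l = V u (l - 1) + dir z" using V_step[OF l, of u] lz by simp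
    have sub': "V u l + \<tau> *\<^sub>R dir z \<in> boundary_path u" if "0 < \<tau>" "\<tau> < r" for \<tau>
    proof -
      have "P + (1 - r + \<tau>) *\<^sub>R dir z \<in> boundary_path u" using that s r_def by (intro sub) simp_all
      then show ?thesis unfolding P Vl by (simp add: algebra_simps)
    qed
    show ?thesis
    proof (cases "l = n")
      case True
      have "Im bottom \<le> Im (V u l + (r / 2) *\<^sub>R dir z)" using path_heights[OF u sub'[of "r/2"]] 2 by simp
      then show ?thesis using True V_n[OF u] 2 dz mult_pos_neg[of "r / 2" "Im (dir z)"] by simp
    next
      case False
      then have l': "Suc l \<in> labels" using l by simp
      have "u (Suc l) = z" by (rule path_direction[OF u l' _ _ z 2, of 0 1]) (use sub' in auto)
      then show ?thesis using inj lz by (metis n_not_Suc_n)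
    qed
  next
    case 3
    have sub': "V u (l - 1) - \<tau> *\<^sub>R dir z \<in> boundary_path u" if "0 < \<tau>" "\<tau> < - r" for \<tau>
    proof -
      have "P + (- r - \<tau>) *\<^sub>R dir z \<in> boundary_path u" using that s r_def by (intro sub) simp_all
      then show ?thesis unfolding P by (simp add: algebra_simps)
    qed
    show ?thesis
    proof (cases "l = 1")
      case True
      have "Im (V u (l - 1) - (- r / 2) *\<^sub>R dir z) \<le> 0" using path_heights[OF u sub'[of "- r/2"]] 3 by simp
      then show ?thesis using True 3 dz mult_neg_neg[of "r / 2" "Im (dir z)"] by simp
    next
      case False
      then have l': "l - 1 \<in> labels" using l by auto
      have "u (l - 1) = z"
        by (rule path_direction[OF u l' _ _ z, of 1 "- r" "- 1"]) (use sub' 3 V_step[OF l', of u] in auto)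
      then have "l - 1 = l" using inj lz by metis
      then show ?thesis using l by auto
    qed
  qed
qed

end

section \<open>Neighbouring tiles and strips of a given tiling\<close>

locale tiling = side_directions +
  fixes w :: "nat \<Rightarrow> nat" and T :: "complex set set"
  assumes w: "w permutes labels" and tiling: "T \<in> rhombic_tilings n \<theta> w"
begin

lemma finite_T: "finite T" and Union_T: "\<Union>T = region w"
  using tiling[unfolded rhombic_tilings_def mem_Collect_eq] elnitsky_polygon_region[OF w] by argo+

lemma tile_cases:
  assumes "R \<in> T"
  obtains p i j where "i \<in> labels" "j \<in> labels" "i < j" "R = rhombus \<theta> p i j"
proof -
  have "\<forall>R\<in>T. \<exists>L. tile_with_labels n \<theta> L R"
    using tiling[unfolded rhombic_tilings_def mem_Collect_eq] by argo
  then obtain L where "tile_with_labels n \<theta> L R" using assms by blast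
  then show ?thesis using tile_with_labelsE that by metis
qed

lemma closed_tile: "R \<in> T \<Longrightarrow> closed R" and convex_tile: "R \<in> T \<Longrightarrow> convex R"
  using tile_cases[of R] compact_rhombus compact_imp_closed convex_rhombus by metis+

lemma tile_region: "R \<in> T \<Longrightarrow> q \<in> R \<Longrightarrow> q \<in> region w"
  using Union_T by blast

lemma interior_overlap: "R \<in> T \<Longrightarrow> S \<in> T \<Longrightarrow> q \<in> interior R \<Longrightarrow> q \<in> interior S \<Longrightarrow> R = S"
  using tiling[unfolded rhombic_tilings_def mem_Collect_eq, THEN conjunct2, THEN conjunct2, THEN conjunct2, THEN conjunct1]
  unfolding pairwise_def by blast

lemma tile_face: "R \<in> T \<Longrightarrow> S \<in> T \<Longrightarrow> R \<noteq> S \<Longrightarrow> (R \<inter> S) face_of R"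
  using tiling[unfolded rhombic_tilings_def mem_Collect_eq, THEN conjunct2, THEN conjunct2, THEN conjunct2, THEN conjunct2]
  unfolding pairwise_def by blast

lemma beyond_path: "q \<in> boundary_path w \<Longrightarrow> 0 < \<epsilon> \<Longrightarrow> q + of_real \<epsilon> \<notin> region w"
  using mem_path_iff[OF w, of q] unfolding region_def by simp

text \<open>Both tiles contain the points slightly to the left of the middle of the edge in their
  interiors.\<close>

lemma right_edge_unique:
  assumes "R \<in> T" "S \<in> T" "right_edge R P z" "right_edge S P z"
  shows "R = S"
proof -
  obtain \<delta> where d: "\<delta> > 0" "\<And>\<epsilon>. 0 < \<epsilon> \<Longrightarrow> \<epsilon> < \<delta> \<Longrightarrow> P + (1/2) *\<^sub>R dir z - of_real \<epsilon> \<in> interior R"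
    using left_of_right_edge[OF assms(3), of "1/2"] by auto
  obtain \<delta>' where d': "\<delta>' > 0" "\<And>\<epsilon>. 0 < \<epsilon> \<Longrightarrow> \<epsilon> < \<delta>' \<Longrightarrow> P + (1/2) *\<^sub>R dir z - of_real \<epsilon> \<in> interior S"
    using left_of_right_edge[OF assms(4), of "1/2"] by auto
  obtain \<epsilon> where "0 < \<epsilon>" "\<epsilon> < \<delta>" "\<epsilon> < \<delta>'" using dense[of 0 "min \<delta> \<delta>'"] d(1) d'(1) by auto
  then show ?thesis using interior_overlap[OF assms(1,2)] d(2) d'(2) by blast
qed

lemma not_interior_right_edge:
  assumes "R \<in> T" "S \<in> T" "R \<noteq> S" "right_edge R P z" "0 < t" "t < 1"
  shows "P + t *\<^sub>R dir z \<notin> interior S"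
proof
  assume "P + t *\<^sub>R dir z \<in> interior S"
  then obtain e where e: "e > 0" "ball (P + t *\<^sub>R dir z) e \<subseteq> interior S" using open_contains_ball[of "interior S"] by auto
  obtain \<delta> where d: "\<delta> > 0" "\<And>\<epsilon>. 0 < \<epsilon> \<Longrightarrow> \<epsilon> < \<delta> \<Longrightarrow> P + t *\<^sub>R dir z - of_real \<epsilon> \<in> interior R"
    using left_of_right_edge[OF assms(4-6)] by auto
  obtain \<epsilon> where \<epsilon>: "0 < \<epsilon>" "\<epsilon> < e" "\<epsilon> < \<delta>" using dense[of 0 "min e \<delta>"] d(1) e(1) by auto
  then have "P + t *\<^sub>R dir z - of_real \<epsilon> \<in> ball (P + t *\<^sub>R dir z) e" by (simp add: dist_norm)
  then show False using interior_overlap[OF assms(1,2)] d(2)[OF \<epsilon>(1,3)] e assms(3) by blast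
qed

text \<open>The edge-to-edge condition is what forces the two tiles to share the whole edge.\<close>

lemma shared_edge:
  assumes RS: "R \<in> T" "S \<in> T" and re: "right_edge R P z" and t: "0 < t" "t < 1"
    and q: "P + t *\<^sub>R dir z \<in> S" and \<epsilon>: "\<epsilon> > 0" "P + t *\<^sub>R dir z + of_real \<epsilon> \<in> S"
  shows "left_edge S P z"
proof -
  have zl: "z \<in> labels" using re right_edge_label by blast
  have ne: "R \<noteq> S" using beyond_right_edge[OF re \<epsilon>(1)] \<epsilon>(2) by blast
  have ends: "P \<in> R" "P + dir z \<in> R" using edge_mem[of R P z 0] edge_mem[of R P z 1] re by simp_all
  have qR: "P + t *\<^sub>R dir z \<in> R" using edge_mem[of R P z t] re t by simp
  have "dir z \<noteq> 0" using Im_dir[OF zl] by auto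
  then have "P + t *\<^sub>R dir z \<in> open_segment P (P + dir z)"
    using t unfolding in_segment by (auto intro!: exI[of _ t] simp: algebra_simps)
  \<comment> \<open>The intersection is a face of \<open>R\<close> and contains an inner point of
    the edge, so it contains both end points. A segment of full edge length then leaves no room for
    displacement along the side of \<open>S\<close>.\<close>
  then have "P \<in> R \<inter> S" "P + dir z \<in> R \<inter> S"
    using tile_face[OF RS ne] ends q qR unfolding face_of_def by blast+
  moreover have "P + (1/2) *\<^sub>R dir z \<notin> interior S" using not_interior_right_edge[OF RS ne re] by simp
  moreover obtain p i j where "i \<in> labels" "j \<in> labels" "i < j" "S = rhombus \<theta> p i j" using tile_cases[OF RS(2)] .
  ultimately obtain P' t' where "P = P' + t' *\<^sub>R dir z" "0 \<le> t'" "t' + 1 \<le> 1" "right_edge S P' z \<or> left_edge S P' z"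
    using segment_in_edge[of i j S p z 1 P] zl by auto
  then have "right_edge S P z \<or> left_edge S P z" by auto
  moreover have "\<not> right_edge S P z" using beyond_right_edge \<epsilon> by blast
  ultimately show ?thesis by blast
qed

text \<open>Among finitely many tiles one contains infinitely many terms of a sequence tending to
  \<open>q\<close> in direction \<open>c\<close>; being closed, it contains \<open>q\<close> as
  well.\<close>

lemma tile_towards:
  assumes \<delta>: "\<delta> > 0" and sub: "\<And>\<epsilon>. 0 < \<epsilon> \<Longrightarrow> \<epsilon> < \<delta> \<Longrightarrow> q + \<epsilon> *\<^sub>R c \<in> region w"
  obtains S \<epsilon> where "S \<in> T" "q \<in> S" "\<epsilon> > 0" "q + \<epsilon> *\<^sub>R c \<in> S"
proof -
  define f where "f m = \<delta> / (real m + 2)" for m :: nat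
  have f: "0 < f m" "f m < \<delta>" for m using \<delta> by (simp_all add: f_def divide_less_eq)
  have "\<forall>m. \<exists>S\<in>T. q + f m *\<^sub>R c \<in> S" using sub f Union_T by blast
  then obtain S where S: "\<And>m. S m \<in> T" "\<And>m. q + f m *\<^sub>R c \<in> S m" by metis
  have "finite (S ` UNIV)" using finite_T S(1) finite_subset[of "S ` UNIV" T] by blast
  then obtain m0 where inf: "infinite {m. S m = S m0}" using pigeonhole_infinite[of UNIV S] by auto
  define g where "g = enumerate {m. S m = S m0}"
  have g: "strict_mono g" "\<And>m. S (g m) = S m0" using inf enumerate_in_set[OF inf] strict_mono_enumerate[OF inf] by (auto simp: g_def)
  have "f \<longlonglongrightarrow> 0" unfolding f_def by (intro tendsto_divide_0[OF tendsto_const] filterlim_at_top_imp_at_infinity filterlim_tendsto_add_at_top[OF _ filterlim_real_sequentially, of _ 2, simplified add.commute] ) auto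
  then have "(\<lambda>m. f (g m)) \<longlonglongrightarrow> 0" using g(1) by (auto dest: LIMSEQ_subseq_LIMSEQ simp: o_def)
  then have lim: "(\<lambda>m. q + f (g m) *\<^sub>R c) \<longlonglongrightarrow> q + 0 *\<^sub>R c" by (intro tendsto_intros)
  have mem: "q + f (g m) *\<^sub>R c \<in> S m0" for m using S(2)[of "g m"] g(2)[of m] by simp
  have "q + 0 *\<^sub>R c \<in> S m0" by (rule closed_sequentially[OF closed_tile[OF S(1)[of m0]] _ lim]) (use mem in blast)
  then have "q \<in> S m0" by simp
  then show ?thesis using that[OF S(1)[of m0] _ f(1)[of m0] S(2)[of m0]] by blast
qed

text \<open>One point of the open edge off the right boundary suffices for a tile on the other side,
  since \<open>shared_edge\<close> extends the contact to the whole edge. Otherwise the edge lies on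
  the boundary path and must be its edge of label \<open>z\<close>.\<close>

lemma strip_step:
  assumes R: "R \<in> T" and re: "right_edge R P z"
  obtains l where "l \<in> labels" "w l = z" "P = V w (l - 1)"
  | S where "S \<in> T" "left_edge S P z"
proof (cases "\<exists>t. 0 < t \<and> t < 1 \<and> P + t *\<^sub>R dir z \<notin> boundary_path w")
  case True
  then obtain t where t: "0 < t" "t < 1" "P + t *\<^sub>R dir z \<notin> boundary_path w" by blast
  let ?q = "P + t *\<^sub>R dir z"
  have q: "?q \<in> region w" using tile_region[OF R] edge_mem[of R P z t] re t by simp
  then have "Re ?q < abscissa w (Im ?q)" using t(3) mem_path_iff[OF w, of ?q] unfolding region_def by auto
  then obtain \<delta> where \<delta>: "\<delta> > 0" "\<delta> = abscissa w (Im ?q) - Re ?q" by simp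
  have "?q + \<epsilon> *\<^sub>R 1 \<in> region w" if "0 < \<epsilon>" "\<epsilon> < \<delta>" for \<epsilon>
    using q that \<delta> unfolding region_def by simp
  then obtain S \<epsilon> where "S \<in> T" "?q \<in> S" "\<epsilon> > 0" "?q + \<epsilon> *\<^sub>R 1 \<in> S" using tile_towards[OF \<delta>(1)] by blast
  then show ?thesis using that(2) shared_edge[OF R _ re t(1,2), of S \<epsilon>] by (simp add: scaleR_conv_of_real)
next
  case False
  then show ?thesis using segment_on_path[OF w right_edge_label[OF re], of P] that(1) by blast
qed

text \<open>Full support leaves room to the left of each inner point of the edge, but different
  points might be covered by different tiles. With infinitely many points and finitely many tiles,
  one tile contains two of them, and the segment in between lies on one of its sides.\<close>

lemma tile_at_boundary:
  assumes fs: "fully_supported n w" and k: "k \<in> labels"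
  obtains R where "R \<in> T" "right_edge R (V w (k - 1)) (w k)"
proof -
  define z where "z = w k"
  have z: "z \<in> labels" using perm_label[OF w k] z_def by simp
  have dz: "Im (dir z) < 0" using Im_dir z by blast
  define q where "q t = V w (k - 1) + t *\<^sub>R dir z" for t
  have qp: "q t \<in> boundary_path w" if "0 \<le> t" "t \<le> 1" for t unfolding q_def z_def using edge_in_path[OF k that] .
  have "\<exists>S\<in>T. q t \<in> S \<and> (\<exists>\<epsilon>>0. q t - of_real \<epsilon> \<in> S)" if t: "0 < t" "t < 1" for t
  proof -
    have "t * Im (dir z) < 0" "Im (dir z) < t * Im (dir z)" using t dz mult_strict_right_mono_neg[of t 1 "Im (dir z)"] by (auto simp: mult_pos_neg)
    moreover have "Im (V w k) = Im (V w (k - 1)) + Im (dir z)" using V_step[OF k, of w] z_def by simp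
    moreover have "Im (V w (k - 1)) \<le> Im (V w 0)" by (rule Im_V_le[OF w]) (use k in auto)
    moreover have "Im (V w n) \<le> Im (V w k)" by (rule Im_V_le[OF w]) (use k in auto)
    ultimately have h: "Im bottom < Im (q t)" "Im (q t) < 0" using V_n[OF w] by (auto simp: q_def)
    have lt: "abscissa id (Im (q t)) < abscissa w (Im (q t))" using abscissa_id_less[OF w fs h] .
    have re: "Re (q t) = abscissa w (Im (q t))" using qp[of t] t mem_path_iff[OF w] by simp
    obtain \<delta> where \<delta>: "\<delta> > 0" "\<delta> = Re (q t) - abscissa id (Im (q t))" using lt re by simp
    have "q t + \<epsilon> *\<^sub>R (-1) \<in> region w" if "0 < \<epsilon>" "\<epsilon> < \<delta>" for \<epsilon>
      using h re that \<delta> unfolding region_def by simp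
    then obtain S \<epsilon> where "S \<in> T" "q t \<in> S" "\<epsilon> > 0" "q t + \<epsilon> *\<^sub>R (-1) \<in> S" using tile_towards[OF \<delta>(1)] by blast
    then show ?thesis by (auto simp: scaleR_conv_of_real)
  qed
  then obtain S where S: "\<And>t. 0 < t \<Longrightarrow> t < 1 \<Longrightarrow> S t \<in> T \<and> q t \<in> S t \<and> (\<exists>\<epsilon>>0. q t - of_real \<epsilon> \<in> S t)" by metis
  have "infinite {0<..<1::real}" by (simp add: infinite_Ioo)
  moreover have "finite (S ` {0<..<1})" using S finite_T finite_subset[of "S ` {0<..<1}" T] by force
  ultimately obtain t0 where "t0 \<in> {0<..<1}" and inf: "infinite {t \<in> {0<..<1}. S t = S t0}"
    using pigeonhole_infinite[of "{0<..<1}" S] by blast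
  define R where "R = S t0"
  have R: "R \<in> T" using S \<open>t0 \<in> _\<close> R_def by simp
  obtain t1 where t1: "t1 \<in> {t \<in> {0<..<1}. S t = S t0}" using inf infinite_imp_nonempty by blast
  have "infinite ({t \<in> {0<..<1}. S t = S t0} - {t1})" using inf by simp
  then obtain t2 where t2: "t2 \<in> {t \<in> {0<..<1}. S t = S t0}" "t2 \<noteq> t1" using infinite_imp_nonempty by blast
  obtain a b where ab: "0 < a" "a < b" "b < 1" "S a = R" "S b = R"
    using t1 t2 unfolding R_def by (cases t1 t2 rule: linorder_cases) auto
  have qa: "q a \<in> R" "\<exists>\<epsilon>>0. q a - of_real \<epsilon> \<in> R" and qb: "q b \<in> R" using S[of a] S[of b] ab by auto
  have mid: "q ((a + b) / 2) = q a + ((b - a) / 2) *\<^sub>R dir z" "q b = q a + (b - a) *\<^sub>R dir z"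
    by (simp_all add: q_def complex_eq_iff field_simps)
  have "q ((a + b) / 2) \<notin> interior R"
    using beyond_path[OF qp[of "(a + b) / 2"]] tile_region[OF R] ab by (intro not_interiorI) auto
  moreover obtain p i j where "i \<in> labels" "j \<in> labels" "i < j" "R = rhombus \<theta> p i j" using tile_cases[OF R] .
  ultimately obtain P t where P: "q a = P + t *\<^sub>R dir z" "0 \<le> t" "t + (b - a) \<le> 1" "right_edge R P z \<or> left_edge R P z"
    using segment_in_edge[of i j R p z "b - a" "q a"] z ab qa qb mid by auto
  then have re: "right_edge R P z" using qa(2) beyond_left_edge by metis
  \<comment> \<open>The side found so far might still be displaced along the boundary edge. Then
    \<open>strip_step\<close> would provide a tile on its right, whose interior would reach beyond
    the right boundary.\<close>
  show ?thesis
  proof (rule strip_step[OF R re])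
    fix l assume l: "l \<in> labels" "w l = z" "P = V w (l - 1)"
    then have "l = k" using permutes_inj[OF w] z_def by (simp add: inj_eq)
    then show ?thesis using that R re l z_def by simp
  next
    fix S' assume S': "S' \<in> T" "left_edge S' P z"
    let ?t = "t + (b - a) / 2"
    have "0 < ?t" "?t < 1" using P(2,3) ab by (simp_all add: field_simps)
    then obtain \<delta> where d: "\<delta> > 0" "\<And>\<epsilon>. 0 < \<epsilon> \<Longrightarrow> \<epsilon> < \<delta> \<Longrightarrow> P + ?t *\<^sub>R dir z + of_real \<epsilon> \<in> interior S'"
      using right_of_left_edge[OF S'(2)] by blast
    have "P + ?t *\<^sub>R dir z = q ((a + b) / 2)" unfolding mid P by (simp add: algebra_simps)
    then have "q ((a + b) / 2) + of_real (\<delta> / 2) \<in> region w" using d(2)[of "\<delta> / 2"] d(1) tile_region[OF S'(1)] interior_subset by fastforce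
    then show ?thesis using beyond_path[OF qp[of "(a + b) / 2"], of "\<delta> / 2"] d(1) ab by simp
  qed
qed

text \<open>The side cannot be a left edge, because the tile would then extend beyond the right
  boundary.\<close>

lemma boundary_edge_right:
  assumes R: "R \<in> T" and k: "k \<in> labels" and sub: "boundary_edge \<theta> w k \<subseteq> R"
  shows "right_edge R (V w (k - 1)) (w k)"
proof -
  let ?P = "V w (k - 1)" and ?z = "w k"
  have z: "?z \<in> labels" using perm_label[OF w k] .
  have mem: "?P + t *\<^sub>R dir ?z \<in> R" if "0 \<le> t" "t \<le> 1" for t using sub mem_boundary_edge[OF k] that by blast
  have mp: "?P + (1/2) *\<^sub>R dir ?z \<in> boundary_path w" using edge_in_path[OF k] by simp
  have "?P + (1/2) *\<^sub>R dir ?z \<notin> interior R"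
    using beyond_path[OF mp] tile_region[OF R] by (intro not_interiorI) blast
  moreover obtain p i j where "i \<in> labels" "j \<in> labels" "i < j" "R = rhombus \<theta> p i j" using tile_cases[OF R] .
  ultimately obtain P t where P: "?P = P + t *\<^sub>R dir ?z" "0 \<le> t" "t + 1 \<le> 1" "right_edge R P ?z \<or> left_edge R P ?z"
    using segment_in_edge[of i j R p ?z 1 ?P] z mem[of 0] mem[of 1] by auto
  then have "right_edge R ?P ?z \<or> left_edge R ?P ?z" by auto
  moreover have "\<not> left_edge R ?P ?z"
  proof
    assume "left_edge R ?P ?z"
    then obtain \<delta> where d: "\<delta> > 0" "\<And>\<epsilon>. 0 < \<epsilon> \<Longrightarrow> \<epsilon> < \<delta> \<Longrightarrow> ?P + (1/2) *\<^sub>R dir ?z + of_real \<epsilon> \<in> interior R"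
      using right_of_left_edge[of R ?P ?z "1/2"] by auto
    then have "?P + (1/2) *\<^sub>R dir ?z + of_real (\<delta> / 2) \<in> region w" using d(2)[of "\<delta> / 2"] d(1) tile_region[OF R] interior_subset by fastforce
    then show False using beyond_path[OF mp, of "\<delta> / 2"] d(1) by simp
  qed
  ultimately show ?thesis by blast
qed

text \<open>
  Following the strip of label \<open>z\<close> to the right, the functional \<open>cross (dir z)\<close> increases by at
  least a fixed amount with each tile, so the strip ends on the right boundary.
\<close>

lemma strip_induct:
  assumes R: "R \<in> T" "right_edge R P z" and I: "I P"
    and step: "\<And>P Q S. I P \<Longrightarrow> S \<in> T \<Longrightarrow> left_edge S P z \<Longrightarrow> right_edge S Q z \<Longrightarrow>
      (\<exists>a\<in>labels. z < a \<and> Q = P + dir a \<or> a < z \<and> Q = P - dir a) \<Longrightarrow> I Q"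
  shows "\<exists>l\<in>labels. w l = z \<and> I (V w (l - 1))"
proof (rule ccontr)
  assume no: "\<not> ?thesis"
  have z: "z \<in> labels" using R right_edge_label by blast
  \<comment> \<open>A uniform lower bound for the gain per tile; finitely many labels make it
    positive. The inserted 1 supplies nonemptiness for \<open>Min\<close>.\<close>
  define \<mu> where "\<mu> = Min (insert 1 ((\<lambda>a. \<bar>cross (dir z) (dir a)\<bar>) ` (labels - {z})))"
  have \<mu>: "\<mu> > 0" unfolding \<mu>_def using cross_dir_eq_0[OF z] by (subst Min_gr_iff) (auto, blast)
  have \<mu>_le: "\<mu> \<le> \<bar>cross (dir z) (dir a)\<bar>" if "a \<in> labels" "a \<noteq> z" for a
    unfolding \<mu>_def by (intro Min_le) (use that in auto)
  have ex: "\<exists>R P'. R \<in> T \<and> right_edge R P' z \<and> I P' \<and> cross (dir z) P + real N * \<mu> \<le> cross (dir z) P'" for N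
  proof (induction N)
    case 0
    then show ?case using R I by auto
  next
    case (Suc N)
    then obtain R P' where IH: "R \<in> T" "right_edge R P' z" "I P'" "cross (dir z) P + real N * \<mu> \<le> cross (dir z) P'" by blast
    obtain S where S: "S \<in> T" "left_edge S P' z"
      using strip_step[OF IH(1,2)] no IH(3) by metis
    obtain Q a where Q: "right_edge S Q z" "a \<in> labels" "z < a \<and> Q = P' + dir a \<or> a < z \<and> Q = P' - dir a"
      using left_edge_opposite[OF S(2)] by metis
    then have "I Q" using step[OF IH(3) S Q(1)] by blast
    moreover have "cross (dir z) P' + \<mu> \<le> cross (dir z) Q"
      using Q \<mu>_le[of a] cross_dir[OF z, of a] cross_dir_neg[of a z] z by (auto simp: cross_simps)
    ultimately show ?case using S Q(1) IH(4) by (intro exI[of _ S] exI[of _ Q]) (auto simp: algebra_simps)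
  qed
  have "compact (region w)" unfolding Union_T[symmetric]
    using finite_T tile_cases compact_rhombus by (metis compact_Union)
  then have "bounded ((\<lambda>p. cross (dir z) p) ` region w)"
    unfolding cross_def by (intro compact_imp_bounded compact_continuous_image continuous_intros)
  then obtain B where B: "\<And>p. p \<in> region w \<Longrightarrow> \<bar>cross (dir z) p\<bar> \<le> B" unfolding bounded_iff by auto
  obtain N :: nat where N: "(B - cross (dir z) P) / \<mu> < real N" using reals_Archimedean2 by blast
  obtain R P' where "R \<in> T" "right_edge R P' z" "cross (dir z) P + real N * \<mu> \<le> cross (dir z) P'" using ex by blast
  moreover have "P' \<in> region w" using calculation tile_region edge_mem[of R P' z 0] by auto
  ultimately show False using B[of P'] N \<mu> by (simp add: divide_less_eq)
qed

text \<open>By convexity the tile would contain a point at the height of \<open>q\<close> with a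
  larger value of \<open>cross (dir z)\<close>, hence to the right of \<open>q\<close>, although
  \<open>q\<close> is the rightmost point of the region at that height.\<close>

lemma no_crossing:
  assumes S: "S \<in> T" "c \<in> S" "c' \<in> S" and q: "q \<in> boundary_path w" and z: "z \<in> labels"
    and l: "cross (dir z) q < cross (dir z) c" "cross (dir z) q < cross (dir z) c'"
    and h: "Im q < Im c \<and> Im c' \<le> Im q \<or> Im c < Im q \<and> Im q \<le> Im c'"
  shows False
proof -
  define t where "t = (Im q - Im c) / (Im c' - Im c)"
  have t: "0 \<le> t" "t \<le> 1" "t * (Im c' - Im c) = Im q - Im c"
    using h unfolding t_def by (auto simp: divide_simps)
  define r where "r = (1 - t) *\<^sub>R c + t *\<^sub>R c'"
  have r: "r \<in> region w" using tile_region[OF S(1)] convexD_alt[OF convex_tile[OF S(1)] S(2,3) t(1,2)] r_def by simp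
  have imr: "Im r = Im q" using t(3) by (simp add: r_def algebra_simps)
  have "cross (dir z) r = (1 - t) * cross (dir z) c + t * cross (dir z) c'" by (simp add: r_def cross_simps)
  moreover have "cross (dir z) q < (1 - t) * cross (dir z) c + t * cross (dir z) c'"
  proof -
    have "0 < (1 - t) * (cross (dir z) c - cross (dir z) q) + t * (cross (dir z) c' - cross (dir z) q)"
      using l t by (cases "t = 0") (auto intro!: add_nonneg_pos)
    then show ?thesis by (simp add: algebra_simps)
  qed
  ultimately have lr: "cross (dir z) q < cross (dir z) r" by simp
  have "r = q + of_real (Re r - Re q)" using imr by (simp add: complex_eq_iff)
  then have "cross (dir z) r = cross (dir z) q - (Re r - Re q) * Im (dir z)"
    by (metis cross_simps(2) cross_simps(12) diff_conv_add_uminus mult_minus_left)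
  then have "(Re r - Re q) * Im (dir z) < 0" using lr by simp
  then have "Re q < Re r" using Im_dir[OF z] by (simp add: mult_less_0_iff)
  moreover have "Re q = abscissa w (Im r)" using mem_path_iff[OF w] q imr by simp
  ultimately show False using r unfolding region_def by simp
qed

text \<open>The invariant follows the lower ends of the edges in the strip. The first one is the
  vertex \<open>V w (k - 1)\<close>; all later ones stay strictly above its height, so the strip
  ends at a boundary edge before position \<open>k\<close>.\<close>

lemma lower_tile_label:
  assumes R: "R \<in> T" "right_edge R (V w (k - 1) - dir z) z" and k: "k \<in> labels" and z: "w k < z"
  obtains l where "l \<in> labels" "l < k" "w l = z"
proof -
  define q where "q = V w (k - 1)"
  have kn: "k - 1 \<le> n" "k - 1 < n" "Suc (k - 1) = k" using k by auto
  have q: "q \<in> boundary_path w" unfolding q_def using vertex_in_path kn by simp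
  have zl: "z \<in> labels" using right_edge_label R by blast
  let ?I = "\<lambda>P. P + dir z = q \<or> cross (dir z) q < cross (dir z) (P + dir z) \<and> Im q < Im (P + dir z)"
  have "\<exists>l\<in>labels. w l = z \<and> ?I (V w (l - 1))"
  proof (rule strip_induct[OF R, of ?I])
    show "?I (V w (k - 1) - dir z)" by (simp add: q_def)
    fix P Q S assume I: "?I P" and S: "S \<in> T" "left_edge S P z" "right_edge S Q z"
      and Q: "\<exists>a\<in>labels. z < a \<and> Q = P + dir a \<or> a < z \<and> Q = P - dir a"
    obtain a where a: "a \<in> labels" "z < a \<and> Q = P + dir a \<or> a < z \<and> Q = P - dir a" using Q by blast
    have c: "P + dir z \<in> S" "Q + dir z \<in> S" using edge_mem[of S P z 1] edge_mem[of S Q z 1] S by simp_all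
    have up: "cross (dir z) (P + dir z) < cross (dir z) (Q + dir z)"
      using a cross_dir[OF zl, of a] cross_dir_neg[of a z] zl by (auto simp: cross_simps)
    show "?I Q"
    proof (cases "P + dir z = q")
      case True
      \<comment> \<open>At the vertex itself \<open>no_crossing\<close> does not apply. A downward
        move along \<open>dir a\<close> would leave the vertex inside the region, and
        \<open>sector_down\<close> would give \<open>a \<le> w k < z < a\<close>.\<close>
      have "\<not> z < a"
      proof
        assume "z < a"
        then have "Q + dir z = q + dir a" using a(2) by (simp flip: True)
        then have "(1 - t) *\<^sub>R (P + dir z) + t *\<^sub>R (Q + dir z) = V w (k - 1) + t *\<^sub>R dir a" for t
          unfolding True q_def by (simp add: algebra_simps)
        then have "V w (k - 1) + t *\<^sub>R dir a \<in> region w" if "0 \<le> t" "t \<le> 1" for t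
          using convexD_alt[OF convex_tile[OF S(1)] c that] tile_region[OF S(1)] by metis
        then have "a \<le> w (Suc (k - 1))" by (rule sector_down[OF w kn(2) a(1)])
        then show False using z \<open>z < a\<close> kn by simp
      qed
      then have "Q + dir z = q - dir a" using a(2) by (simp flip: True)
      then show ?thesis using up True Im_dir[OF a(1)] by simp
    next
      case False
      then have P: "cross (dir z) q < cross (dir z) (P + dir z)" "Im q < Im (P + dir z)" using I by auto
      then have Ql: "cross (dir z) q < cross (dir z) (Q + dir z)" using up by simp
      then have "\<not> Im (Q + dir z) \<le> Im q" using no_crossing[OF S(1) c q zl P(1) Ql] P(2) by blast
      then show ?thesis using Ql by auto
    qed
  qed
  then obtain l where l: "l \<in> labels" "w l = z" "?I (V w (l - 1))" by blast
  have "V w (l - 1) + dir z = V w l" using V_step[OF l(1), of w] l(2) by simp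
  then have "V w l = V w (k - 1) \<or> Im (V w (k - 1)) < Im (V w l)" using l(3) q_def by auto
  then have "l \<le> k - 1" using V_inj[OF w, of l "k - 1"] Im_V_less_iff[OF w, of "k - 1" l] Im_V_le[OF w, of "k - 1" l] l(1) kn
    by (metis atLeastAtMost_iff le_cases leD order_refl)
  then show ?thesis using that[OF l(1) _ l(2)] k by auto
qed

text \<open>The mirror image of \<open>lower_tile_label\<close>: the upper ends are followed from
  \<open>V w k\<close>, they stay below its height, and \<open>sector_up\<close> settles the move
  away from the vertex.\<close>

lemma upper_tile_label:
  assumes R: "R \<in> T" "right_edge R (V w k) z" and k: "k \<in> labels" and z: "z < w k"
  obtains l where "l \<in> labels" "k < l" "w l = z"
proof -
  define q where "q = V w k"
  have kn: "k \<le> n" using k by auto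
  have q: "q \<in> boundary_path w" unfolding q_def using vertex_in_path kn by simp
  have zl: "z \<in> labels" using right_edge_label R by blast
  let ?I = "\<lambda>P. P = q \<or> cross (dir z) q < cross (dir z) P \<and> Im P < Im q"
  have "\<exists>l\<in>labels. w l = z \<and> ?I (V w (l - 1))"
  proof (rule strip_induct[OF R, of ?I])
    show "?I (V w k)" by (simp add: q_def)
    fix P Q S assume I: "?I P" and S: "S \<in> T" "left_edge S P z" "right_edge S Q z"
      and Q: "\<exists>a\<in>labels. z < a \<and> Q = P + dir a \<or> a < z \<and> Q = P - dir a"
    obtain a where a: "a \<in> labels" "z < a \<and> Q = P + dir a \<or> a < z \<and> Q = P - dir a" using Q by blast
    have c: "P \<in> S" "Q \<in> S" using edge_mem[of S P z 0] edge_mem[of S Q z 0] S by simp_all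
    have up: "cross (dir z) P < cross (dir z) Q"
      using a cross_dir[OF zl, of a] cross_dir_neg[of a z] zl by (auto simp: cross_simps)
    show "?I Q"
    proof (cases "P = q")
      case True
      have "\<not> a < z"
      proof
        assume "a < z"
        then have Qe: "Q = q - dir a" using a(2) by (simp flip: True)
        then have "(1 - t) *\<^sub>R P + t *\<^sub>R Q = V w k - t *\<^sub>R dir a" for t
          unfolding True Qe q_def by (simp add: algebra_simps)
        then have "V w k - t *\<^sub>R dir a \<in> region w" if "0 \<le> t" "t \<le> 1" for t
          using convexD_alt[OF convex_tile[OF S(1)] c that] tile_region[OF S(1)] by metis
        then have "w k \<le> a" by (rule sector_up[OF w k a(1)])
        then show False using z \<open>a < z\<close> by simp
      qed
      then have "Q = q + dir a" using a(2) by (simp flip: True)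
      then show ?thesis using up True Im_dir[OF a(1)] by simp
    next
      case False
      then have P: "cross (dir z) q < cross (dir z) P" "Im P < Im q" using I by auto
      then have Ql: "cross (dir z) q < cross (dir z) Q" using up by simp
      then have "\<not> Im q \<le> Im Q" using no_crossing[OF S(1) c q zl P(1) Ql] P(2) by blast
      then show ?thesis using Ql by auto
    qed
  qed
  then obtain l where l: "l \<in> labels" "w l = z" "?I (V w (l - 1))" by blast
  have ln: "l - 1 \<le> n" using l(1) by auto
  have "V w (l - 1) = V w k \<or> Im (V w (l - 1)) < Im (V w k)" using l(3) q_def by auto
  then have "k \<le> l - 1" using V_inj[OF w ln kn] Im_V_less_iff[OF w kn ln] by auto
  then show ?thesis using that[OF l(1) _ l(2)] l(1) by auto
qed

text \<open>A larger second label would stand before \<open>k\<close> by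
  \<open>lower_tile_label\<close>, against \<open>before\<close>. A smaller one stands after
  \<open>k\<close>, and at \<open>V w k\<close> the region itself bounds it by the next boundary
  label.\<close>

lemma forced_tile:
  assumes fs: "fully_supported n w" and k: "k \<in> labels" "Suc k \<in> labels" 
    and before: "\<And>i. i \<in> labels \<Longrightarrow> i < k \<Longrightarrow> w i < w k"
    and after: "\<And>l. l \<in> labels \<Longrightarrow> Suc k < l \<Longrightarrow> w (Suc k) < w l"
  obtains R where "R \<in> T" "tile_with_labels n \<theta> {w k, w (Suc k)} R"
    "right_edge R (V w (k - 1)) (w k)" "right_edge R (V w k) (w (Suc k))"
proof -
  obtain R where R: "R \<in> T" "right_edge R (V w (k - 1)) (w k)" using tile_at_boundary[OF fs k(1)] .
  show ?thesis
  proof (rule right_edge_other[OF R(2)])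
    fix z assume "w k < z" "right_edge R (V w (k - 1) - dir z) z"
    then obtain l where "l \<in> labels" "l < k" "w l = z" using lower_tile_label[OF R(1) _ k(1)] by blast
    then show ?thesis using before[of l] \<open>w k < z\<close> by simp
  next
    fix z assume z: "z < w k" "right_edge R (V w (k - 1) + dir (w k)) z" "tile_with_labels n \<theta> {w k, z} R"
    then have re: "right_edge R (V w k) z" using V_step[OF k(1), of w] by simp
    obtain l where l: "l \<in> labels" "k < l" "w l = z" using upper_tile_label[OF R(1) re k(1) z(1)] .
    have "V w k + t *\<^sub>R dir z \<in> region w" if "0 \<le> t" "t \<le> 1" for t
      using tile_region[OF R(1)] edge_mem[of R "V w k" z t] re that by blast
    \<comment> \<open>Together with \<open>after\<close> this leaves only position
      \<open>Suc k\<close> for the label \<open>z\<close>.\<close>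
    then have "z \<le> w (Suc k)" using sector_down[OF w _ right_edge_label[OF re]] k by simp
    then have "l = Suc k" using after[of l] l by (cases "l = Suc k") auto
    then show ?thesis using that[OF R(1) _ R(2)] z re l by simp
  qed
qed

end

section \<open>Existence of tilings\<close>

context side_directions begin

text \<open>
  The induction over permutations passes through paths that touch the left boundary, where the
  polygon has degenerate parts that no tile covers; the condition on boundary edges makes the
  edge-to-edge condition inductive.
\<close>

definition weak_tiling :: "(nat \<Rightarrow> nat) \<Rightarrow> complex set set \<Rightarrow> bool" where
  "weak_tiling w T \<longleftrightarrow> finite T \<and> (\<forall>R\<in>T. \<exists>L. tile_with_labels n \<theta> L R)
     \<and> open_region w \<subseteq> \<Union>T \<and> \<Union>T \<subseteq> region w
     \<and> pairwise (\<lambda>R S. interior R \<inter> interior S = {}) T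
     \<and> pairwise (\<lambda>R S. (R \<inter> S) face_of R \<and> (R \<inter> S) face_of S) T
     \<and> (\<forall>S\<in>T. \<forall>j\<in>labels. (S \<inter> boundary_edge \<theta> w j) face_of S \<and> (S \<inter> boundary_edge \<theta> w j) face_of boundary_edge \<theta> w j)"

lemma weak_tiling_id: "weak_tiling id {}"
  unfolding weak_tiling_def open_region_def by auto

lemma closed_tile_with_labels: "tile_with_labels n \<theta> L R \<Longrightarrow> closed R"
  and convex_tile_with_labels: "tile_with_labels n \<theta> L R \<Longrightarrow> convex R"
  using tile_with_labelsE[of L R] compact_rhombus compact_imp_closed convex_rhombus by metis+

text \<open>The union of finitely many closed tiles is closed, and full support makes the open
  region dense in the polygon.\<close>

lemma weak_tiling_rhombic:
  assumes w: "w permutes labels" and fs: "fully_supported n w" and T: "weak_tiling w T"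
  shows "T \<in> rhombic_tilings n \<theta> w"
proof -
  note t = T[unfolded weak_tiling_def]
  have fin: "finite T" and tile: "\<forall>R\<in>T. \<exists>L. tile_with_labels n \<theta> L R"
    and cov: "open_region w \<subseteq> \<Union>T" and sub: "\<Union>T \<subseteq> region w"
    and int: "pairwise (\<lambda>R S. interior R \<inter> interior S = {}) T"
    and fc: "pairwise (\<lambda>R S. (R \<inter> S) face_of R \<and> (R \<inter> S) face_of S) T" using t by argo+
  have "closed (\<Union>T)" using fin tile closed_tile_with_labels by (meson closed_Union)
  then have "region w \<subseteq> \<Union>T" using region_subset_closed[OF w fs] cov by blast
  then have "\<Union>T = elnitsky_polygon n \<theta> w" using sub elnitsky_polygon_region[OF w] by auto
  then show ?thesis unfolding rhombic_tilings_def using fin tile int fc by simp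
qed

text \<open>The new rhombus is the area between the old and the new path, so it meets the old region
  only along its two left sides, which are edges of the old path. The boundary condition of the old
  tiling is thus just what makes the new contacts edge-to-edge.\<close>

lemma weak_tiling_step:
  assumes w: "w permutes labels" and k: "1 \<le> k" "k < n" and desc: "w (Suc k) < w k"
    and T: "weak_tiling (swap_adjacent w k) T"
  shows "weak_tiling w (insert (rhombus \<theta> (V w (k - 1)) (w (Suc k)) (w k)) T)"
proof -
  define x y p u R where "x = w k" and "y = w (Suc k)" and "p = V w (k - 1)" and "u = swap_adjacent w k"
    and "R = rhombus \<theta> p y x"
  note T' = T[folded u_def, unfolded weak_tiling_def]
  have fin: "finite T" and tile: "\<forall>R\<in>T. \<exists>L. tile_with_labels n \<theta> L R"
    and cov: "open_region u \<subseteq> \<Union>T" and sub: "\<Union>T \<subseteq> region u"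
    and int: "pairwise (\<lambda>R S. interior R \<inter> interior S = {}) T"
    and fc: "pairwise (\<lambda>R S. (R \<inter> S) face_of R \<and> (R \<inter> S) face_of S) T"
    and inv: "\<forall>S\<in>T. \<forall>j\<in>labels. (S \<inter> boundary_edge \<theta> u j) face_of S \<and> (S \<inter> boundary_edge \<theta> u j) face_of boundary_edge \<theta> u j"
    using T' by argo+
  have u: "u permutes labels" using swap_adjacent_permutes w k u_def by blast
  have kl: "k \<in> labels" "Suc k \<in> labels" "k - 1 \<le> n" "k \<le> n" "Suc k \<le> n" using k by auto
  have xy: "y \<in> labels" "x \<in> labels" "y < x" using perm_label[OF w] kl desc by (auto simp: x_def y_def)
  have Vk: "V w k = p + dir x" "V w (Suc k) = p + dir x + dir y"
    using V_step[OF kl(1), of w] V_step[OF kl(2), of w] by (simp_all add: x_def y_def p_def)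
  have Uk: "V u (k - 1) = p" "V u k = p + dir y" "u k = y" "u (Suc k) = x"
    using V_step[OF kl(1), of u] V_swap_adjacent[OF k(1), of "k - 1" w] k
    by (simp_all add: x_def y_def p_def u_def)
  have btw: "q \<in> R \<longleftrightarrow> Im (V w (Suc k)) \<le> Im q \<and> Im q \<le> Im p \<and> abscissa u (Im q) \<le> Re q \<and> Re q \<le> abscissa w (Im q)" for q
    using rhombus_between[OF w k desc, of q] unfolding R_def x_def y_def p_def u_def .
  have top: "Im p \<le> 0" using Im_V_le[OF w, of 0 "k - 1"] kl by (simp add: p_def)
  have bot: "Im bottom \<le> Im (V w (Suc k))" using Im_V_le[OF w kl(5) order_refl] V_n[OF w] by simp
  have re: "right_edge R p x" "right_edge R (p + dir x) y" and le: "left_edge R p y" "left_edge R (p + dir y) x"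
    using rhombus_edges[OF xy] unfolding R_def by blast+
  have tR: "tile_with_labels n \<theta> {y, x} R" unfolding tile_with_labels_def R_def using xy by blast
  have cR: "convex R" using convex_tile_with_labels[OF tR] .
  let ?E = "boundary_edge \<theta> u k" and ?E' = "boundary_edge \<theta> u (Suc k)"
  let ?F = "boundary_edge \<theta> w k" and ?F' = "boundary_edge \<theta> w (Suc k)"
  have E: "?E = closed_segment p (p + dir y)" "?E' = closed_segment (p + dir y) (p + dir y + dir x)"
    using boundary_edge_dir[OF kl(1), of u] boundary_edge_dir[OF kl(2), of u] Uk by simp_all
  have F: "?F = closed_segment p (p + dir x)" "?F' = closed_segment (p + dir x) (p + dir x + dir y)"
    using boundary_edge_dir[OF kl(1), of w] boundary_edge_dir[OF kl(2), of w] Vk by (simp_all add: x_def y_def p_def)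
  have Ef: "?E face_of R" "?E' face_of R" using edge_face le unfolding E by blast+
  have Ff: "?F face_of R" "?F' face_of R" using edge_face re unfolding F by blast+
  have ER: "?E \<subseteq> R" "?E' \<subseteq> R" and FR: "?F \<subseteq> R" "?F' \<subseteq> R" using Ef Ff face_of_imp_subset by blast+
  have aw: "abscissa u h \<le> abscissa w h" if h: "Im bottom \<le> h" "h \<le> 0" for h
  proof (cases "h \<le> Im (V w (Suc k)) \<or> Im p \<le> h")
    case True
    then show ?thesis using point_at_swap_adjacent[OF w k h] unfolding p_def u_def by simp
  next
    case False
    have "point_at w h \<in> R"
    proof (cases "Im (V w k) \<le> h")
      case True
      then obtain t where "0 \<le> t" "t \<le> 1" "point_at w h = V w (k - 1) + t *\<^sub>R dir (w k)"
        using point_at_height[OF w kl(1) True] False p_def by auto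
      then show ?thesis using FR(1) mem_boundary_edge[OF kl(1)] by blast
    next
      case h': False
      have "Im (V w (Suc k)) \<le> h" "h \<le> Im (V w (Suc k - 1))" using False h' by auto
      then obtain t where "0 \<le> t" "t \<le> 1" "point_at w h = V w (Suc k - 1) + t *\<^sub>R dir (w (Suc k))"
        using point_at_height[OF w kl(2)] by blast
      then show ?thesis using FR(2) mem_boundary_edge[OF kl(2)] by blast
    qed
    then show ?thesis using btw[of "point_at w h"] Im_point_at[OF w h] by simp
  qed
  have R_sub: "R \<subseteq> region w"
  proof
    fix q assume q: "q \<in> R"
    then have h: "Im bottom \<le> Im q" "Im q \<le> 0" using btw[of q] top bot by auto
    then show "q \<in> region w" using abscissa_id_le[OF u h] btw[of q] q unfolding region_def by auto
  qed
  have u_sub: "region u \<subseteq> region w" unfolding region_def using aw by fastforce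
  have cov': "open_region w \<subseteq> R \<union> \<Union>T"
  proof
    fix q assume q: "q \<in> open_region w"
    then have h: "Im bottom \<le> Im q" "Im q \<le> 0" unfolding open_region_def by auto
    show "q \<in> R \<union> \<Union>T"
    proof (cases "Re q < abscissa u (Im q)")
      case True
      then have "q \<in> open_region u" using q unfolding open_region_def by simp
      then show ?thesis using cov by blast
    next
      case False
      then have "abscissa u (Im q) < abscissa w (Im q)" using q unfolding open_region_def by auto
      then have "Im (V w (Suc k)) \<le> Im q" "Im q \<le> Im p"
        using point_at_swap_adjacent[OF w k h] unfolding p_def u_def by (metis linear order_less_irrefl)+
      then have "q \<in> R" using btw[of q] False q unfolding open_region_def by simp
      then show ?thesis by blast
    qed
  qed
  \<comment> \<open>A point common to the rhombus and the old region is bounded by the old path from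
    both sides, so it lies on that path.\<close>
  have onE: "q \<in> ?E \<union> ?E'" and onp: "Re q = abscissa u (Im q)" if q: "q \<in> R" "q \<in> region u" for q
  proof -
    have h: "Im (V w (Suc k)) \<le> Im q" "Im q \<le> Im p" using btw q by auto
    show eq: "Re q = abscissa u (Im q)" using btw[of q] q unfolding region_def by auto
    have "Im bottom \<le> Im q" "Im q \<le> 0" using h top bot by auto
    then have qe: "q = point_at u (Im q)" using Im_point_at[OF u] eq by (simp add: complex_eq_iff)
    show "q \<in> ?E \<union> ?E'"
    proof (cases "Im (V u k) \<le> Im q")
      case True
      have "Im q \<le> Im (V u (k - 1))" using h Uk by simp
      then obtain t where "0 \<le> t" "t \<le> 1" "point_at u (Im q) = V u (k - 1) + t *\<^sub>R dir (u k)"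
        using point_at_height[OF u kl(1) True] by blast
      then have "q \<in> ?E" using qe mem_boundary_edge[OF kl(1), of q u] by auto
      then show ?thesis by blast
    next
      case False
      have "V u (Suc k) = V w (Suc k)" using V_swap_adjacent[OF k(1), of "Suc k" w] u_def by simp
      then have "Im (V u (Suc k)) \<le> Im q" "Im q \<le> Im (V u (Suc k - 1))" using h False by simp_all
      then obtain t where "0 \<le> t" "t \<le> 1" "point_at u (Im q) = V u (Suc k - 1) + t *\<^sub>R dir (u (Suc k))"
        using point_at_height[OF u kl(2)] by blast
      then have "q \<in> ?E'" using qe mem_boundary_edge[OF kl(2), of q u] by auto
      then show ?thesis by blast
    qed
  qed
  \<comment> \<open>A tile that meets both left sides away from their common corner would, by
    convexity, contain a point of the rhombus off both of them.\<close>
  have SR: "S \<inter> R = S \<inter> ?E \<or> S \<inter> R = S \<inter> ?E'" if S: "S \<in> T" for S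
  proof (rule ccontr)
    have Su: "S \<subseteq> region u" using sub S by blast
    have cS: "convex S" using tile S convex_tile_with_labels by blast
    have eq: "S \<inter> R = S \<inter> (?E \<union> ?E')" using onE Su ER by blast
    assume "\<not> ?thesis"
    then obtain a b where a: "a \<in> S" "a \<in> ?E" "a \<notin> ?E'" and b: "b \<in> S" "b \<in> ?E'" "b \<notin> ?E" unfolding eq by blast
    obtain s where s: "0 \<le> s" "s \<le> 1" "a = p + s *\<^sub>R dir y" using a(2) unfolding E closed_segment_dir by blast
    obtain t where t: "0 \<le> t" "t \<le> 1" "b = p + dir y + t *\<^sub>R dir x" using b(2) unfolding E closed_segment_dir by blast
    have "s \<noteq> 1" using a(3) s unfolding E by auto
    have "t \<noteq> 0" using b(3) t unfolding E by auto
    define m where "m = (1 - 1/2) *\<^sub>R a + (1/2::real) *\<^sub>R b"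
    have mS: "m \<in> S" unfolding m_def by (rule convexD_alt[OF cS a(1) b(1)]) simp_all
    have mc: "m = p + ((s + 1) / 2) *\<^sub>R dir y + (t / 2) *\<^sub>R dir x"
      unfolding m_def s t by (simp add: complex_eq_iff field_simps)
    then have "m \<in> R" unfolding R_def using rhombus_coords[OF xy, of p] s t by simp
    then have "m \<in> ?E \<union> ?E'" using onE Su mS by blast
    then obtain r where "0 \<le> r" "m = p + r *\<^sub>R dir y + 0 *\<^sub>R dir x \<or> m = p + 1 *\<^sub>R dir y + r *\<^sub>R dir x"
      unfolding E closed_segment_dir by auto
    then have "((s + 1) / 2) *\<^sub>R dir y + (t / 2) *\<^sub>R dir x = r *\<^sub>R dir y + 0 *\<^sub>R dir x \<or>
      ((s + 1) / 2) *\<^sub>R dir y + (t / 2) *\<^sub>R dir x = 1 *\<^sub>R dir y + r *\<^sub>R dir x"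
      unfolding mc add.assoc by (simp only: add_left_cancel)
    then have "t / 2 = 0 \<or> (s + 1) / 2 = 1" using coords_unique[OF xy] by blast
    then show False using \<open>s \<noteq> 1\<close> \<open>t \<noteq> 0\<close> by auto
  qed
  have fR: "(S \<inter> R) face_of S \<and> (S \<inter> R) face_of R" if S: "S \<in> T" for S
    using SR[OF S]
  proof
    assume e: "S \<inter> R = S \<inter> ?E"
    have "(S \<inter> ?E) face_of S" "(S \<inter> ?E) face_of ?E" using inv S kl(1) by blast+
    then show ?thesis unfolding e using face_of_trans Ef(1) by blast
  next
    assume e: "S \<inter> R = S \<inter> ?E'"
    have "(S \<inter> ?E') face_of S" "(S \<inter> ?E') face_of ?E'" using inv S kl(2) by blast+
    then show ?thesis unfolding e using face_of_trans Ef(2) by blast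
  qed
  have iR: "interior R \<inter> interior S = {}" if S: "S \<in> T" for S
  proof (rule ccontr)
    assume "interior R \<inter> interior S \<noteq> {}"
    then obtain q where q: "q \<in> interior R" "q \<in> interior S" by blast
    then have "q \<in> R" "q \<in> S" using interior_subset by blast+
    then have eq: "Re q = abscissa u (Im q)" using onp sub S by blast
    obtain e where e: "e > 0" "ball q e \<subseteq> R" using q(1) mem_interior by blast
    have "q - of_real (e / 2) \<in> ball q e" using e by (simp add: dist_norm)
    then have "q - of_real (e / 2) \<in> R" using e by blast
    then show False using btw[of "q - of_real (e / 2)"] eq e by simp
  qed
  \<comment> \<open>The neighbouring boundary edges can touch the rhombus only at its top or bottom
    vertex; horizontal supporting lines show that these vertices are faces.\<close>
  have vertex_face: "{p} face_of R" "{V w (Suc k)} face_of R"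
  proof -
    have "R \<inter> {q. \<i> \<bullet> q = Im p} face_of R"
      by (rule face_of_Int_supporting_hyperplane_le[OF cR]) (use btw in \<open>simp add: inner_complex_def\<close>)
    moreover have "R \<inter> {q. \<i> \<bullet> q = Im p} = {p}"
    proof (intro equalityI subsetI)
      fix q assume "q \<in> R \<inter> {q. \<i> \<bullet> q = Im p}"
      then have q: "q \<in> R" "Im q = Im p" by (auto simp: inner_complex_def)
      have "point_at w (Im p) = p" using point_at_vertex[OF w kl(3)] p_def by simp
      moreover have "point_at u (Im p) = p" using point_at_vertex[OF u kl(3)] Uk by simp
      ultimately show "q \<in> {p}" using btw[of q] q by (auto simp: complex_eq_iff)
    next
      fix q assume "q \<in> {p}"
      then show "q \<in> R \<inter> {q. \<i> \<bullet> q = Im p}" using edge_mem[of R p x 0] re by (simp add: inner_complex_def)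
    qed
    ultimately show "{p} face_of R" by simp
    have "R \<inter> {q. \<i> \<bullet> q = Im (V w (Suc k))} face_of R"
      by (rule face_of_Int_supporting_hyperplane_ge[OF cR]) (use btw in \<open>simp add: inner_complex_def\<close>)
    moreover have "R \<inter> {q. \<i> \<bullet> q = Im (V w (Suc k))} = {V w (Suc k)}"
    proof (intro equalityI subsetI)
      fix q assume "q \<in> R \<inter> {q. \<i> \<bullet> q = Im (V w (Suc k))}"
      then have q: "q \<in> R" "Im q = Im (V w (Suc k))" by (auto simp: inner_complex_def)
      have "point_at w (Im (V w (Suc k))) = V w (Suc k)" using point_at_vertex[OF w kl(5)] .
      moreover have "point_at u (Im (V w (Suc k))) = V w (Suc k)"
        using point_at_vertex[OF u kl(5)] V_swap_adjacent[OF k(1), of "Suc k" w] u_def by simp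
      ultimately show "q \<in> {V w (Suc k)}" using btw[of q] q by (auto simp: complex_eq_iff)
    next
      fix q assume "q \<in> {V w (Suc k)}"
      then show "q \<in> R \<inter> {q. \<i> \<bullet> q = Im (V w (Suc k))}" using edge_mem[of R "p + dir x" y 1] re Vk by (simp add: inner_complex_def)
    qed
    ultimately show "{V w (Suc k)} face_of R" by simp
  qed
  have end_face: "{V w (j - 1)} face_of boundary_edge \<theta> w j" "{V w j} face_of boundary_edge \<theta> w j" for j
    by (simp_all add: face_of_singleton boundary_edge_def segment_convex_hull extreme_point_of_convex_hull_2)
  have inv_R: "(R \<inter> boundary_edge \<theta> w j) face_of R \<and> (R \<inter> boundary_edge \<theta> w j) face_of boundary_edge \<theta> w j"
    if j: "j \<in> labels" for j
  proof -
    consider "j = k \<or> j = Suc k" | "j < k" | "Suc k < j" by linarith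
    then show ?thesis
    proof cases
      case 1
      have "convex (boundary_edge \<theta> w j)" by (simp add: boundary_edge_def)
      moreover have "R \<inter> boundary_edge \<theta> w j = boundary_edge \<theta> w j" using 1 FR by auto
      ultimately show ?thesis using 1 Ff face_of_refl by metis
    next
      case 2
      show ?thesis
      proof (cases "R \<inter> boundary_edge \<theta> w j = {}")
        case False
        have all: "q = p \<and> j = k - 1" if q: "q \<in> R" "q \<in> boundary_edge \<theta> w j" for q
        proof -
          have qp: "q \<in> boundary_path w" using q(2) j unfolding boundary_path_def by blast
          obtain t where "0 \<le> t" "t \<le> 1" "q = V w (j - 1) + t *\<^sub>R dir (w j)" using q(2) mem_boundary_edge[OF j] by blast
          then have "Im (V w j) \<le> Im q" using edge_height(1)[OF w j] by simp
          moreover have "Im q \<le> Im (V w (k - 1))" using btw q p_def by simp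
          moreover have "Im (V w (k - 1)) \<le> Im (V w j)" by (rule Im_V_le[OF w]) (use 2 kl in auto)
          ultimately have e: "Im q = Im (V w (k - 1))" "Im (V w j) = Im (V w (k - 1))" by auto
          then have "q = V w (k - 1)" using mem_path[OF w, of q] qp point_at_vertex[OF w kl(3)] by metis
          moreover have "\<not> j < k - 1" using Im_V_less[OF w _ kl(3), of j] e(2) by fastforce
          then have "j = k - 1" using 2 by linarith
          ultimately show ?thesis using p_def by simp
        qed
        then have "R \<inter> boundary_edge \<theta> w j = {p}" "j = k - 1" using False by blast+
        then show ?thesis using vertex_face(1) end_face(2)[of j] p_def by simp
      qed (auto intro: empty_face_of)
    next
      case 3
      show ?thesis
      proof (cases "R \<inter> boundary_edge \<theta> w j = {}")
        case False
        have all: "q = V w (Suc k) \<and> j - 1 = Suc k" if q: "q \<in> R" "q \<in> boundary_edge \<theta> w j" for q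
        proof -
          have qp: "q \<in> boundary_path w" using q(2) j unfolding boundary_path_def by blast
          obtain t where "0 \<le> t" "t \<le> 1" "q = V w (j - 1) + t *\<^sub>R dir (w j)" using q(2) mem_boundary_edge[OF j] by blast
          then have "Im q \<le> Im (V w (j - 1))" using edge_height(2)[OF w j] by simp
          moreover have "Im (V w (Suc k)) \<le> Im q" using btw q by simp
          moreover have "Im (V w (j - 1)) \<le> Im (V w (Suc k))" by (rule Im_V_le[OF w]) (use 3 j in auto)
          ultimately have e: "Im q = Im (V w (Suc k))" "Im (V w (j - 1)) = Im (V w (Suc k))" by auto
          then have "q = V w (Suc k)" using mem_path[OF w, of q] qp point_at_vertex[OF w kl(5)] by metis
          moreover have jn: "j - 1 \<le> n" using j by auto
          have "\<not> Suc k < j - 1" using Im_V_less[OF w _ jn, of "Suc k"] e(2) by fastforce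
          then have "j - 1 = Suc k" using 3 by linarith
          ultimately show ?thesis by simp
        qed
        then have "R \<inter> boundary_edge \<theta> w j = {V w (Suc k)}" "j - 1 = Suc k" using False by blast+
        then show ?thesis using vertex_face(2) end_face(1)[of j] by simp
      qed (auto intro: empty_face_of)
    qed
  qed
  have inv_S: "(S \<inter> boundary_edge \<theta> w j) face_of S \<and> (S \<inter> boundary_edge \<theta> w j) face_of boundary_edge \<theta> w j"
    if S: "S \<in> T" and j: "j \<in> labels" for S j
  proof (cases "j = k \<or> j = Suc k")
    case True
    let ?B = "boundary_edge \<theta> w j"
    have B: "?B face_of R" "?B \<subseteq> R" using True Ff FR by auto
    \<comment> \<open>An old tile reaches a new boundary edge only through the rhombus, so the face
      relations with the rhombus are composed.\<close>
    have eq: "S \<inter> ?B = (S \<inter> R) \<inter> ?B" using B by blast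
    have "(S \<inter> R) \<inter> ?B face_of R" using fR[OF S] B(1) face_of_Int by blast
    then have "(S \<inter> R) \<inter> ?B face_of (S \<inter> R)" "(S \<inter> R) \<inter> ?B face_of ?B"
      using face_of_subset[of _ R] B(2) by (metis inf_le1 inf_le2)+
    then show ?thesis unfolding eq using face_of_trans fR[OF S] by blast
  next
    case False
    then have "V u (j - 1) = V w (j - 1)" "V u j = V w j" using V_swap_adjacent[OF k(1)] u_def j by auto
    then have "boundary_edge \<theta> u j = boundary_edge \<theta> w j" by (simp add: boundary_edge_def)
    then show ?thesis using inv S j by metis
  qed
  have "weak_tiling w (insert R T)"
    unfolding weak_tiling_def
  proof (intro conjI)
    show "finite (insert R T)" using fin by simp
    show "\<forall>R\<in>insert R T. \<exists>L. tile_with_labels n \<theta> L R" using tile tR by blast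
    show "open_region w \<subseteq> \<Union>(insert R T)" using cov' by simp
    show "\<Union>(insert R T) \<subseteq> region w" using R_sub u_sub sub by blast
    show "pairwise (\<lambda>R S. interior R \<inter> interior S = {}) (insert R T)"
      using int iR by (auto simp: pairwise_insert Int_commute)
    show "pairwise (\<lambda>R S. (R \<inter> S) face_of R \<and> (R \<inter> S) face_of S) (insert R T)"
      using fc fR by (auto simp: pairwise_insert Int_commute)
    show "\<forall>S\<in>insert R T. \<forall>j\<in>labels. (S \<inter> boundary_edge \<theta> w j) face_of S \<and> (S \<inter> boundary_edge \<theta> w j) face_of boundary_edge \<theta> w j"
      using inv_R inv_S by blast
  qed
  then show ?thesis unfolding R_def x_def y_def p_def .
qed

text \<open>Injectivity makes \<open>w\<close> strictly increasing, so \<open>k \<le> w k\<close>,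
  and the equality of the sums forces equality of the terms.\<close>

lemma no_descent_id:
  assumes w: "w permutes labels" and nd: "\<And>k. 1 \<le> k \<Longrightarrow> k < n \<Longrightarrow> w k \<le> w (Suc k)"
  shows "w = id"
proof -
  have ge: "k \<le> w k" if "1 \<le> k" "k \<le> n" for k
    using that
  proof (induction k rule: dec_induct)
    case base
    then show ?case using perm_label[OF w, of 1] by simp
  next
    case (step k)
    have "w k \<noteq> w (Suc k)" using permutes_inj[OF w] by (simp add: inj_eq)
    then show ?case using step nd[of k] by fastforce
  qed
  have "(\<Sum>k\<in>labels. w k) = (\<Sum>k\<in>labels. k)" using sum.permute[OF w, of "\<lambda>k. k"] by (simp add: o_def)
  then have "w k = k" if "k \<in> labels" for k
    using sum_mono_inv[of "\<lambda>k. k" labels w k] ge that by auto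
  then show ?thesis using w unfolding permutes_def by (metis eq_id_iff)
qed

text \<open>Sorting by adjacent exchanges: each one raises the sum of the products
  \<open>k * w k\<close>, which is at most \<open>n * n * n\<close>. The rhombi are added back in
  reverse order, starting from the empty tiling for the identity.\<close>

lemma weak_tiling_exists: "w permutes labels \<Longrightarrow> \<exists>T. weak_tiling w T"
proof (induction "n * n * n - (\<Sum>k\<in>labels. k * w k)" arbitrary: w rule: less_induct)
  case less
  show ?case
  proof (cases "\<exists>k. 1 \<le> k \<and> k < n \<and> w (Suc k) < w k")
    case True
    then obtain k where k: "1 \<le> k" "k < n" "w (Suc k) < w k" by blast
    let ?u = "swap_adjacent w k"
    have u: "?u permutes labels" using swap_adjacent_permutes less k by blast
    have bound: "(\<Sum>k\<in>labels. k * v k) \<le> n * n * n" if "v permutes labels" for v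
    proof -
      have "(\<Sum>k\<in>labels. k * v k) \<le> (\<Sum>k\<in>labels. n * n)"
        using perm_label[OF that] by (intro sum_mono mult_le_mono) auto
      then show ?thesis by simp
    qed
    have split: "(\<Sum>k\<in>labels. f k) = f k + f (Suc k) + (\<Sum>k\<in>labels - {k, Suc k}. f k)" for f :: "nat \<Rightarrow> nat"
    proof -
      have "(\<Sum>k\<in>labels. f k) = (\<Sum>k\<in>labels - {k, Suc k}. f k) + (\<Sum>k\<in>{k, Suc k}. f k)"
        by (rule sum.subset_diff) (use k in auto)
      then show ?thesis by simp
    qed
    have "(\<Sum>j\<in>labels - {k, Suc k}. j * ?u j) = (\<Sum>j\<in>labels - {k, Suc k}. j * w j)" by (intro sum.cong) auto
    then have "(\<Sum>j\<in>labels. j * w j) < (\<Sum>j\<in>labels. j * ?u j)"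
      unfolding split[of "\<lambda>j. j * w j"] split[of "\<lambda>j. j * ?u j"] using k by simp
    then have "n * n * n - (\<Sum>j\<in>labels. j * ?u j) < n * n * n - (\<Sum>j\<in>labels. j * w j)"
      using bound[OF u] by linarith
    then obtain T where "weak_tiling ?u T" using less(1) u by blast
    then show ?thesis using weak_tiling_step[OF less(2) k] by blast
  next
    case False
    then have "w = id" using no_descent_id[OF less(2)] by (meson not_le)
    then show ?thesis using weak_tiling_id by blast
  qed
qed

text \<open>
  Choosing the order in which the inversions are undone: the larger label is first moved next to
  position \<open>k\<close>, so that the tile on the \<open>k\<close>-th boundary edge is built from that label.
\<close>

lemma weak_tiling_lower:
  "w permutes labels \<Longrightarrow> 1 \<le> i \<Longrightarrow> i < k \<Longrightarrow> k \<le> n \<Longrightarrow> w k < w i \<Longrightarrow>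
    \<exists>T R P z. weak_tiling w T \<and> R \<in> T \<and> right_edge R (V w (k - 1)) (w k) \<and> right_edge R P z \<and> w k < z"
proof (induction "k - i" arbitrary: w i)
  case 0
  then show ?case by simp
next
  case (Suc d)
  show ?case
  proof (cases "Suc i = k")
    case True
    have i: "1 \<le> i" "i < n" "w (Suc i) < w i" using Suc.prems True by auto
    obtain T where "weak_tiling (swap_adjacent w i) T" using weak_tiling_exists swap_adjacent_permutes[OF Suc.prems(1) i(1,2)] by blast
    then have T: "weak_tiling w (insert (rhombus \<theta> (V w (i - 1)) (w (Suc i)) (w i)) T)"
      by (rule weak_tiling_step[OF Suc.prems(1) i])
    have "i \<in> labels" "Suc i \<in> labels" using i by auto
    then have l: "w (Suc i) \<in> labels" "w i \<in> labels" "V w i = V w (i - 1) + dir (w i)" using perm_label[OF Suc.prems(1)] V_step by auto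
    show ?thesis using T rhombus_edges(1,2)[OF l(1,2) i(3), of "V w (i - 1)"] i(3) l(3) True by fastforce
  next
    case False
    then have i: "1 \<le> Suc i" "Suc i < k" "d = k - Suc i" using Suc by auto
    show ?thesis
    proof (cases "w k < w (Suc i)")
      case True
      then show ?thesis using Suc.hyps(1)[OF i(3) Suc.prems(1) i(1,2) Suc.prems(4)] by blast
    next
      case False
      \<comment> \<open>Here \<open>w (Suc i) \<le> w k < w i\<close>, so exchanging positions
        \<open>i\<close> and \<open>Suc i\<close> brings the larger label one place closer to
        \<open>k\<close> and leaves the boundary edge at \<open>k\<close> fixed. In the other case
        \<open>Suc i\<close> itself is a suitable starting position.\<close>
      then have desc: "w (Suc i) < w i" using Suc.prems by simp
      have n: "i < n" using i Suc.prems by simp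
      let ?u = "swap_adjacent w i"
      have u: "?u permutes labels" using swap_adjacent_permutes[OF Suc.prems(1,2) n] .
      have e: "?u k = w k" "?u (Suc i) = w i" "V ?u (k - 1) = V w (k - 1)"
        using i Suc.prems(2) V_swap_adjacent[OF Suc.prems(2), of "k - 1" w] by auto
      then obtain T R P z where "weak_tiling ?u T" "R \<in> T" "right_edge R (V w (k - 1)) (w k)" "right_edge R P z" "w k < z"
        using Suc.hyps(1)[OF i(3) u i(1,2) Suc.prems(4)] Suc.prems(5) by auto
      then show ?thesis using weak_tiling_step[OF Suc.prems(1,2) n desc] by blast
    qed
  qed
qed

text \<open>The counterpart for an inversion after \<open>k\<close>: here the smaller label is moved
  up to position \<open>Suc k\<close> before the tile on the edge \<open>k\<close> is
  placed.\<close>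

lemma weak_tiling_upper:
  "w permutes labels \<Longrightarrow> 1 \<le> k \<Longrightarrow> k < l \<Longrightarrow> l \<le> n \<Longrightarrow> w l < w k \<Longrightarrow>
    \<exists>T R P z. weak_tiling w T \<and> R \<in> T \<and> right_edge R (V w (k - 1)) (w k) \<and> right_edge R P z \<and> z < w k"
proof (induction "l - k" arbitrary: w l)
  case 0
  then show ?case by simp
next
  case (Suc d)
  show ?case
  proof (cases "Suc k = l")
    case True
    have i: "1 \<le> k" "k < n" "w (Suc k) < w k" using Suc.prems True by auto
    obtain T where "weak_tiling (swap_adjacent w k) T" using weak_tiling_exists swap_adjacent_permutes[OF Suc.prems(1) i(1,2)] by blast
    then have T: "weak_tiling w (insert (rhombus \<theta> (V w (k - 1)) (w (Suc k)) (w k)) T)"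
      by (rule weak_tiling_step[OF Suc.prems(1) i])
    have "k \<in> labels" "Suc k \<in> labels" using i by auto
    then have l: "w (Suc k) \<in> labels" "w k \<in> labels" using perm_label[OF Suc.prems(1)] by auto
    show ?thesis using T rhombus_edges(1,2)[OF l i(3), of "V w (k - 1)"] i(3) True by fastforce
  next
    case False
    then obtain j where j: "l = Suc j" "k < j" using Suc by (cases l) auto
    have i: "d = j - k" "j \<le> n" "j < n" "1 \<le> j" using j Suc by auto
    show ?thesis
    proof (cases "w j < w k")
      case True
      then show ?thesis using Suc.hyps(1)[OF i(1) Suc.prems(1,2) j(2) i(2)] by blast
    next
      case False
      then have desc: "w (Suc j) < w j" using Suc.prems j by simp
      let ?u = "swap_adjacent w j"
      have u: "?u permutes labels" using swap_adjacent_permutes[OF Suc.prems(1) i(4,3)] .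
      have e: "?u k = w k" "?u j = w l" "V ?u (k - 1) = V w (k - 1)"
        using j V_swap_adjacent[OF i(4), of "k - 1" w] by auto
      then obtain T R P z where "weak_tiling ?u T" "R \<in> T" "right_edge R (V w (k - 1)) (w k)" "right_edge R P z" "z < w k"
        using Suc.hyps(1)[OF i(1) u Suc.prems(2) j(2) i(2)] Suc.prems(5) by auto
      then show ?thesis using weak_tiling_step[OF Suc.prems(1) i(4,3) desc] by blast
    qed
  qed
qed

end

section \<open>Forced right-perimeter tiles\<close>

context side_directions begin

text \<open>The line through a right edge supports the tile.\<close>

lemma right_edge_halfplane:
  assumes "right_edge R P z" "q \<in> R"
  shows "cross (dir z) q \<le> cross (dir z) P"
proof -
  obtain p i j where ij: "i \<in> labels" "j \<in> labels" "i < j" and R: "R = rhombus \<theta> p i j"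
    and c: "z = j \<and> P = p \<or> z = i \<and> P = p + dir j"
    using assms unfolding right_edge_def by blast
  obtain a b where ab: "q = p + a *\<^sub>R dir i + b *\<^sub>R dir j" "0 \<le> a" "b \<le> 1"
    using assms(2) rhombus_cases unfolding R by blast
  have D: "0 < cross (dir i) (dir j)" "cross (dir j) (dir i) = - cross (dir i) (dir j)"
    by (rule cross_dir[OF ij], rule cross_swap)
  have "b * cross (dir i) (dir j) \<le> cross (dir i) (dir j)" using D ab by simp
  then show ?thesis using c ab D by (auto simp: cross_simps)
qed

end

section \<open>Perimeter tiles of one tiling\<close>

context tiling begin

text \<open>Perimeter tiles are recorded by the position of their upper boundary edge, so that
  counting them becomes a question on sets of integers without consecutive elements.\<close>

definition perimeter_positions :: "nat set" where
  "perimeter_positions = {k. 1 \<le> k \<and> k < n \<and>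
     (\<exists>R\<in>T. right_edge R (V w (k - 1)) (w k) \<and> right_edge R (V w k) (w (Suc k)))}"

lemma perimeter_tile:
  assumes R: "R \<in> T" and L: "tile_with_labels n \<theta> {x, y} R" and p: "right_perimeter_tile n \<theta> w R"
  obtains k where "1 \<le> k" "k < n" "{x, y} = {w k, w (Suc k)}"
    "right_edge R (V w (k - 1)) (w k)" "right_edge R (V w k) (w (Suc k))"
proof -
  obtain k where k: "1 \<le> k" "k < n" "boundary_edge \<theta> w k edge_of R" "boundary_edge \<theta> w (Suc k) edge_of R"
    using p unfolding right_perimeter_tile_def by blast
  then have sub: "boundary_edge \<theta> w k \<subseteq> R" "boundary_edge \<theta> w (Suc k) \<subseteq> R"
    unfolding edge_of_def using face_of_imp_subset by blast+
  have kl: "k \<in> labels" "Suc k \<in> labels" using k by auto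
  have re: "right_edge R (V w (k - 1)) (w k)" "right_edge R (V w k) (w (Suc k))"
    using boundary_edge_right[OF R kl(1) sub(1)] boundary_edge_right[OF R kl(2) sub(2)] by simp_all
  have "w k \<in> {x, y}" "w (Suc k) \<in> {x, y}" using right_edge_tile_label[OF L] re by blast+
  moreover have "w k \<noteq> w (Suc k)" using permutes_inj[OF w] by (simp add: inj_eq)
  ultimately have "{x, y} = {w k, w (Suc k)}" by auto
  then show ?thesis using that k re by blast
qed

lemma perimeter_positions_sub: "perimeter_positions \<subseteq> {1..<n}"
  unfolding perimeter_positions_def by auto

text \<open>The common boundary edge would make the two tiles equal, and a rhombus cannot carry
  three distinct labels.\<close>

lemma perimeter_positions_not_consecutive: "k \<in> perimeter_positions \<Longrightarrow> Suc k \<notin> perimeter_positions"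
proof
  assume k: "k \<in> perimeter_positions" "Suc k \<in> perimeter_positions"
  obtain R where R: "R \<in> T" "right_edge R (V w (k - 1)) (w k)" "right_edge R (V w k) (w (Suc k))"
    using k(1) unfolding perimeter_positions_def by blast
  obtain R' where R': "R' \<in> T" "right_edge R' (V w k) (w (Suc k))" "right_edge R' (V w (Suc k)) (w (Suc (Suc k)))"
    using k(2) unfolding perimeter_positions_def by auto
  have "R' = R" using right_edge_unique[OF R'(1) R(1) R'(2) R(3)] .
  obtain p i j where ij: "i \<in> labels" "j \<in> labels" "i < j" "R = rhombus \<theta> p i j" using tile_cases[OF R(1)] .
  have "{w k, w (Suc k), w (Suc (Suc k))} \<subseteq> {i, j}"
    using right_edge_labels[OF ij(1-3)] R R' \<open>R' = R\<close> ij(4) by blast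
  then have "card {w k, w (Suc k), w (Suc (Suc k))} \<le> card {i, j}" by (intro card_mono) auto
  moreover have "card {w k, w (Suc k), w (Suc (Suc k))} = 3" using permutes_inj[OF w] by (simp add: inj_eq card_insert_if)
  moreover have "card {i, j} \<le> 2" by (simp add: card_insert_if)
  ultimately show False by linarith
qed

lemma forced_sub: "forced_right_perimeter_tiles n \<theta> w \<subseteq> (\<lambda>k. {w k, w (Suc k)}) ` perimeter_positions"
proof
  fix L assume "L \<in> forced_right_perimeter_tiles n \<theta> w"
  then obtain x y where L: "L = {x, y}" "\<exists>R\<in>T. tile_with_labels n \<theta> {x, y} R \<and> right_perimeter_tile n \<theta> w R"
    using tiling unfolding forced_right_perimeter_tiles_def by blast
  then obtain R where R: "R \<in> T" "tile_with_labels n \<theta> {x, y} R" "right_perimeter_tile n \<theta> w R" by blast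
  obtain k where "1 \<le> k" "k < n" "{x, y} = {w k, w (Suc k)}"
    "right_edge R (V w (k - 1)) (w k)" "right_edge R (V w k) (w (Suc k))"
    using perimeter_tile[OF R] .
  then show "L \<in> (\<lambda>k. {w k, w (Suc k)}) ` perimeter_positions"
    unfolding L perimeter_positions_def using R(1) by blast
qed

text \<open>If the second label were larger, the tile would have a right edge with this label above
  the boundary edge \<open>k\<close> as well as below it. The supporting lines of both would
  coincide, making the edge \<open>k\<close> parallel to them.\<close>

lemma perimeter_descent:
  assumes "k \<in> perimeter_positions"
  shows "w (Suc k) < w k"
proof -
  obtain R where R: "R \<in> T" "right_edge R (V w (k - 1)) (w k)" "right_edge R (V w k) (w (Suc k))" and k: "1 \<le> k" "k < n"
    using assms[unfolded perimeter_positions_def mem_Collect_eq] by blast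
  have kl: "k \<in> labels" using k by simp
  have ne: "w k \<noteq> w (Suc k)" using permutes_inj[OF w] by (simp add: inj_eq)
  show ?thesis
  proof (rule right_edge_other[OF R(2)])
    fix z assume z: "w k < z" "right_edge R (V w (k - 1) - dir z) z" "tile_with_labels n \<theta> {w k, z} R"
    then have wz: "w (Suc k) = z" using right_edge_tile_label[OF z(3) R(3)] ne by auto
    have "V w k \<in> R" "V w (k - 1) - dir z \<in> R"
      using edge_mem[of R "V w k" "w (Suc k)" 0] edge_mem[of R "V w (k - 1) - dir z" z 0] R(3) z(2) by simp_all
    then have "cross (dir z) (V w k) = cross (dir z) (V w (k - 1) - dir z)"
      using right_edge_halfplane[OF z(2)] right_edge_halfplane[OF R(3)] wz by (metis order_antisym)
    then have "cross (dir z) (dir (w k)) = 0" using V_step[OF kl, of w] by (simp add: cross_simps)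
    then have "z = w k" using cross_dir_eq_0[OF right_edge_label[OF z(2)] right_edge_label[OF R(2)]] by blast
    then show ?thesis using z(1) by simp
  next
    fix z assume z: "z < w k" "tile_with_labels n \<theta> {w k, z} R"
    then show ?thesis using right_edge_tile_label[OF z(2) R(3)] ne by auto
  qed
qed

end

context side_directions begin

lemma tilingI: "w permutes labels \<Longrightarrow> T \<in> rhombic_tilings n \<theta> w \<Longrightarrow> tiling n \<theta> w T"
  by unfold_locales

lemma inj_adjacent:
  fixes w :: "nat \<Rightarrow> nat"
  assumes "inj w" shows "inj (\<lambda>k. {w k, w (Suc k)})"
proof (rule injI)
  fix a b assume "{w a, w (Suc a)} = {w b, w (Suc b)}"
  then have "w a = w b \<or> w a = w (Suc b) \<and> w (Suc a) = w b" by (auto simp: doubleton_eq_iff)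
  then have "a = b \<or> a = Suc b \<and> Suc a = b" using assms by (auto simp: inj_eq)
  then show "a = b" by auto
qed

lemma forced_finite: "finite (forced_right_perimeter_tiles n \<theta> w)"
  by (rule finite_subset[of _ "Pow labels"]) (auto simp: forced_right_perimeter_tiles_def)

text \<open>Any single tiling bounds the number of forced tiles by \<open>m\<close>, through its
  perimeter positions; the odd positions supply that many by \<open>forced_tile\<close>.\<close>

lemma forced_of_extremal:
  assumes n: "n = 2 * m" and w: "w permutes labels" and fs: "fully_supported n w" and e: "extremal m w"
  shows "card (forced_right_perimeter_tiles n \<theta> w) = m"
proof -
  let ?F = "forced_right_perimeter_tiles n \<theta> w"
  obtain T where T: "weak_tiling w T" using weak_tiling_exists[OF w] by blast
  interpret tiling n \<theta> w T using tilingI[OF w weak_tiling_rhombic[OF w fs T]] .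
  note nc = card_no_consecutive[of perimeter_positions m, OF _ perimeter_positions_not_consecutive]
  have fK: "finite perimeter_positions" using finite_subset[OF perimeter_positions_sub] by simp
  have "card ?F \<le> card ((\<lambda>k. {w k, w (Suc k)}) ` perimeter_positions)" using forced_sub fK by (intro card_mono) auto
  also have "\<dots> \<le> card perimeter_positions" using fK by (rule card_image_le)
  also have "\<dots> \<le> m" using nc(1) perimeter_positions_sub n by simp
  finally have le: "card ?F \<le> m" .
  have "(\<lambda>k. {w k, w (Suc k)}) ` {k. odd k \<and> k < 2 * m} \<subseteq> ?F"
  proof
    fix L assume "L \<in> (\<lambda>k. {w k, w (Suc k)}) ` {k. odd k \<and> k < 2 * m}"
    then obtain k where k: "odd k" "k < 2 * m" "L = {w k, w (Suc k)}" by blast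
    have kl: "k \<in> labels" "Suc k \<in> labels" using k n odd_pos[of k] by auto
    have "\<exists>R\<in>T'. tile_with_labels n \<theta> {w k, w (Suc k)} R \<and> right_perimeter_tile n \<theta> w R"
      if T': "T' \<in> rhombic_tilings n \<theta> w" for T'
    proof -
      interpret T': tiling n \<theta> w T' using tilingI[OF w T'] .
      obtain R where R: "R \<in> T'" "tile_with_labels n \<theta> {w k, w (Suc k)} R"
        "right_edge R (V w (k - 1)) (w k)" "right_edge R (V w k) (w (Suc k))"
      proof (rule T'.forced_tile[OF fs kl])
        fix i assume "i \<in> labels" "i < k"
        then show "w i < w k" using extremal_max[OF e k(1,2), of i] by simp
      next
        fix l assume "l \<in> labels" "Suc k < l"
        then show "w (Suc k) < w l" using extremal_min[OF e, of "Suc k" l] k n by simp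
      qed
      have "boundary_edge \<theta> w k edge_of R" "boundary_edge \<theta> w (Suc k) edge_of R"
        using edge_edge_of[of R] R(3,4) boundary_edge_dir[OF kl(1), of w] boundary_edge_dir[OF kl(2), of w] by simp_all
      then have "right_perimeter_tile n \<theta> w R" unfolding right_perimeter_tile_def using kl by auto
      then show ?thesis using R by blast
    qed
    moreover have "w k \<noteq> w (Suc k)" using permutes_inj[OF w] by (simp add: inj_eq)
    ultimately show "L \<in> ?F" unfolding forced_right_perimeter_tiles_def k(3) using perm_label[OF w] kl by blast
  qed
  then have "card ((\<lambda>k. {w k, w (Suc k)}) ` {k. odd k \<and> k < 2 * m}) \<le> card ?F" using forced_finite by (rule card_mono[rotated])
  then have "m \<le> card ?F" using card_image[OF inj_on_subset[OF inj_adjacent[OF permutes_inj[OF w]] subset_UNIV], of "{k. odd k \<and> k < 2 * m}"] card_odd_below by simp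
  then show ?thesis using le by simp
qed

text \<open>Equality in the bound makes the perimeter positions of one tiling exactly the odd
  numbers, so the forced tiles are known, and each must occur in every tiling, including those built
  to contradict it.\<close>

lemma extremal_of_forced:
  assumes n: "n = 2 * m" and w: "w permutes labels" and fs: "fully_supported n w"
    and c: "card (forced_right_perimeter_tiles n \<theta> w) = m"
  shows "extremal m w"
proof -
  let ?F = "forced_right_perimeter_tiles n \<theta> w" and ?f = "\<lambda>k. {w k, w (Suc k)}" and ?O = "{k. odd k \<and> k < 2 * m}"
  have inj: "inj w" using permutes_inj[OF w] .
  obtain T where T: "weak_tiling w T" using weak_tiling_exists[OF w] by blast
  interpret tiling n \<theta> w T using tilingI[OF w weak_tiling_rhombic[OF w fs T]] .
  note nc = card_no_consecutive[of perimeter_positions m, OF _ perimeter_positions_not_consecutive]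
  have fK: "finite perimeter_positions" using finite_subset[OF perimeter_positions_sub] by simp
  have cK: "card (?f ` perimeter_positions) = card perimeter_positions"
    using inj_adjacent[OF inj] by (simp add: card_image inj_on_subset)
  have "m \<le> card (?f ` perimeter_positions)" using c card_mono[OF finite_imageI[OF fK] forced_sub] by simp
  then have "card perimeter_positions = m" using nc(1) perimeter_positions_sub n cK by auto
  then have K: "perimeter_positions = ?O" using nc(2) perimeter_positions_sub n by simp
  have F: "?F = ?f ` ?O"
    using card_subset_eq[OF finite_imageI[OF fK] forced_sub] c cK \<open>card perimeter_positions = m\<close> K by simp
  have desc: "w (Suc k) < w k" if "odd k" "k < 2 * m" for k using perimeter_descent K that by blast
  \<comment> \<open>A label pair of neighbouring entries determines its position, so in every tiling
    the tile lies on the same two boundary edges.\<close>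
  have forced: "\<exists>R\<in>T'. right_edge R (V w (k - 1)) (w k) \<and> right_edge R (V w k) (w (Suc k)) \<and> tile_with_labels n \<theta> {w k, w (Suc k)} R"
    if k: "odd k" "k < 2 * m" and T': "T' \<in> rhombic_tilings n \<theta> w" for k T'
  proof -
    interpret T': tiling n \<theta> w T' using tilingI[OF w T'] .
    have "?f k \<in> ?F" using F k by blast
    then obtain x y where xy: "?f k = {x, y}" "\<exists>R\<in>T'. tile_with_labels n \<theta> {x, y} R \<and> right_perimeter_tile n \<theta> w R"
      using T' unfolding forced_right_perimeter_tiles_def by blast
    then obtain R where R: "R \<in> T'" "tile_with_labels n \<theta> {x, y} R" "right_perimeter_tile n \<theta> w R" by blast
    obtain k' where k': "{x, y} = ?f k'" "right_edge R (V w (k' - 1)) (w k')" "right_edge R (V w k') (w (Suc k'))"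
      using T'.perimeter_tile[OF R] by metis
    have "?f k' = ?f k" using k'(1) xy(1) by simp
    then have "k' = k" by (rule injD[OF inj_adjacent[OF inj]])
    moreover have "tile_with_labels n \<theta> {w k, w (Suc k)} R" using R(2) xy(1) by simp
    ultimately show ?thesis using k'(2,3) R(1) by blast
  qed
  have ne: "w i \<noteq> w j" if "i \<noteq> j" for i j using inj that by (simp add: inj_eq)
  show ?thesis
    unfolding extremal_def
  proof (intro conjI allI impI)
    fix k assume "odd k \<and> k < 2 * m"
    then show "w (Suc k) < w k" using desc by blast
  next
    fix i k assume k: "odd k \<and> k < 2 * m \<and> 1 \<le> i \<and> i < k"
    show "w i < w k"
    proof (rule ccontr)
      assume "\<not> w i < w k"
      then have "w k < w i" using ne[of i k] k by simp
      then obtain T' R P z where T': "weak_tiling w T'" and R: "R \<in> T'" "right_edge R (V w (k - 1)) (w k)" "right_edge R P z" "w k < z"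
        using weak_tiling_lower[OF w, of i k] k n by auto
      have t: "T' \<in> rhombic_tilings n \<theta> w" using weak_tiling_rhombic[OF w fs T'] .
      interpret T': tiling n \<theta> w T' using tilingI[OF w t] .
      obtain R' where R': "R' \<in> T'" "right_edge R' (V w (k - 1)) (w k)" "tile_with_labels n \<theta> {w k, w (Suc k)} R'"
        using forced[OF _ _ t, of k] k by blast
      have "R' = R" using T'.right_edge_unique[OF R'(1) R(1) R'(2) R(2)] .
      \<comment> \<open>The forced tile on the edge \<open>k\<close> has no label above
        \<open>w k\<close>, since position \<open>k\<close> is a descent, whereas the constructed
        tile on this edge has one.\<close>
      then have "z \<in> {w k, w (Suc k)}" using right_edge_tile_label R' R by blast
      then show False using R(4) desc[of k] k by auto
    qed
  next
    fix k l assume k: "even k \<and> 1 \<le> k \<and> k < l \<and> l \<le> 2 * m"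
    then obtain j where j: "k = Suc j" "odd j" by (cases k) auto
    show "w k < w l"
    proof (rule ccontr)
      assume "\<not> w k < w l"
      then have "w l < w k" using ne[of k l] k by simp
      then obtain T' R P z where T': "weak_tiling w T'" and R: "R \<in> T'" "right_edge R (V w (k - 1)) (w k)" "right_edge R P z" "z < w k"
        using weak_tiling_upper[OF w, of k l] k n by auto
      have t: "T' \<in> rhombic_tilings n \<theta> w" using weak_tiling_rhombic[OF w fs T'] .
      interpret T': tiling n \<theta> w T' using tilingI[OF w t] .
      obtain R' where R': "R' \<in> T'" "right_edge R' (V w j) (w k)" "tile_with_labels n \<theta> {w j, w k} R'"
        using forced[OF _ _ t, of j] k j by auto
      have "R' = R" using T'.right_edge_unique[OF R'(1) R(1) R'(2)] R(2) j by simp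
      \<comment> \<open>Dually, the forced tile on the edge \<open>k\<close> has no label below
        \<open>w k\<close>, because \<open>w k < w j\<close>.\<close>
      then have "z \<in> {w j, w k}" using right_edge_tile_label R' R by blast
      then show False using R(4) desc[of j] k j by auto
    qed
  qed
qed

end

theorem theorem5p7:
  fixes m :: nat and \<theta> :: "nat \<Rightarrow> real"
  assumes "m \<ge> 1" and "side_angles (2 * m) \<theta>"
  shows "bij_betw (phi m)
           {v. v permutes {1..2 * m - 2} \<and> avoids_321 (2 * m - 2) v \<and> alternating (2 * m - 2) v}
           {w. w permutes {1..2 * m} \<and> fully_supported (2 * m) w \<and>
               avoids_321 (2 * m) w \<and> alternating (2 * m) w}
       \<and> real (card {w. w permutes {1..2 * m} \<and> fully_supported (2 * m) w \<and>
               card (forced_right_perimeter_tiles (2 * m) \<theta> w) = m}) = catalan (m - 1)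
       \<and> {w. w permutes {1..2 * m} \<and> fully_supported (2 * m) w \<and>
               card (forced_right_perimeter_tiles (2 * m) \<theta> w) = m}
           = {w. w permutes {1..2 * m} \<and> fully_supported (2 * m) w \<and>
               avoids_321 (2 * m) w \<and> alternating (2 * m) w}
       \<and> real (card {w. w permutes {1..2 * m} \<and> fully_supported (2 * m) w \<and>
               avoids_321 (2 * m) w \<and> alternating (2 * m) w}) = catalan (m - 1)"
proof -
  let ?A = "{v. v permutes {1..2 * m - 2} \<and> avoids_321 (2 * m - 2) v \<and> alternating (2 * m - 2) v}"
  let ?B = "{w. w permutes {1..2 * m} \<and> fully_supported (2 * m) w \<and> avoids_321 (2 * m) w \<and> alternating (2 * m) w}"
  let ?C = "{w. w permutes {1..2 * m} \<and> fully_supported (2 * m) w \<and> card (forced_right_perimeter_tiles (2 * m) \<theta> w) = m}"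
  interpret side_directions "2 * m" \<theta> using assms by unfold_locales auto
  have bij: "bij_betw (phi m) ?A ?B" using bij_betw_phi[OF assms(1)] .
  have "?A = {v. v permutes {1..2 * (m - 1)} \<and> extremal (m - 1) v}"
    using extremal_iff[of _ "m - 1"] by (auto simp: right_diff_distrib')
  then have "real (card ?A) = catalan (m - 1)" using card_extremal[of "m - 1"] by simp
  then have B: "real (card ?B) = catalan (m - 1)" using bij_betw_same_card[OF bij] by simp
  have C: "?C = ?B"
    using forced_of_extremal[OF refl] extremal_of_forced[OF refl] extremal_iff[of _ m] by blast
  show ?thesis using bij B C by simp
qed

end
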